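(* Let $(X,\mathcal F)$ be a compact Polish foliated space, let $X_0\subset X$ be the union of the leaves without holonomy, and let $X_{0,\mathrm d}\subset X_0$ be the union of the leaves that are dense and without holonomy. The following properties hold: (i) Suppose that $(X,\mathcal F)$ is transitive. If there is a growth symmetric leaf in $X_{0,\mathrm d}$, then all leaves in $X_{0,\mathrm d}$ have equi-equivalent growth. (ii) Suppose that $(X,\mathcal F)$ is minimal. If all leaves in $X_{0,\mathrm d}$ have equi-equivalent growth, then all leaves in $X_0$ are equi-growth symmetric.
   Context: Foliated spaces. A (topological) foliated structure $\mathcal F$ of dimension $n$ on a space $X$ is given by an atlas $\{(U_i,\phi_i)\}$, where $\{U_i\}$ is an open cover of $X$ and $\phi_i:U_i\to B_i\times Z_i$ are homeomorphisms, with $B_i\subset\mathbb R^n$ an open ball and $Z_i$ a locally compact Polish space, whose changes of coordinates are locally of the form $\phi_j\phi_i^{-1}(x,z)=(x_{ij}(x,z),h_{ij}(z))$. The sets $\phi_i^{-1}(B_i\times\{z\})$ are the plaques; the leaves are the connected components of $X$ with the (leaf) topology whose basic open sets are the plaques of all foliated charts. $L_x$ is the leaf through $x$. $(X,\mathcal F)$ is a compact Polish foliated space if $X$ is compact, Hausdorff and second countable. It is transitive if some leaf is dense in $X$, and minimal if every leaf is dense in $X$. Regular atlas and holonomy. A foliated atlas $\mathcal U=\{(U_i,\phi_i)\}$ is regular if: each $(U_i,\phi_i)$ is the restriction of a foliated chart $(\widetilde U_i,\tilde\phi_i)$ with $\overline{U_i}\subset\widetilde U_i$; $\{U_i\}$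 is locally finite; and the closure of every plaque of $(U_i,\phi_i)$ meets at most the closure of one plaque of $(U_j,\phi_j)$, for all $i,j$. Let $p_i:U_i\to Z_i$ be $\phi_i$ followed by the second projection; there are homeomorphisms $h_{ij}:p_i(U_i\cap U_j)\to p_j(U_i\cap U_j)$ with $p_j=h_{ij}p_i$ on $U_i\cap U_j$, generating the holonomy pseudogroup $\mathcal H$ on $\bigsqcup_iZ_i$. The holonomy group of the leaf through $x\in U_i$ is the group of germs at $p_i(x)$ of maps in $\mathcal H$ fixing $p_i(x)$; a leaf is without holonomy if this group is trivial. Leaf metrics and growth. Fix a regular foliated atlas $\mathcal U$. For $x,y$ in the same leaf, $d^*_{\mathcal U}(x,y)=0$ if $x=y$, and otherwise it is the minimum number of $\mathcal U$-plaques whose union is connected and contains $x$ and $y$. For $x\in X$ and $r>0$, $v_{\mathcal U}(x,r)$ is the number of $\mathcal U$-plaques that meet the ball of center $x$ and radius $r$ in $(L_x,d^*_{\mathcal U})$. A non-decreasing function $u:\mathbb R^+\to\mathbb R^+$ is dominated by another one $v$ if there are $a,b\ge1$ and $c>0$ with $u(r)\le a\,v(br)$ for all $r\ge c$; the functions in a family equi-dominate one another if each one is dominated by each other with the same constants $a,b,c$. A family of leaves has equi-equivalent growth if one can choose a point $x_L$ in each leaf $L$ of the family so that the functions $r\mapsto v_{\mathcal U}(x_L,r)$ equi-dominate one another. A leaf $L$ is growth symmetric if the functions $r\mapsto v_{\mathcal U}(x,r)$, for all $x\in L$, equi-dominate one another. A family of leaves is equi-growth symmetric if the functions $r\mapsto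 v_{\mathcal U}(x,r)$, for all points $x$ of all leaves of the family, equi-dominate one another. These notions do not depend on the choice of $\mathcal U$. *)

theory Defs
  imports "HOL-Analysis.Analysis"
begin

section \<open>Foliated structures\<close>

text \<open>
  A chart is an open set of the space together with a homeomorphism onto the product of an open
  ball of \<open>\<real>\<^sup>n\<close> and a local transversal.  The transversals of all charts are topologies on
  (subsets of) one common type \<open>'z\<close>, which is a type variable everywhere. This is no restriction,
  since every Polish space is homeomorphic to a subspace of \<open>nat \<Rightarrow> real\<close>.
  The chart map is only relevant on the domain of the chart.
\<close>

record ('a, 'z) chart =
  chart_dom :: "'a set"
  chart_ball :: "(nat \<Rightarrow> real) set"
  chart_trans :: "'z topology"
  chart_map :: "'a \<Rightarrow> (nat \<Rightarrow> real) \<times> 'z"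

text \<open>\<open>Euclidean_space n\<close> consists of the functions \<open>nat \<Rightarrow> real\<close> vanishing from \<open>n\<close> on, so that
  \<open>n\<close> is an arbitrary natural number (including 0).\<close>

definition open_ball :: "nat \<Rightarrow> (nat \<Rightarrow> real) set \<Rightarrow> bool" where
  "open_ball n B \<longleftrightarrow>
     (\<exists>a\<in>topspace (Euclidean_space n). \<exists>r>0.
        B = {x \<in> topspace (Euclidean_space n). sqrt (\<Sum>i<n. (x i - a i)\<^sup>2) < r})"

definition locally_compact_Polish :: "'z topology \<Rightarrow> bool" where
  "locally_compact_Polish Z \<longleftrightarrow>
     locally_compact_space Z \<and> completely_metrizable_space Z \<and> second_countable Z"

definition foliated_chart :: "'a topology \<Rightarrow> nat \<Rightarrow> ('a, 'z) chart \<Rightarrow> bool" where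
  "foliated_chart X n c \<longleftrightarrow>
     openin X (chart_dom c) \<and> open_ball n (chart_ball c) \<and> locally_compact_Polish (chart_trans c) \<and>
     homeomorphic_map (subtopology X (chart_dom c))
       (prod_topology (subtopology (Euclidean_space n) (chart_ball c)) (chart_trans c))
       (chart_map c)"

text \<open>The change of coordinates from \<open>c\<close> to \<open>d\<close> is locally of the form
  \<open>(x, z) \<mapsto> (\<xi> (x, z), h z)\<close>. Continuity of \<open>\<xi>\<close> and \<open>h\<close> (on small product
  neighbourhoods) follows from that of the change of coordinates.\<close>

definition foliated_change :: "'a topology \<Rightarrow> ('a, 'z) chart \<Rightarrow> ('a, 'z) chart \<Rightarrow> bool" where
  "foliated_change X c d \<longleftrightarrow>
     (\<forall>p \<in> chart_dom c \<inter> chart_dom d.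
        \<exists>V \<xi> h. openin X V \<and> p \<in> V \<and> V \<subseteq> chart_dom c \<inter> chart_dom d \<and>
          (\<forall>q\<in>V. \<forall>x z. chart_map c q = (x, z) \<longrightarrow> chart_map d q = (\<xi> (x, z), h z)))"

definition foliated_atlas :: "'a topology \<Rightarrow> nat \<Rightarrow> ('a, 'z) chart set \<Rightarrow> bool" where
  "foliated_atlas X n \<A> \<longleftrightarrow>
     (\<forall>c\<in>\<A>. foliated_chart X n c) \<and>
     (\<Union>c\<in>\<A>. chart_dom c) = topspace X \<and>
     (\<forall>c\<in>\<A>. \<forall>d\<in>\<A>. foliated_change X c d)"

text \<open>A foliated structure is represented by the set of all its foliated charts, that is, all
  charts that are compatible with a given foliated atlas.\<close>

definition foliated_structure :: "'a topology \<Rightarrow> nat \<Rightarrow> ('a, 'z) chart set \<Rightarrow> bool" where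
  "foliated_structure X n \<F> \<longleftrightarrow>
     (\<exists>\<A>. foliated_atlas X n \<A> \<and>
        \<F> = {c. foliated_chart X n c \<and> (\<forall>d\<in>\<A>. foliated_change X c d \<and> foliated_change X d c)})"

definition compact_Polish_foliated_space ::
    "'a topology \<Rightarrow> nat \<Rightarrow> ('a, 'z) chart set \<Rightarrow> bool" where
  "compact_Polish_foliated_space X n \<F> \<longleftrightarrow>
     compact_space X \<and> Hausdorff_space X \<and> second_countable X \<and> foliated_structure X n \<F>"

definition plaque :: "('a, 'z) chart \<Rightarrow> 'z \<Rightarrow> 'a set" where
  "plaque c z = {x \<in> chart_dom c. chart_map c x \<in> chart_ball c \<times> {z}}"

definition chart_plaques :: "('a, 'z) chart \<Rightarrow> 'a set set" where
  "chart_plaques c = plaque c ` topspace (chart_trans c)"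

definition plaques :: "('a, 'z) chart set \<Rightarrow> 'a set set" where
  "plaques \<A> = (\<Union>c\<in>\<A>. chart_plaques c)"

definition leaf_topology :: "('a, 'z) chart set \<Rightarrow> 'a topology" where
  "leaf_topology \<F> = topology_generated_by (plaques \<F>)"

definition leaves :: "('a, 'z) chart set \<Rightarrow> 'a set set" where
  "leaves \<F> = connected_components_of (leaf_topology \<F>)"

definition leaf_through :: "('a, 'z) chart set \<Rightarrow> 'a \<Rightarrow> 'a set" where
  "leaf_through \<F> x = connected_component_of_set (leaf_topology \<F>) x"

definition dense_leaf :: "'a topology \<Rightarrow> 'a set \<Rightarrow> bool" where
  "dense_leaf X L \<longleftrightarrow> X closure_of L = topspace X"

definition transitive_foliation :: "'a topology \<Rightarrow> ('a, 'z) chart set \<Rightarrow> bool" where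
  "transitive_foliation X \<F> \<longleftrightarrow> (\<exists>L\<in>leaves \<F>. dense_leaf X L)"

definition minimal_foliation :: "'a topology \<Rightarrow> ('a, 'z) chart set \<Rightarrow> bool" where
  "minimal_foliation X \<F> \<longleftrightarrow> (\<forall>L\<in>leaves \<F>. dense_leaf X L)"

section \<open>Regular atlases and holonomy\<close>

definition chart_restriction :: "('a, 'z) chart \<Rightarrow> ('a, 'z) chart \<Rightarrow> bool" where
  "chart_restriction c d \<longleftrightarrow>
     chart_dom c \<subseteq> chart_dom d \<and> (\<forall>x\<in>chart_dom c. chart_map c x = chart_map d x)"

text \<open>Local finiteness is that of the family of chart domains indexed by the charts, not of the
  set of these domains.\<close>

definition regular_foliated_atlas ::
    "'a topology \<Rightarrow> nat \<Rightarrow> ('a, 'z) chart set \<Rightarrow> ('a, 'z) chart set \<Rightarrow> bool" where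
  "regular_foliated_atlas X n \<F> \<U> \<longleftrightarrow>
     foliated_atlas X n \<U> \<and> \<U> \<subseteq> \<F> \<and>
     (\<forall>c\<in>\<U>. \<exists>d\<in>\<F>. chart_restriction c d \<and> X closure_of (chart_dom c) \<subseteq> chart_dom d) \<and>
     (\<forall>x\<in>topspace X. \<exists>V. openin X V \<and> x \<in> V \<and> finite {c\<in>\<U>. chart_dom c \<inter> V \<noteq> {}}) \<and>
     (\<forall>c\<in>\<U>. \<forall>d\<in>\<U>. \<forall>P\<in>chart_plaques c. \<forall>Q\<in>chart_plaques d. \<forall>Q'\<in>chart_plaques d.
        X closure_of P \<inter> X closure_of Q \<noteq> {} \<and> X closure_of P \<inter> X closure_of Q' \<noteq> {} \<longrightarrow> Q = Q')"

definition transversal_proj :: "('a, 'z) chart \<Rightarrow> 'a \<Rightarrow> 'z" where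
  "transversal_proj c x = snd (chart_map c x)"

definition total_transversal :: "('a, 'z) chart set \<Rightarrow> (('a, 'z) chart \<times> 'z) topology" where
  "total_transversal \<U> = sum_topology chart_trans \<U>"

text \<open>Local homeomorphisms of the total transversal are represented by their graphs. The following
  is the graph of the elementary holonomy map from the transversal of \<open>c\<close> to that of \<open>d\<close>.\<close>

definition elementary_holonomy ::
    "('a, 'z) chart \<Rightarrow> ('a, 'z) chart \<Rightarrow> (('a, 'z) chart \<times> 'z) rel" where
  "elementary_holonomy c d =
     {((c, transversal_proj c x), (d, transversal_proj d x)) | x. x \<in> chart_dom c \<inter> chart_dom d}"

text \<open>The generated pseudogroup: closed under composition, inversion, restriction to open sets and
  combination of families whose union is again (the graph of) an injective map.\<close>

inductive_set holonomy_pseudogroup ::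
    "('a, 'z) chart set \<Rightarrow> (('a, 'z) chart \<times> 'z) rel set"
  for \<U> :: "('a, 'z) chart set" where
  generator: "c \<in> \<U> \<Longrightarrow> d \<in> \<U> \<Longrightarrow> elementary_holonomy c d \<in> holonomy_pseudogroup \<U>"
| identity: "Id_on (topspace (total_transversal \<U>)) \<in> holonomy_pseudogroup \<U>"
| composition: "g \<in> holonomy_pseudogroup \<U> \<Longrightarrow> h \<in> holonomy_pseudogroup \<U> \<Longrightarrow>
    g O h \<in> holonomy_pseudogroup \<U>"
| inversion: "h \<in> holonomy_pseudogroup \<U> \<Longrightarrow> h\<inverse> \<in> holonomy_pseudogroup \<U>"
| restriction: "h \<in> holonomy_pseudogroup \<U> \<Longrightarrow> openin (total_transversal \<U>) W \<Longrightarrow>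
    h \<inter> (W \<times> UNIV) \<in> holonomy_pseudogroup \<U>"
| combination: "\<forall>h\<in>\<G>. h \<in> holonomy_pseudogroup \<U> \<Longrightarrow>
    single_valued (\<Union>\<G>) \<Longrightarrow> single_valued ((\<Union>\<G>)\<inverse>) \<Longrightarrow> \<Union>\<G> \<in> holonomy_pseudogroup \<U>"

definition holonomy_germ ::
    "('a, 'z) chart set \<Rightarrow> ('a, 'z) chart \<times> 'z \<Rightarrow> (('a, 'z) chart \<times> 'z) rel \<Rightarrow>
      (('a, 'z) chart \<times> 'z) rel set" where
  "holonomy_germ \<U> t h =
     {g \<in> holonomy_pseudogroup \<U>.
        \<exists>W. openin (total_transversal \<U>) W \<and> t \<in> W \<and> g \<inter> (W \<times> UNIV) = h \<inter> (W \<times> UNIV)}"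

text \<open>Only the underlying set of the holonomy group is needed to express its triviality; its neutral
  element is the germ of the identity.\<close>

definition holonomy_group ::
    "('a, 'z) chart set \<Rightarrow> ('a, 'z) chart \<times> 'z \<Rightarrow> (('a, 'z) chart \<times> 'z) rel set set" where
  "holonomy_group \<U> t = {holonomy_germ \<U> t h | h. h \<in> holonomy_pseudogroup \<U> \<and> (t, t) \<in> h}"

definition without_holonomy :: "('a, 'z) chart set \<Rightarrow> 'a set \<Rightarrow> bool" where
  "without_holonomy \<U> L \<longleftrightarrow>
     (\<forall>x\<in>L. \<forall>c\<in>\<U>. x \<in> chart_dom c \<longrightarrow>
        (let t = (c, transversal_proj c x) in
           holonomy_group \<U> t = {holonomy_germ \<U> t (Id_on (topspace (total_transversal \<U>)))}))"

definition X_0 :: "('a, 'z) chart set \<Rightarrow> ('a, 'z) chart set \<Rightarrow> 'a set" where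
  "X_0 \<F> \<U> = \<Union>{L \<in> leaves \<F>. without_holonomy \<U> L}"

definition X_0d :: "'a topology \<Rightarrow> ('a, 'z) chart set \<Rightarrow> ('a, 'z) chart set \<Rightarrow> 'a set" where
  "X_0d X \<F> \<U> = \<Union>{L \<in> leaves \<F>. dense_leaf X L \<and> without_holonomy \<U> L}"

definition leaves_in :: "('a, 'z) chart set \<Rightarrow> 'a set \<Rightarrow> 'a set set" where
  "leaves_in \<F> Y = {L \<in> leaves \<F>. L \<subseteq> Y}"

section \<open>Leaf metrics and growth\<close>

text \<open>Connectedness of unions of plaques refers to the leaf topology. The value is only meaningful
  for points of the same leaf.\<close>

definition leaf_dist ::
    "('a, 'z) chart set \<Rightarrow> ('a, 'z) chart set \<Rightarrow> 'a \<Rightarrow> 'a \<Rightarrow> nat" where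
  "leaf_dist \<F> \<U> x y =
     (if x = y then 0
      else LEAST k. \<exists>\<P>. \<P> \<subseteq> plaques \<U> \<and> finite \<P> \<and> card \<P> = k \<and>
                       connectedin (leaf_topology \<F>) (\<Union>\<P>) \<and> x \<in> \<Union>\<P> \<and> y \<in> \<Union>\<P>)"

definition leaf_ball ::
    "('a, 'z) chart set \<Rightarrow> ('a, 'z) chart set \<Rightarrow> 'a \<Rightarrow> real \<Rightarrow> 'a set" where
  "leaf_ball \<F> \<U> x r = {y \<in> leaf_through \<F> x. real (leaf_dist \<F> \<U> x y) < r}"

definition leaf_growth ::
    "('a, 'z) chart set \<Rightarrow> ('a, 'z) chart set \<Rightarrow> 'a \<Rightarrow> real \<Rightarrow> real" where
  "leaf_growth \<F> \<U> x r = real (card {P \<in> plaques \<U>. P \<inter> leaf_ball \<F> \<U> x r \<noteq> {}})"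

definition dominated_with :: "real \<Rightarrow> real \<Rightarrow> real \<Rightarrow> (real \<Rightarrow> real) \<Rightarrow> (real \<Rightarrow> real) \<Rightarrow> bool" where
  "dominated_with a b c u v \<longleftrightarrow> (\<forall>r\<ge>c. u r \<le> a * v (b * r))"

definition equi_dominate :: "(real \<Rightarrow> real) set \<Rightarrow> bool" where
  "equi_dominate S \<longleftrightarrow>
     (\<exists>a b c. a \<ge> 1 \<and> b \<ge> 1 \<and> c > 0 \<and> (\<forall>u\<in>S. \<forall>v\<in>S. dominated_with a b c u v))"

definition equi_equivalent_growth ::
    "('a, 'z) chart set \<Rightarrow> ('a, 'z) chart set \<Rightarrow> 'a set set \<Rightarrow> bool" where
  "equi_equivalent_growth \<F> \<U> \<L> \<longleftrightarrow>
     (\<exists>pt. (\<forall>L\<in>\<L>. pt L \<in> L) \<and> equi_dominate ((\<lambda>L. leaf_growth \<F> \<U> (pt L)) ` \<L>))"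

definition growth_symmetric ::
    "('a, 'z) chart set \<Rightarrow> ('a, 'z) chart set \<Rightarrow> 'a set \<Rightarrow> bool" where
  "growth_symmetric \<F> \<U> L \<longleftrightarrow> equi_dominate (leaf_growth \<F> \<U> ` L)"

definition equi_growth_symmetric ::
    "('a, 'z) chart set \<Rightarrow> ('a, 'z) chart set \<Rightarrow> 'a set set \<Rightarrow> bool" where
  "equi_growth_symmetric \<F> \<U> \<L> \<longleftrightarrow> equi_dominate (leaf_growth \<F> \<U> ` \<Union>\<L>)"

end

theory Submission
  imports Defs
begin

text \<open>
  Plaques are encoded by their points \<open>t\<close> in the total transversal, two of them being adjacent when
  they meet; up to universal constants the growth function of a leaf at \<open>x\<close> counts the vertices at
  graph distance at most \<open>m\<close> from a plaque through \<open>x\<close>. Words in the elementary holonomy maps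
  transport paths in this graph to nearby plaques. Distinct end points stay distinct, so the count
  is lower semicontinuous. At a plaque without holonomy, coinciding end points stay equal, and if
  the charts are first shrunk to compact cores no new path appears nearby, so the count is also
  upper semicontinuous up to a linear rescaling of the radius.

  Hence a comparison with a fixed function that holds with uniform constants on a set of points
  extends to the points without holonomy in its closure, which gives (i) at once. For (ii), the
  points without holonomy are covered by countably many sets on which the comparison is uniform.
  They form a residual set, so by Baire's theorem one of these sets is dense in some nonempty open
  set; by minimality and compactness every leaf returns to this open set within bounded distance
  of each of its points.
\<close>

section \<open>Finite relations, connected covers and topology\<close>

text \<open>Both semicontinuity statements concern one radius at a time. The neighbourhood on which
  they hold depends on the radius, but the constants depend neither on the radius nor on the point.
  A limit point can therefore be compared with a different member of the set for each radius, and
  this is why the constants must be uniform on the set.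

  In (ii) only one base point per leaf is controlled. Going from it to another point of the leaf
  shifts the radius by their distance, which has no common bound. A shift by \<open>j\<close> is at
  most a doubling of the radius once \<open>m \<ge> j\<close>, so it raises only the threshold of
  the comparison, which is a natural number, while the other constants stay fixed. Hence the
  countable family of sets for Baire's theorem is indexed by the threshold alone. Once one of them
  is dense in an open set, the remaining shift from any point to that open set is bounded, and the
  same absorption yields one threshold for all points.\<close>

lemma relpow_bound_card:
  assumes "(a, b) \<in> r\<^sup>*" "r \<subseteq> V \<times> V" "finite V" "a \<in> V"
  shows "\<exists>j<card V. (a, b) \<in> r ^^ j"
proof -
  define d where "d b = (LEAST j. (a, b) \<in> r ^^ j)" for b
  have d_le: "d b \<le> j" if "(a, b) \<in> r ^^ j" for b j
    unfolding d_def using that by (rule Least_le)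
  have d_mem: "(a, b) \<in> r ^^ d b" if "(a, b) \<in> r ^^ j" for b j
    unfolding d_def using that by (rule LeastI)
  \<comment> \<open>On a shortest path to \<open>b\<close> every distance \<open>i\<close> up to
    \<open>d b\<close> occurs. So \<open>d\<close> takes at least \<open>d b + 1\<close> values on
    \<open>V\<close>, which bounds \<open>d b\<close>.\<close>
  have surj: "\<exists>v\<in>V. d v = i" if "i \<le> j" "(a, b) \<in> r ^^ j" "d b = j" "b \<in> V" for i j b
    using that
  proof (induction j arbitrary: b)
    case 0 then show ?case by auto
  next
    case (Suc j)
    show ?case
    proof (cases "i = Suc j")
      case True then show ?thesis using Suc.prems by auto
    next
      case False
      obtain v where v: "(a, v) \<in> r ^^ j" "(v, b) \<in> r"
        using Suc.prems(2) by auto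
      have "d v = j"
      proof (rule ccontr)
        assume "d v \<noteq> j"
        then have "Suc (d v) < Suc j" using d_le[OF v(1)] by simp
        moreover have "(a, b) \<in> r ^^ Suc (d v)" using d_mem[OF v(1)] v(2) by auto
        ultimately show False using d_le Suc.prems(3) by (metis not_le)
      qed
      then show ?thesis using Suc.IH[of v] v False Suc.prems(1) assms(2) by auto
    qed
  qed
  obtain j where j: "(a, b) \<in> r ^^ j" using assms(1) rtrancl_imp_relpow by blast
  have bV: "b \<in> V" using assms(1,2,4) by (induction) auto
  have "{..d b} \<subseteq> d ` V" using surj[OF _ d_mem[OF j] refl bV] by blast
  then have "card {..d b} \<le> card (d ` V)" using assms(3) by (intro card_mono) auto
  also have "\<dots> \<le> card V" using assms(3) by (rule card_image_le)
  finally show ?thesis using d_mem[OF j] by (intro exI[of _ "d b"]) auto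
qed

text \<open>The members reachable from \<open>V\<close> through overlaps in \<open>P\<close>, and
  the remaining ones, form two open sets that cover \<open>P\<close> and are disjoint on it; the
  first contains \<open>x\<close>, so the second misses \<open>P\<close>. The bound on the length
  depends only on the cover, so one cover serves many sets \<open>P\<close>.\<close>

lemma connectedin_finite_cover_chain:
  assumes conn: "connectedin X P" and fin: "finite \<V>" and op: "\<And>V. V \<in> \<V> \<Longrightarrow> openin X V"
    and cov: "P \<subseteq> \<Union>\<V>" and V: "V \<in> \<V>" "x \<in> V" "x \<in> P" and W: "W \<in> \<V>" "y \<in> W" "y \<in> P"
  shows "\<exists>j<card \<V>. (V, W) \<in> {(A, B). A \<in> \<V> \<and> B \<in> \<V> \<and> A \<inter> B \<inter> P \<noteq> {}} ^^ j"
proof -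
  define r where "r = {(A, B). A \<in> \<V> \<and> B \<in> \<V> \<and> A \<inter> B \<inter> P \<noteq> {}}"
  define O1 where "O1 = \<Union>{A\<in>\<V>. (V, A) \<in> r\<^sup>*}"
  define O2 where "O2 = \<Union>{A\<in>\<V>. (V, A) \<notin> r\<^sup>*}"
  have open12: "openin X O1" "openin X O2" unfolding O1_def O2_def using op by auto
  have "P \<subseteq> O1 \<union> O2" using cov unfolding O1_def O2_def by blast
  moreover have "O1 \<inter> O2 \<inter> P = {}"
  proof (rule ccontr)
    assume "O1 \<inter> O2 \<inter> P \<noteq> {}"
    then obtain A B where "A \<in> \<V>" "B \<in> \<V>" "(V, A) \<in> r\<^sup>*" "(V, B) \<notin> r\<^sup>*" "A \<inter> B \<inter> P \<noteq> {}"
      unfolding O1_def O2_def by blast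
    then show False unfolding r_def using rtrancl.rtrancl_into_rtrancl[of V A] by fast
  qed
  moreover have "O1 \<inter> P \<noteq> {}" using V unfolding O1_def by blast
  ultimately have "O2 \<inter> P = {}" using conn open12 unfolding connectedin by blast
  then have "(V, W) \<in> r\<^sup>*" using W unfolding O2_def by blast
  then show ?thesis
    using relpow_bound_card[of V W r \<V>] fin V(1) unfolding r_def by blast
qed

lemma relpow_mono_refl_on:
  assumes "\<And>a b. (a, b) \<in> r \<Longrightarrow> (b, b) \<in> r" "(b, b) \<in> r" "(a, b) \<in> r ^^ j" "j \<le> k"
  shows "(a, b) \<in> r ^^ k"
  using assms(4,3) by (induction k rule: dec_induct) (auto intro: assms(2))

lemma relpow_comp: "(a, b) \<in> r ^^ j \<Longrightarrow> (b, c) \<in> r ^^ k \<Longrightarrow> (a, c) \<in> r ^^ (j + k)"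
  by (auto simp: relpow_add)

text \<open>Common core of both semicontinuity proofs. Each end point over \<open>s\<close> is sent
  to the end point over \<open>t\<close> of some map reaching it. This is injective as soon as maps
  that agree at \<open>t\<close> also agree at \<open>s\<close>.\<close>

lemma card_UN_Image_le:
  assumes L: "finite L"
    and sv: "\<And>p. p \<in> L \<Longrightarrow> single_valued (G p)"
    and dom: "\<And>p. p \<in> L \<Longrightarrow> s \<in> Domain (G p) \<Longrightarrow> t \<in> Domain (G p)"
    and eq: "\<And>p q e f g. p \<in> L \<Longrightarrow> q \<in> L \<Longrightarrow> (t, e) \<in> G p \<Longrightarrow> (t, e) \<in> G q \<Longrightarrow>
                (s, f) \<in> G p \<Longrightarrow> (s, g) \<in> G q \<Longrightarrow> f = g"
  shows "card (\<Union>p\<in>L. G p `` {s}) \<le> card (\<Union>p\<in>L. G p `` {t})"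
proof -
  have "\<forall>f\<in>(\<Union>p\<in>L. G p `` {s}). \<exists>e. \<exists>p\<in>L. (s, f) \<in> G p \<and> (t, e) \<in> G p"
    using dom by blast
  then obtain \<phi> where \<phi>: "\<And>f. f \<in> (\<Union>p\<in>L. G p `` {s}) \<Longrightarrow>
      \<exists>p\<in>L. (s, f) \<in> G p \<and> (t, \<phi> f) \<in> G p"
    by metis
  have "inj_on \<phi> (\<Union>p\<in>L. G p `` {s})"
  proof (rule inj_onI)
    fix f g assume "f \<in> (\<Union>p\<in>L. G p `` {s})" "g \<in> (\<Union>p\<in>L. G p `` {s})" "\<phi> f = \<phi> g"
    then show "f = g" using \<phi>[of f] \<phi>[of g] eq by metis
  qed
  moreover have "\<phi> ` (\<Union>p\<in>L. G p `` {s}) \<subseteq> (\<Union>p\<in>L. G p `` {t})" using \<phi> by blast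
  moreover have "finite (\<Union>p\<in>L. G p `` {t})"
  proof (rule finite_UN_I[OF L])
    fix p assume "p \<in> L"
    have "G p `` {t} \<subseteq> {THE e. (t, e) \<in> G p}"
    proof
      fix e assume "e \<in> G p `` {t}"
      then have "(THE e. (t, e) \<in> G p) = e"
        using sv[OF \<open>p \<in> L\<close>] by (intro the_equality) (auto dest: single_valuedD)
      then show "e \<in> {THE e. (t, e) \<in> G p}" by simp
    qed
    then show "finite (G p `` {t})" by (rule finite_subset) simp
  qed
  ultimately show ?thesis by (rule card_inj_on_le)
qed

text \<open>By regularity finitely many open sets with closure inside some \<open>D c\<close> cover
  the space; \<open>M c\<close> collects the closures that fit into \<open>D c\<close>. The
  interiors must still cover, so that a core contains a whole neighbourhood of some of its
  points.\<close>

lemma compact_Hausdorff_shrinking: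
  assumes "compact_space X" "Hausdorff_space X"
    and op: "\<And>c. c \<in> C \<Longrightarrow> openin X (D c)" and cov: "topspace X \<subseteq> (\<Union>c\<in>C. D c)"
  obtains M where "\<And>c. closedin X (M c)" "\<And>c. c \<in> C \<Longrightarrow> M c \<subseteq> D c"
    "\<And>x. x \<in> topspace X \<Longrightarrow> \<exists>c\<in>C. x \<in> X interior_of (M c)"
proof -
  define \<O> where "\<O> = {V. openin X V \<and> (\<exists>c\<in>C. X closure_of V \<subseteq> D c)}"
  have nb: "neighbourhood_base_of (closedin X) X"
    using compact_Hausdorff_imp_regular_space[OF assms(1,2)] neighbourhood_base_of_closedin by blast
  have "topspace X \<subseteq> \<Union>\<O>"
  proof
    fix x assume "x \<in> topspace X"
    then obtain c where c: "c \<in> C" "x \<in> D c" using cov by blast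
    then obtain V K where V: "openin X V" "closedin X K" "x \<in> V" "V \<subseteq> K" "K \<subseteq> D c"
      using nb op[OF c(1)] unfolding neighbourhood_base_of by meson
    then have "X closure_of V \<subseteq> D c" using closure_of_minimal by blast
    then show "x \<in> \<Union>\<O>" using V c unfolding \<O>_def by blast
  qed
  moreover have "\<And>V. V \<in> \<O> \<Longrightarrow> openin X V" unfolding \<O>_def by blast
  ultimately obtain \<O>' where \<O>': "finite \<O>'" "\<O>' \<subseteq> \<O>" "topspace X \<subseteq> \<Union>\<O>'"
    using assms(1) unfolding compact_space_def compactin_def by meson
  define M where "M c = \<Union>((closure_of) X ` {V\<in>\<O>'. X closure_of V \<subseteq> D c})" for c
  show thesis
  proof (rule that)
    show "closedin X (M c)" for c unfolding M_def using \<O>'(1) by (intro closedin_Union) auto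
    show "M c \<subseteq> D c" if "c \<in> C" for c unfolding M_def by blast
  next
    fix x assume "x \<in> topspace X"
    then obtain V where V: "V \<in> \<O>'" "x \<in> V" using \<O>' by blast
    then obtain c where c: "c \<in> C" "X closure_of V \<subseteq> D c" "openin X V"
      using \<O>'(2) unfolding \<O>_def by blast
    have "V \<subseteq> M c"
      using V c closure_of_subset[of V X] openin_subset unfolding M_def by blast
    then have "x \<in> X interior_of (M c)" using V c interior_of_maximal by blast
    then show "\<exists>c\<in>C. x \<in> X interior_of (M c)" using c by blast
  qed
qed

lemma connectedin_open_ball:
  assumes "open_ball n B"
  shows "connectedin (Euclidean_space n) B"
proof -
  obtain a r where a: "a \<in> topspace (Euclidean_space n)" and r: "r > 0"
    and B: "B = {x \<in> topspace (Euclidean_space n). sqrt (\<Sum>i<n. (x i - a i)\<^sup>2) < r}"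
    using assms unfolding open_ball_def by blast
  define seg where "seg x = (\<lambda>s i. if i < n then a i + s * (x i - a i) else 0) ` {0..1::real}" for x
  have conn: "connectedin (Euclidean_space n) (seg x)" for x
    unfolding seg_def
  proof (rule connectedin_continuous_map_image)
    show "continuous_map (top_of_set {0..1}) (Euclidean_space n)
        (\<lambda>s i. if i < n then a i + s * (x i - a i) else 0)"
      by (subst continuous_map_componentwise_Euclidean_space)
        (auto intro!: continuous_intros simp: continuous_map_iff_continuous)
    show "connectedin (top_of_set {0..1::real}) {0..1}"
      by (simp add: connectedin_subtopology)
  qed
  have ends: "a \<in> seg x" "x \<in> seg x" if "x \<in> B" for x
  proof -
    have ax: "\<And>i. i \<ge> n \<Longrightarrow> a i = 0" "\<And>i. i \<ge> n \<Longrightarrow> x i = 0"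
      using a that B by (auto simp: topspace_Euclidean_space)
    show "a \<in> seg x" unfolding seg_def
      by (rule image_eqI[of _ _ 0]) (auto simp: fun_eq_iff ax)
    show "x \<in> seg x" unfolding seg_def
      by (rule image_eqI[of _ _ 1]) (auto simp: fun_eq_iff ax)
  qed
  have sub: "seg x \<subseteq> B" if "x \<in> B" for x
  proof
    fix y assume "y \<in> seg x"
    then obtain s where s: "0 \<le> s" "s \<le> 1" and y: "y = (\<lambda>i. if i < n then a i + s * (x i - a i) else 0)"
      unfolding seg_def by auto
    have "(\<Sum>i<n. (y i - a i)\<^sup>2) = (\<Sum>i<n. s\<^sup>2 * (x i - a i)\<^sup>2)"
      by (rule sum.cong) (auto simp: y power_mult_distrib)
    also have "\<dots> \<le> (\<Sum>i<n. 1 * (x i - a i)\<^sup>2)"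
      using s by (intro sum_mono mult_right_mono) (auto simp: power_le_one)
    finally have "sqrt (\<Sum>i<n. (y i - a i)\<^sup>2) \<le> sqrt (\<Sum>i<n. (x i - a i)\<^sup>2)" by simp
    also have "\<dots> < r" using that B by simp
    finally show "y \<in> B" unfolding B by (simp add: topspace_Euclidean_space y)
  qed
  have "B = \<Union>(seg ` B)" using ends sub by blast
  moreover have "connectedin (Euclidean_space n) (\<Union>(seg ` B))"
  proof (cases "B = {}")
    case False
    have "a \<in> \<Inter>(seg ` B)" using ends by blast
    then show ?thesis using conn by (intro connectedin_Union) auto
  qed simp
  ultimately show ?thesis by simp
qed

section \<open>Words in families of partial maps\<close>

fun word_rel :: "'v set \<Rightarrow> ('c \<Rightarrow> 'c \<Rightarrow> 'v rel) \<Rightarrow> ('c \<times> 'c) list \<Rightarrow> 'v rel" where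
  "word_rel S e [] = Id_on S"
| "word_rel S e (p # ps) = e (fst p) (snd p) O word_rel S e ps"

lemma word_rel_subset:
  assumes "\<And>c d. e c d \<subseteq> S \<times> S"
  shows "word_rel S e ps \<subseteq> S \<times> S"
proof (induction ps)
  case (Cons p ps)
  then show ?case using assms[of "fst p" "snd p"] by auto
qed auto

lemma word_rel_append:
  assumes "\<And>c d. e c d \<subseteq> S \<times> S"
  shows "word_rel S e (ps @ qs) = word_rel S e ps O word_rel S e qs"
proof (induction ps)
  case Nil
  have "word_rel S e qs \<subseteq> S \<times> S" by (rule word_rel_subset) (rule assms)
  then show ?case by auto
qed (auto simp: O_assoc)

lemma word_rel_singleton:
  assumes "\<And>c d. e c d \<subseteq> S \<times> S"
  shows "word_rel S e [(c, d)] = e c d"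
  using assms by fastforce

lemma word_rel_converse:
  assumes sub: "\<And>c d. e c d \<subseteq> S \<times> S" and conv: "\<And>c d. (e c d)\<inverse> = e d c"
  shows "(word_rel S e ps)\<inverse> = word_rel S e (map prod.swap (rev ps))"
proof (induction ps)
  case (Cons p ps)
  have "(word_rel S e (p # ps))\<inverse> = word_rel S e (map prod.swap (rev ps)) O e (snd p) (fst p)"
    by (simp add: converse_relcomp Cons conv)
  also have "\<dots> = word_rel S e (map prod.swap (rev (p # ps)))"
    by (simp only: rev.simps map_append word_rel_append[OF sub])
      (simp add: word_rel_singleton[OF sub] prod.swap_def del: word_rel.simps)
  finally show ?case .
qed auto

lemma word_rel_single_valued:
  assumes "\<And>c d. c \<in> C \<Longrightarrow> d \<in> C \<Longrightarrow> single_valued (e c d)" "ps \<in> lists (C \<times> C)"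
  shows "single_valued (word_rel S e ps)"
  using assms(2)
proof (induction ps)
  case (Cons p ps)
  then have "single_valued (e (fst p) (snd p))" "single_valued (word_rel S e ps)"
    using assms(1)[of "fst p" "snd p"] by (auto simp: mem_Times_iff)
  then show ?case using single_valued_relcomp by simp
qed auto

lemma word_rel_mono:
  assumes "\<And>c d. c \<in> C \<Longrightarrow> d \<in> C \<Longrightarrow> e c d \<subseteq> e' c d" "ps \<in> lists (C \<times> C)"
  shows "word_rel S e ps \<subseteq> word_rel S e' ps"
  using assms(2)
proof (induction ps)
  case (Cons p ps)
  then show ?case using assms(1)[of "fst p" "snd p"] by (auto, blast)
qed auto

text \<open>\<open>P\<close> will be openness for holonomy words, and closedness for their
  restrictions to compact cores.\<close>

lemma word_rel_preimage:
  assumes "\<And>c d K. c \<in> C \<Longrightarrow> d \<in> C \<Longrightarrow> P K \<Longrightarrow> P ((e c d)\<inverse> `` K)"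
    and "ps \<in> lists (C \<times> C)" "\<And>K. P K \<Longrightarrow> K \<subseteq> S" "P K"
  shows "P ((word_rel S e ps)\<inverse> `` K)"
  using assms(2)
proof (induction ps)
  case Nil
  have "(word_rel S e [])\<inverse> `` K = K" using assms(3)[OF assms(4)] by auto
  then show ?case using assms(4) by simp
next
  case (Cons p ps)
  have "(word_rel S e (p # ps))\<inverse> `` K = (e (fst p) (snd p))\<inverse> `` ((word_rel S e ps)\<inverse> `` K)"
    by auto
  then show ?case using Cons assms(1)[of "fst p" "snd p"] by (auto simp: mem_Times_iff)
qed

text \<open>Turns the points reached in \<open>m\<close> steps of a graph into images of one point
  under words. When \<open>C\<close> is finite there are finitely many words of length
  \<open>m\<close>, so local properties of the single maps pass to the whole set.\<close>

lemma relpow_UN_word_rel: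
  assumes sub: "\<And>c d. e c d \<subseteq> S \<times> S" and t: "t \<in> S"
  shows "((\<Union>c\<in>C. \<Union>d\<in>C. e c d) ^^ m) `` {t} =
    (\<Union>ps\<in>{ps \<in> lists (C \<times> C). length ps = m}. word_rel S e ps `` {t})"
proof -
  define R where "R = (\<Union>c\<in>C. \<Union>d\<in>C. e c d)"
  have "(t, u) \<in> R ^^ m \<longleftrightarrow> (\<exists>ps\<in>lists (C \<times> C). length ps = m \<and> (t, u) \<in> word_rel S e ps)" for u
    using t
  proof (induction m arbitrary: t)
    case 0
    show ?case
    proof
      assume "(t, u) \<in> R ^^ 0"
      then show "\<exists>ps\<in>lists (C \<times> C). length ps = 0 \<and> (t, u) \<in> word_rel S e ps"
        using 0 by (intro bexI[of _ "[]"]) auto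
    qed auto
  next
    case (Suc m)
    show ?case
    proof
      assume "(t, u) \<in> R ^^ Suc m"
      then obtain s where "(t, s) \<in> R" and su: "(s, u) \<in> R ^^ m"
        using relpow_Suc_D2[of t u m R] by metis
      then obtain c d where cd: "c \<in> C" "d \<in> C" "(t, s) \<in> e c d" unfolding R_def by blast
      then have "s \<in> S" using sub by blast
      then obtain ps where "ps \<in> lists (C \<times> C)" "length ps = m" "(s, u) \<in> word_rel S e ps"
        using Suc.IH[of s] su by metis
      then show "\<exists>ps\<in>lists (C \<times> C). length ps = Suc m \<and> (t, u) \<in> word_rel S e ps"
        using cd by (intro bexI[of _ "(c, d) # ps"]) auto
    next
      assume "\<exists>ps\<in>lists (C \<times> C). length ps = Suc m \<and> (t, u) \<in> word_rel S e ps"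
      then obtain ps0 where ps0: "ps0 \<in> lists (C \<times> C)" "length ps0 = Suc m" "(t, u) \<in> word_rel S e ps0"
        by blast
      then obtain c d ps where eq: "ps0 = (c, d) # ps" by (cases ps0) auto
      obtain s where s: "(t, s) \<in> e c d" "(s, u) \<in> word_rel S e ps" using ps0 eq by auto
      have mem: "c \<in> C" "d \<in> C" "ps \<in> lists (C \<times> C)" "length ps = m" using ps0 eq by auto
      have "s \<in> S" using s sub by blast
      then have "(s, u) \<in> R ^^ m" using Suc.IH[of s] s mem by metis
      moreover have "(t, s) \<in> R" using s mem unfolding R_def by blast
      ultimately show "(t, u) \<in> R ^^ Suc m" by (rule relpow_Suc_I2[rotated])
    qed
  qed
  then show ?thesis unfolding R_def[symmetric] set_eq_iff by auto
qed

section \<open>Charts and plaques\<close>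

lemma foliated_chart_homeo:
  "foliated_chart X n c \<Longrightarrow> homeomorphic_map (subtopology X (chart_dom c))
     (prod_topology (subtopology (Euclidean_space n) (chart_ball c)) (chart_trans c)) (chart_map c)"
  unfolding foliated_chart_def by blast

lemma foliated_chart_map_image:
  assumes "foliated_chart X n c"
  shows "chart_map c ` chart_dom c = chart_ball c \<times> topspace (chart_trans c)"
    "chart_ball c \<noteq> {}" "chart_ball c \<subseteq> topspace (Euclidean_space n)" "chart_dom c \<subseteq> topspace X"
proof -
  have op: "openin X (chart_dom c)" and b: "open_ball n (chart_ball c)"
    and h: "homeomorphic_map (subtopology X (chart_dom c))
       (prod_topology (subtopology (Euclidean_space n) (chart_ball c)) (chart_trans c))
       (chart_map c)" using assms unfolding foliated_chart_def by blast+
  show D: "chart_dom c \<subseteq> topspace X" using op openin_subset by blast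
  obtain a r where a: "a \<in> topspace (Euclidean_space n)" "r > 0"
    "chart_ball c = {x \<in> topspace (Euclidean_space n). sqrt (\<Sum>i<n. (x i - a i)\<^sup>2) < r}"
    using b unfolding open_ball_def by blast
  have "a \<in> chart_ball c" unfolding a(3) using a(1,2) by simp
  then show "chart_ball c \<noteq> {}" by blast
  show B: "chart_ball c \<subseteq> topspace (Euclidean_space n)" unfolding a(3) by blast
  show "chart_map c ` chart_dom c = chart_ball c \<times> topspace (chart_trans c)"
    using homeomorphic_imp_surjective_map[OF h]
    unfolding topspace_prod_topology topspace_subtopology Int_absorb1[OF D] Int_absorb1[OF B] .
qed

lemma plaque_eq:
  assumes "foliated_chart X n c"
  shows "plaque c z = {x \<in> chart_dom c. transversal_proj c x = z}"
proof -
  have "chart_map c x \<in> chart_ball c \<times> {z} \<longleftrightarrow> snd (chart_map c x) = z" if "x \<in> chart_dom c" for x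
  proof -
    have "chart_map c x \<in> chart_ball c \<times> topspace (chart_trans c)"
      unfolding foliated_chart_map_image(1)[OF assms, symmetric] using that by (rule imageI)
    then show ?thesis by (simp add: mem_Times_iff)
  qed
  then show ?thesis unfolding plaque_def transversal_proj_def by (intro Collect_cong conj_cong refl)
qed

lemma transversal_proj_in:
  assumes "foliated_chart X n c" "x \<in> chart_dom c"
  shows "transversal_proj c x \<in> topspace (chart_trans c)"
proof -
  have "chart_map c x \<in> chart_ball c \<times> topspace (chart_trans c)"
    unfolding foliated_chart_map_image(1)[OF assms(1), symmetric] using assms(2) by (rule imageI)
  then show ?thesis unfolding transversal_proj_def by (simp add: mem_Times_iff)
qed

lemma transversal_proj_surj:
  assumes "foliated_chart X n c" "z \<in> topspace (chart_trans c)"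
  obtains x where "x \<in> chart_dom c" "transversal_proj c x = z"
proof -
  obtain b where "b \<in> chart_ball c" using foliated_chart_map_image(2)[OF assms(1)] by blast
  then have "(b, z) \<in> chart_map c ` chart_dom c"
    using foliated_chart_map_image(1)[OF assms(1)] assms(2) by auto
  then show thesis using that unfolding transversal_proj_def by (metis imageE snd_conv)
qed

lemma transversal_proj_continuous:
  assumes "foliated_chart X n c"
  shows "continuous_map (subtopology X (chart_dom c)) (chart_trans c) (transversal_proj c)"
proof -
  have "continuous_map (subtopology X (chart_dom c)) (chart_trans c) (snd \<circ> chart_map c)"
    by (rule continuous_map_compose[OF homeomorphic_imp_continuous_map[OF foliated_chart_homeo[OF assms]]
          continuous_map_snd])
  then show ?thesis by (simp add: comp_def transversal_proj_def[abs_def])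
qed

lemma transversal_proj_open:
  assumes "foliated_chart X n c"
  shows "open_map (subtopology X (chart_dom c)) (chart_trans c) (transversal_proj c)"
proof -
  have "open_map (subtopology X (chart_dom c)) (chart_trans c) (snd \<circ> chart_map c)"
    by (rule open_map_compose[OF homeomorphic_imp_open_map[OF foliated_chart_homeo[OF assms]]
          open_map_snd])
  then show ?thesis by (simp add: comp_def transversal_proj_def[abs_def])
qed

text \<open>Connectedness in the topology of \<open>X\<close>, as needed for chains of open sets of
  \<open>X\<close> along a plaque. The leaf topology is finer in general and is treated in
  \<open>connectedin_leaf_pl\<close>.\<close>

lemma connectedin_plaque:
  assumes "foliated_chart X n c"
  shows "connectedin X (plaque c z)"
proof (cases "z \<in> topspace (chart_trans c)")
  case False
  then have "plaque c z = {}"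
    using transversal_proj_in[OF assms] unfolding plaque_eq[OF assms] by blast
  then show ?thesis by simp
next
  case True
  have h: "homeomorphic_map (subtopology X (chart_dom c))
       (prod_topology (subtopology (Euclidean_space n) (chart_ball c)) (chart_trans c))
       (chart_map c)" and b: "open_ball n (chart_ball c)"
    using assms unfolding foliated_chart_def by blast+
  have img: "chart_map c ` plaque c z = chart_ball c \<times> {z}"
  proof (intro subset_antisym subsetI)
    fix q assume q: "q \<in> chart_ball c \<times> {z}"
    then have "q \<in> chart_map c ` chart_dom c"
      unfolding foliated_chart_map_image(1)[OF assms] using True by auto
    then obtain x where "x \<in> chart_dom c" "q = chart_map c x" by (rule imageE)
    then show "q \<in> chart_map c ` plaque c z" using q unfolding plaque_def by (intro image_eqI) simp_all
  qed (auto simp: plaque_def)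
  have "plaque c z \<subseteq> topspace (subtopology X (chart_dom c))"
    using foliated_chart_map_image(4)[OF assms] unfolding plaque_def by auto
  moreover have "connectedin (subtopology (Euclidean_space n) (chart_ball c)) (chart_ball c)"
    using connectedin_open_ball[OF b] by (simp add: connectedin_subtopology)
  ultimately have "connectedin (subtopology X (chart_dom c)) (plaque c z)"
    unfolding homeomorphic_map_connectedness_eq[OF h] img connectedin_Times using True by simp
  then show ?thesis by (simp add: connectedin_subtopology)
qed

section \<open>Regular foliated atlases\<close>

lemma equi_dominate_subset: "equi_dominate S \<Longrightarrow> S' \<subseteq> S \<Longrightarrow> equi_dominate S'"
  unfolding equi_dominate_def by blast

locale regular_foliated_space =
  fixes X :: "'a topology" and n :: nat and \<F> \<U> :: "('a, 'z) chart set"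
  assumes foliated: "compact_Polish_foliated_space X n \<F>"
    and regular: "regular_foliated_atlas X n \<F> \<U>"
begin

abbreviation T :: "(('a, 'z) chart \<times> 'z) topology" where
  "T \<equiv> total_transversal \<U>"

text \<open>Local finiteness puts no bound on the charts with empty domain. The others are finitely
  many by compactness.\<close>

definition \<C> :: "('a, 'z) chart set" where
  "\<C> = {c \<in> \<U>. chart_dom c \<noteq> {}}"

definition pr :: "('a, 'z) chart \<Rightarrow> 'a \<Rightarrow> ('a, 'z) chart \<times> 'z" where
  "pr c x = (c, transversal_proj c x)"

abbreviation pl :: "('a, 'z) chart \<times> 'z \<Rightarrow> 'a set" where
  "pl t \<equiv> plaque (fst t) (snd t)"

lemma compact: "compact_space X" and Hausdorff: "Hausdorff_space X"
  using foliated unfolding compact_Polish_foliated_space_def by blast+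

lemma chart_in_\<F>: "c \<in> \<F> \<Longrightarrow> foliated_chart X n c"
  using foliated unfolding compact_Polish_foliated_space_def foliated_structure_def by auto

text \<open>Charts of the structure are by definition compatible only with a generating atlas. Near
  \<open>p\<close> the two changes of coordinates are composed through an atlas chart containing
  \<open>p\<close>.\<close>

lemma change_in_\<F>:
  assumes "c \<in> \<F>" "d \<in> \<F>"
  shows "foliated_change X c d"
  unfolding foliated_change_def
proof
  fix p assume p: "p \<in> chart_dom c \<inter> chart_dom d"
  obtain \<A> where A: "foliated_atlas X n \<A>"
    "\<F> = {c. foliated_chart X n c \<and> (\<forall>d\<in>\<A>. foliated_change X c d \<and> foliated_change X d c)}"
    using foliated unfolding compact_Polish_foliated_space_def foliated_structure_def by auto
  have "p \<in> topspace X" using p foliated_chart_map_image(4) chart_in_\<F> assms by blast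
  then obtain a where a: "a \<in> \<A>" "p \<in> chart_dom a" using A unfolding foliated_atlas_def by blast
  have ca: "foliated_change X c a" and ad: "foliated_change X a d" using assms A(2) a by auto
  obtain V \<xi> h where V: "openin X V" "p \<in> V" "V \<subseteq> chart_dom c \<inter> chart_dom a"
    "\<forall>q\<in>V. \<forall>x z. chart_map c q = (x, z) \<longrightarrow> chart_map a q = (\<xi> (x, z), h z)"
    using ca[unfolded foliated_change_def, THEN bspec, of p] p a by auto
  obtain V' \<xi>' h' where V': "openin X V'" "p \<in> V'" "V' \<subseteq> chart_dom a \<inter> chart_dom d"
    "\<forall>q\<in>V'. \<forall>x z. chart_map a q = (x, z) \<longrightarrow> chart_map d q = (\<xi>' (x, z), h' z)"
    using ad[unfolded foliated_change_def, THEN bspec, of p] p a by auto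
  show "\<exists>V \<xi> h. openin X V \<and> p \<in> V \<and> V \<subseteq> chart_dom c \<inter> chart_dom d \<and>
      (\<forall>q\<in>V. \<forall>x z. chart_map c q = (x, z) \<longrightarrow> chart_map d q = (\<xi> (x, z), h z))"
    using V V' by (intro exI[of _ "V \<inter> V'"] exI[of _ "\<lambda>(x, z). \<xi>' (\<xi> (x, z), h z)"]
        exI[of _ "h' \<circ> h"] conjI openin_Int) auto
qed

lemma local_change:
  assumes "c \<in> \<F>" "d \<in> \<F>" "p \<in> chart_dom c" "p \<in> chart_dom d"
  obtains V where "openin X V" "p \<in> V" "V \<subseteq> chart_dom c \<inter> chart_dom d"
    "\<And>x y. x \<in> V \<Longrightarrow> y \<in> V \<Longrightarrow> transversal_proj c x = transversal_proj c y \<Longrightarrow>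
       transversal_proj d x = transversal_proj d y"
proof -
  obtain V \<xi> h where V: "openin X V" "p \<in> V" "V \<subseteq> chart_dom c \<inter> chart_dom d"
    "\<forall>q\<in>V. \<forall>x z. chart_map c q = (x, z) \<longrightarrow> chart_map d q = (\<xi> (x, z), h z)"
    using change_in_\<F>[OF assms(1,2), unfolded foliated_change_def, THEN bspec, of p] assms(3,4) by auto
  have "transversal_proj d x = h (transversal_proj c x)" if "x \<in> V" for x
    using V(4) that unfolding transversal_proj_def by (metis prod.collapse snd_conv)
  then show thesis using that[of V] V by auto
qed

lemma regular_atlasD:
  "foliated_atlas X n \<U>" "\<U> \<subseteq> \<F>"
  "\<forall>c\<in>\<U>. \<exists>d\<in>\<F>. chart_restriction c d \<and> X closure_of (chart_dom c) \<subseteq> chart_dom d"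
  "\<forall>x\<in>topspace X. \<exists>V. openin X V \<and> x \<in> V \<and> finite {c\<in>\<U>. chart_dom c \<inter> V \<noteq> {}}"
  "\<forall>c\<in>\<U>. \<forall>d\<in>\<U>. \<forall>P\<in>chart_plaques c. \<forall>Q\<in>chart_plaques d. \<forall>Q'\<in>chart_plaques d.
     X closure_of P \<inter> X closure_of Q \<noteq> {} \<and> X closure_of P \<inter> X closure_of Q' \<noteq> {} \<longrightarrow> Q = Q'"
  using regular unfolding regular_foliated_atlas_def by - (elim conjE, assumption)+

lemma \<U>_\<F>: "c \<in> \<U> \<Longrightarrow> c \<in> \<F>"
  using regular_atlasD(2) by blast

lemma \<C>_\<U>: "c \<in> \<C> \<Longrightarrow> c \<in> \<U>"
  unfolding \<C>_def by blast

lemma chart_\<U>: "c \<in> \<U> \<Longrightarrow> foliated_chart X n c"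
  using \<U>_\<F> chart_in_\<F> by blast

lemma chart_\<C>: "c \<in> \<C> \<Longrightarrow> foliated_chart X n c"
  using \<C>_\<U> chart_\<U> by blast

lemma dom_open: "c \<in> \<U> \<Longrightarrow> openin X (chart_dom c)"
  using chart_\<U> unfolding foliated_chart_def by blast

lemma dom_topspace: "c \<in> \<U> \<Longrightarrow> x \<in> chart_dom c \<Longrightarrow> x \<in> topspace X"
  using dom_open openin_subset by blast

lemma \<C>_I: "c \<in> \<U> \<Longrightarrow> x \<in> chart_dom c \<Longrightarrow> c \<in> \<C>"
  unfolding \<C>_def by blast

lemma \<C>_cover: "x \<in> topspace X \<Longrightarrow> \<exists>c\<in>\<C>. x \<in> chart_dom c"
  using regular_atlasD(1) \<C>_I unfolding foliated_atlas_def by (metis UN_E)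

lemma finite_\<C>: "finite \<C>"
proof -
  define \<O> where "\<O> = {V. openin X V \<and> finite {c\<in>\<U>. chart_dom c \<inter> V \<noteq> {}}}"
  have "topspace X \<subseteq> \<Union>\<O>" "\<And>V. V \<in> \<O> \<Longrightarrow> openin X V"
    using regular_atlasD(4) unfolding \<O>_def by blast+
  then obtain \<O>' where \<O>': "finite \<O>'" "\<O>' \<subseteq> \<O>" "topspace X \<subseteq> \<Union>\<O>'"
    using compact unfolding compact_space_def compactin_def by meson
  have "\<C> \<subseteq> (\<Union>V\<in>\<O>'. {c\<in>\<U>. chart_dom c \<inter> V \<noteq> {}})"
  proof
    fix c assume "c \<in> \<C>"
    then obtain x where x: "c \<in> \<U>" "x \<in> chart_dom c" unfolding \<C>_def by auto
    then obtain V where "V \<in> \<O>'" "x \<in> V" using \<O>'(3) dom_topspace[OF x] by auto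
    then show "c \<in> (\<Union>V\<in>\<O>'. {c\<in>\<U>. chart_dom c \<inter> V \<noteq> {}})" using x by auto
  qed
  moreover have "finite (\<Union>V\<in>\<O>'. {c\<in>\<U>. chart_dom c \<inter> V \<noteq> {}})"
    using \<O>'(1,2) unfolding \<O>_def by auto
  ultimately show ?thesis by (rule finite_subset)
qed

lemma pr_in_T: "c \<in> \<U> \<Longrightarrow> x \<in> chart_dom c \<Longrightarrow> pr c x \<in> topspace T"
  using transversal_proj_in[OF chart_\<U>] unfolding pr_def total_transversal_def by auto

lemma T_cases:
  assumes "t \<in> topspace T"
  obtains c x where "c \<in> \<C>" "x \<in> chart_dom c" "t = pr c x"
proof -
  obtain c z where t: "t = (c, z)" "c \<in> \<U>" "z \<in> topspace (chart_trans c)"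
    using assms unfolding total_transversal_def by auto
  then obtain x where "x \<in> chart_dom c" "transversal_proj c x = z"
    using transversal_proj_surj chart_\<U> by metis
  then show thesis using that \<C>_I t unfolding pr_def by blast
qed

lemma pl_iff:
  assumes "t \<in> topspace T"
  shows "x \<in> pl t \<longleftrightarrow> fst t \<in> \<C> \<and> x \<in> chart_dom (fst t) \<and> t = pr (fst t) x"
proof -
  have "fst t \<in> \<C>" using assms by (rule T_cases) (simp add: pr_def)
  then show ?thesis using plaque_eq[OF chart_\<C>[of "fst t"]] unfolding pr_def by (cases t) auto
qed

lemma pl_pr:
  assumes "c \<in> \<U>"
  shows "x \<in> pl (pr c y) \<longleftrightarrow> x \<in> chart_dom c \<and> pr c x = pr c y"
  using plaque_eq[OF chart_\<U>[OF assms]] unfolding pr_def by auto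

lemma pr_open:
  assumes "c \<in> \<U>" "openin X V" "V \<subseteq> chart_dom c"
  shows "openin T (pr c ` V)"
proof -
  have "openin (subtopology X (chart_dom c)) V"
    using assms by (simp add: openin_open_subtopology dom_open)
  then have "openin (chart_trans c) (transversal_proj c ` V)"
    using transversal_proj_open[OF chart_\<U>[OF assms(1)]] unfolding open_map_def by blast
  then have "openin T (Pair c ` (transversal_proj c ` V))"
    using open_map_component_injection[OF assms(1), of chart_trans]
    unfolding open_map_def total_transversal_def by blast
  then show ?thesis by (simp add: image_image pr_def[abs_def])
qed

lemma pr_continuous:
  assumes "c \<in> \<U>"
  shows "continuous_map (subtopology X (chart_dom c)) T (pr c)"
proof -
  have "continuous_map (subtopology X (chart_dom c)) T (Pair c \<circ> transversal_proj c)"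
    unfolding total_transversal_def
    by (rule continuous_map_compose[OF transversal_proj_continuous[OF chart_\<U>[OF assms]]
          continuous_map_component_injection[OF assms, of chart_trans]])
  then show ?thesis by (simp add: comp_def pr_def[abs_def])
qed

lemma pr_preimage_open:
  assumes "c \<in> \<U>" "openin T W"
  shows "openin X {x \<in> chart_dom c. pr c x \<in> W}"
proof -
  have "openin (subtopology X (chart_dom c)) {x \<in> topspace (subtopology X (chart_dom c)). pr c x \<in> W}"
    using pr_continuous[OF assms(1)] assms(2) openin_continuous_map_preimage by blast
  moreover have "topspace (subtopology X (chart_dom c)) = chart_dom c"
    using dom_topspace[OF assms(1)] by auto
  ultimately have "openin (subtopology X (chart_dom c)) {x \<in> chart_dom c. pr c x \<in> W}"
    by (simp only:)
  then show ?thesis using dom_open[OF assms(1)] by (simp add: openin_open_subtopology)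
qed

lemma T_Hausdorff:
  assumes "s \<in> topspace T" "t \<in> topspace T" "s \<noteq> t"
  obtains V W where "openin T V" "openin T W" "s \<in> V" "t \<in> W" "V \<inter> W = {}"
proof -
  obtain c z d w where [simp]: "s = (c, z)" "t = (d, w)" and cz: "c \<in> \<U>" "z \<in> topspace (chart_trans c)"
    "d \<in> \<U>" "w \<in> topspace (chart_trans d)"
    using assms(1,2) unfolding total_transversal_def by auto
  have op: "openin T (Pair e ` V)" if "e \<in> \<U>" "openin (chart_trans e) V" for e V
    using that open_map_component_injection[of e \<U> chart_trans]
    unfolding open_map_def total_transversal_def by blast
  show thesis
  proof (cases "c = d")
    case False
    show thesis
      by (rule that[of "Pair c ` topspace (chart_trans c)" "Pair d ` topspace (chart_trans d)"])
        (use False cz op in auto)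
  next
    case True
    have "Hausdorff_space (chart_trans c)"
      using chart_\<U>[OF cz(1)] completely_metrizable_imp_metrizable_space
        metrizable_imp_Hausdorff_space
      unfolding foliated_chart_def locally_compact_Polish_def by blast
    moreover have "z \<noteq> w" using assms(3) True by simp
    ultimately obtain V W where "openin (chart_trans c) V" "openin (chart_trans c) W" "z \<in> V" "w \<in> W"
      "disjnt V W" using cz True unfolding Hausdorff_space_def by metis
    then show thesis
      using that[of "Pair c ` V" "Pair c ` W"] op cz True by (auto simp: disjnt_iff)
  qed
qed

lemma Hausdorff_T: "Hausdorff_space T"
  unfolding Hausdorff_space_def using T_Hausdorff unfolding disjnt_def by metis

section \<open>Elementary holonomy and the adjacency graph of plaques\<close>

lemma elementary_holonomy_iff:
  "(s, t) \<in> elementary_holonomy c d \<longleftrightarrow> (\<exists>x\<in>chart_dom c \<inter> chart_dom d. s = pr c x \<and> t = pr d x)"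
  unfolding elementary_holonomy_def pr_def by blast

lemma elementary_holonomy_converse: "(elementary_holonomy c d)\<inverse> = elementary_holonomy d c"
  unfolding elementary_holonomy_def by blast

text \<open>The regularity condition on plaques enters here: the plaque of \<open>c\<close> over
  \<open>s\<close> meets the plaques of \<open>d\<close> over \<open>t\<close> and
  \<open>t'\<close>, so these two coincide.\<close>

lemma elementary_holonomy_single_valued:
  assumes "c \<in> \<U>" "d \<in> \<U>"
  shows "single_valued (elementary_holonomy c d)"
proof (rule single_valuedI)
  fix s t t' assume "(s, t) \<in> elementary_holonomy c d" "(s, t') \<in> elementary_holonomy c d"
  then obtain x y where x: "x \<in> chart_dom c" "x \<in> chart_dom d" "s = pr c x" "t = pr d x"
    and y: "y \<in> chart_dom c" "y \<in> chart_dom d" "s = pr c y" "t' = pr d y"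
    unfolding elementary_holonomy_iff by blast
  note reg = regular_atlasD(5)[rule_format, OF assms]
  have cl: "p \<in> X closure_of pl (pr e p)" if "e \<in> \<U>" "p \<in> chart_dom e" for e p
  proof -
    have "pl (pr e p) \<subseteq> topspace X" using pl_pr[OF that(1)] dom_topspace[OF that(1)] by blast
    then show ?thesis using closure_of_subset pl_pr[OF that(1)] that(2) by blast
  qed
  have mem: "pl (pr e p) \<in> chart_plaques e" if "e \<in> \<U>" "p \<in> chart_dom e" for e p
    using transversal_proj_in[OF chart_\<U>[OF that(1)] that(2)]
    unfolding chart_plaques_def pr_def by auto
  have "pl (pr c x) = pl (pr c y)" using x y by simp
  then have "X closure_of pl (pr c x) \<inter> X closure_of pl (pr d x) \<noteq> {}"
    "X closure_of pl (pr c x) \<inter> X closure_of pl (pr d y) \<noteq> {}"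
    using cl[OF assms(1) x(1)] cl[OF assms(2) x(2)] cl[OF assms(1) y(1)] cl[OF assms(2) y(2)]
    by auto
  then have "pl (pr d x) = pl (pr d y)"
    using reg[OF mem[OF assms(1) x(1)] mem[OF assms(2) x(2)] mem[OF assms(2) y(2)]] by simp
  then have "x \<in> pl (pr d y)" using pl_pr[OF assms(2)] x by blast
  then show "t = t'" using pl_pr[OF assms(2)] x y by auto
qed

lemma elementary_holonomy_preimage_open:
  assumes "c \<in> \<U>" "d \<in> \<U>" "openin T W"
  shows "openin T ((elementary_holonomy c d)\<inverse> `` W)"
proof -
  have "(elementary_holonomy c d)\<inverse> `` W = pr c ` (chart_dom c \<inter> {x \<in> chart_dom d. pr d x \<in> W})"
    unfolding elementary_holonomy_iff Image_def by (auto simp: elementary_holonomy_iff)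
  also have "openin T \<dots>"
    by (intro pr_open[OF assms(1)] openin_Int dom_open pr_preimage_open assms) auto
  finally show ?thesis .
qed

text \<open>Extended by the empty relation, so that symmetry, openness of preimages and inclusion in
  the total transversal hold for all pairs of charts without side conditions.\<close>

definition elem :: "('a, 'z) chart \<Rightarrow> ('a, 'z) chart \<Rightarrow> (('a, 'z) chart \<times> 'z) rel" where
  "elem c d = (if c \<in> \<C> \<and> d \<in> \<C> then elementary_holonomy c d else {})"

text \<open>Letters need not be composable: if the target chart of one letter is not the source
  chart of the next, the word gives the empty relation.\<close>

abbreviation hol :: "(('a, 'z) chart \<times> ('a, 'z) chart) list \<Rightarrow> (('a, 'z) chart \<times> 'z) rel" where
  "hol \<equiv> word_rel (topspace T) elem"

definition adj :: "(('a, 'z) chart \<times> 'z) rel" where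
  "adj = (\<Union>c\<in>\<C>. \<Union>d\<in>\<C>. elem c d)"

abbreviation words :: "(('a, 'z) chart \<times> ('a, 'z) chart) list set" where
  "words \<equiv> lists (\<C> \<times> \<C>)"

lemma elem_subset: "elem c d \<subseteq> topspace T \<times> topspace T"
  unfolding elem_def using pr_in_T[OF \<C>_\<U>] by (auto simp: elementary_holonomy_iff)

lemma elem_converse: "(elem c d)\<inverse> = elem d c"
  unfolding elem_def by (simp add: elementary_holonomy_converse)

lemma elem_preimage_open: "openin T W \<Longrightarrow> openin T ((elem c d)\<inverse> `` W)"
  unfolding elem_def using elementary_holonomy_preimage_open \<C>_\<U> by simp

lemma hol_preimage_open:
  assumes "ps \<in> words" "openin T W"
  shows "openin T ((hol ps)\<inverse> `` W)"
  using word_rel_preimage[of UNIV "openin T" elem ps "topspace T" W] elem_preimage_open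
    openin_subset[of T] assms(2) by auto

lemma hol_single_valued: "ps \<in> words \<Longrightarrow> single_valued (hol ps)"
  by (rule word_rel_single_valued)
    (auto simp: elem_def elementary_holonomy_single_valued \<C>_\<U>)

lemma hol_subset: "hol ps \<subseteq> topspace T \<times> topspace T"
  by (rule word_rel_subset) (rule elem_subset)

lemma hol_append: "hol (ps @ qs) = hol ps O hol qs"
  by (rule word_rel_append) (rule elem_subset)

lemma hol_converse: "(hol ps)\<inverse> = hol (map prod.swap (rev ps))"
  by (rule word_rel_converse) (rule elem_subset, rule elem_converse)

lemma rev_words: "ps \<in> words \<Longrightarrow> map prod.swap (rev ps) \<in> words"
  by (auto simp: lists_eq_set)

lemma hol_image_open:
  assumes "ps \<in> words" "openin T W"
  shows "openin T (hol ps `` W)"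
  using hol_preimage_open[OF rev_words[OF assms(1)] assms(2)] unfolding hol_converse[symmetric] by simp

lemma adj_iff:
  "(s, t) \<in> adj \<longleftrightarrow> s \<in> topspace T \<and> t \<in> topspace T \<and> pl s \<inter> pl t \<noteq> {}"
proof
  assume "(s, t) \<in> adj"
  then obtain c d x where "c \<in> \<C>" "d \<in> \<C>" "x \<in> chart_dom c" "x \<in> chart_dom d" "s = pr c x" "t = pr d x"
    unfolding adj_def elem_def elementary_holonomy_iff by (auto split: if_splits simp: elementary_holonomy_iff)
  then show "s \<in> topspace T \<and> t \<in> topspace T \<and> pl s \<inter> pl t \<noteq> {}"
    using pr_in_T[OF \<C>_\<U>] pl_pr[OF \<C>_\<U>] by blast
next
  assume st: "s \<in> topspace T \<and> t \<in> topspace T \<and> pl s \<inter> pl t \<noteq> {}"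
  then obtain x where "x \<in> pl s" "x \<in> pl t" by blast
  then have "(s, t) \<in> elem (fst s) (fst t)" "fst s \<in> \<C>" "fst t \<in> \<C>"
    using st pl_iff unfolding elem_def by (auto simp: elementary_holonomy_iff)
  then show "(s, t) \<in> adj" unfolding adj_def by blast
qed

lemma adj_elem:
  assumes "(s, t) \<in> adj"
  shows "(s, t) \<in> elem (fst s) (fst t)" "fst t \<in> \<C>"
proof -
  obtain c d where cd: "c \<in> \<C>" "d \<in> \<C>" "(s, t) \<in> elem c d" using assms unfolding adj_def by blast
  then have "(s, t) \<in> elementary_holonomy c d" unfolding elem_def by (simp split: if_splits)
  then have "fst s = c \<and> fst t = d" unfolding elementary_holonomy_iff by (auto simp: pr_def)
  then show "(s, t) \<in> elem (fst s) (fst t)" "fst t \<in> \<C>" using cd by auto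
qed

lemma adjI: "s \<in> topspace T \<Longrightarrow> t \<in> topspace T \<Longrightarrow> x \<in> pl s \<Longrightarrow> x \<in> pl t \<Longrightarrow> (s, t) \<in> adj"
  unfolding adj_iff by blast

lemma adj_sym: "(s, t) \<in> adj \<Longrightarrow> (t, s) \<in> adj"
  unfolding adj_iff by blast

lemma pl_nonempty: "t \<in> topspace T \<Longrightarrow> pl t \<noteq> {}"
  using T_cases[of t] pl_pr[OF \<C>_\<U>] by (metis empty_iff)

lemma adj_refl: "t \<in> topspace T \<Longrightarrow> (t, t) \<in> adj"
  unfolding adj_iff using pl_nonempty by auto

lemma adj_pow_words:
  "t \<in> topspace T \<Longrightarrow> (adj ^^ m) `` {t} = (\<Union>ps\<in>{ps \<in> words. length ps = m}. hol ps `` {t})"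
  unfolding adj_def by (rule relpow_UN_word_rel[OF elem_subset])

lemma finite_words: "finite {ps \<in> words. length ps = m}"
  using finite_lists_length_eq[of "\<C> \<times> \<C>" m] finite_\<C> by (simp add: lists_eq_set)

lemma adj_pow_in_T: "t \<in> topspace T \<Longrightarrow> (t, s) \<in> adj ^^ m \<Longrightarrow> s \<in> topspace T"
  by (cases m) (auto simp: adj_iff)

text \<open>Loops pad a path, so \<open>adj ^^ m\<close> is the relation of graph distance at most
  \<open>m\<close>, and its images of points are balls rather than spheres.\<close>

lemma adj_pow_mono: "t \<in> topspace T \<Longrightarrow> (t, s) \<in> adj ^^ m \<Longrightarrow> m \<le> k \<Longrightarrow> (t, s) \<in> adj ^^ k"
  using relpow_mono_refl_on[of adj s t m k] adj_refl adj_pow_in_T by (auto simp: adj_iff)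

lemma adj_pow_sym: "(s, t) \<in> adj ^^ m \<Longrightarrow> (t, s) \<in> adj ^^ m"
proof (induction m arbitrary: t)
  case (Suc m)
  then obtain u where "(s, u) \<in> adj ^^ m" "(u, t) \<in> adj" by auto
  then show ?case using Suc.IH adj_sym relpow_Suc_I2 by metis
qed auto

text \<open>Bounded geometry: holonomy being single valued, a plaque meets at most one plaque of
  each chart, so no vertex of the graph has more than \<open>card \<C>\<close> neighbours.\<close>

lemma card_adj_Image_le:
  assumes "finite S"
  shows "finite (adj `` S)" "card (adj `` S) \<le> card \<C> * card S"
proof -
  have one: "finite (adj `` {s}) \<and> card (adj `` {s}) \<le> card \<C>" for s
  proof -
    have "inj_on fst (adj `` {s})"
    proof (rule inj_onI)
      fix t t' assume "t \<in> adj `` {s}" "t' \<in> adj `` {s}" "fst t = fst t'"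
      then have "(s, t) \<in> elem (fst s) (fst t)" "(s, t') \<in> elem (fst s) (fst t)"
        using adj_elem(1) by (metis Image_singleton_iff)+
      then show "t = t'"
        using elementary_holonomy_single_valued[of "fst s" "fst t"] \<C>_\<U>
        unfolding elem_def by (auto split: if_splits dest: single_valuedD)
    qed
    moreover have "fst ` (adj `` {s}) \<subseteq> \<C>" using adj_elem(2) by auto
    ultimately show ?thesis
      using finite_\<C> card_inj_on_le inj_on_finite by blast
  qed
  have eq: "adj `` S = (\<Union>s\<in>S. adj `` {s})" by blast
  show "finite (adj `` S)" unfolding eq using assms one by blast
  have "card (\<Union>s\<in>S. adj `` {s}) \<le> (\<Sum>s\<in>S. card (adj `` {s}))"
    by (rule card_UN_le[OF assms])
  also have "\<dots> \<le> (\<Sum>s\<in>S. card \<C>)" using one by (intro sum_mono) blast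
  finally show "card (adj `` S) \<le> card \<C> * card S" unfolding eq by (simp add: mult.commute)
qed

definition vol :: "('a, 'z) chart \<times> 'z \<Rightarrow> nat \<Rightarrow> nat" where
  "vol t m = card ((adj ^^ m) `` {t})"

lemma finite_adj_pow: "finite ((adj ^^ m) `` {t})"
proof (induction m)
  case (Suc m)
  have "(adj ^^ Suc m) `` {t} = adj `` ((adj ^^ m) `` {t})" by auto
  then show ?case using card_adj_Image_le(1)[OF Suc] by simp
qed auto

lemma vol_mono: "t \<in> topspace T \<Longrightarrow> m \<le> k \<Longrightarrow> vol t m \<le> vol t k"
  unfolding vol_def by (intro card_mono finite_adj_pow) (auto intro: adj_pow_mono)

lemma vol_shift: "(s, t) \<in> adj ^^ j \<Longrightarrow> vol t m \<le> vol s (m + j)"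
  unfolding vol_def
  by (intro card_mono finite_adj_pow) (auto simp: add.commute[of m] intro: relpow_comp)

section \<open>Leaf distance and growth\<close>

lemma topspace_leaf_topology: "topspace (leaf_topology \<F>) = topspace X"
proof -
  have *: "(\<Union>z\<in>topspace (chart_trans c). plaque c z) = chart_dom c" if "c \<in> \<F>" for c
    using transversal_proj_in[OF chart_in_\<F>[OF that]] unfolding plaque_eq[OF chart_in_\<F>[OF that]] by auto
  have "topspace (leaf_topology \<F>) = (\<Union>c\<in>\<F>. chart_dom c)"
    unfolding leaf_topology_def plaques_def chart_plaques_def by (auto simp flip: *)
  also have "\<dots> = topspace X"
  proof
    show "(\<Union>c\<in>\<F>. chart_dom c) \<subseteq> topspace X"
      using foliated_chart_map_image(4)[OF chart_in_\<F>] by auto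
    show "topspace X \<subseteq> (\<Union>c\<in>\<F>. chart_dom c)"
      using \<C>_cover \<U>_\<F>[OF \<C>_\<U>] by (intro subsetI) (metis UN_I)
  qed
  finally show ?thesis .
qed

lemma plaques_eq: "plaques \<U> = pl ` topspace T"
  unfolding plaques_def chart_plaques_def total_transversal_def topspace_sum_topology
  by (fastforce simp: image_iff)

lemma openin_leaf_pl:
  assumes "t \<in> topspace T"
  shows "openin (leaf_topology \<F>) (pl t)"
proof -
  have "pl t \<in> plaques \<U>" using assms plaques_eq by simp
  moreover have "plaques \<U> \<subseteq> plaques \<F>" using \<U>_\<F> unfolding plaques_def by (intro UN_mono) auto
  ultimately show ?thesis unfolding leaf_topology_def by (intro topology_generated_by_Basis) (rule subsetD)
qed

text \<open>By \<open>local_change\<close>, any other plaque meets \<open>P\<close> in a relatively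
  open set. Hence the identity is continuous from \<open>P\<close> with the topology of
  \<open>X\<close> to the leaf topology and carries connectedness over.\<close>

lemma connectedin_leaf_pl:
  assumes "t \<in> topspace T"
  shows "connectedin (leaf_topology \<F>) (pl t)"
proof -
  obtain c z where t: "t = (c, z)" by (cases t)
  have c: "c \<in> \<U>" using assms t unfolding total_transversal_def by auto
  note cF = \<U>_\<F>[OF c]
  define P where "P = pl t"
  have P: "P = {x \<in> chart_dom c. transversal_proj c x = z}"
    unfolding P_def t using plaque_eq[OF chart_\<U>[OF c]] by simp
  have PX: "P \<subseteq> topspace X" unfolding P using dom_topspace[OF c] by auto
  have "continuous_map (subtopology X P) (leaf_topology \<F>) id"
    unfolding leaf_topology_def
  proof (rule continuous_on_generated_topo)
    show "id ` topspace (subtopology X P) \<subseteq> \<Union>(plaques \<F>)"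
      using topspace_leaf_topology unfolding leaf_topology_def by auto
  next
    fix Q assume "Q \<in> plaques \<F>"
    then obtain d w where d: "d \<in> \<F>" and Q: "Q = {x \<in> chart_dom d. transversal_proj d x = w}"
      using plaque_eq[OF chart_in_\<F>] unfolding plaques_def chart_plaques_def by auto
    have "openin (subtopology X P) (P \<inter> Q)"
      unfolding openin_subopen[of _ "P \<inter> Q"]
    proof
      fix p assume p: "p \<in> P \<inter> Q"
      then have pc: "p \<in> chart_dom c" "p \<in> chart_dom d" unfolding P Q by auto
      obtain V where V: "openin X V" "p \<in> V" "V \<subseteq> chart_dom c \<inter> chart_dom d"
        "\<And>x y. x \<in> V \<Longrightarrow> y \<in> V \<Longrightarrow> transversal_proj c x = transversal_proj c y \<Longrightarrow>
           transversal_proj d x = transversal_proj d y"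
        using local_change[OF cF d pc] by metis
      have "P \<inter> V \<subseteq> Q"
      proof
        fix q assume q: "q \<in> P \<inter> V"
        then have "transversal_proj c q = transversal_proj c p" using p unfolding P by simp
        then have "transversal_proj d q = transversal_proj d p" using V(4)[of q p] V(2) q by simp
        then show "q \<in> Q" using p q V(3) unfolding Q by auto
      qed
      then show "\<exists>S. openin (subtopology X P) S \<and> p \<in> S \<and> S \<subseteq> P \<inter> Q"
        using V(1,2) p by (intro exI[of _ "P \<inter> V"]) (auto intro: openin_subtopology_Int2)
    qed
    moreover have "id -` Q \<inter> topspace (subtopology X P) = P \<inter> Q" using PX by auto
    ultimately show "openin (subtopology X P) (id -` Q \<inter> topspace (subtopology X P))" by simp
  qed
  moreover have "connectedin (subtopology X P) P"
    using connectedin_plaque[OF chart_\<U>[OF c], of z] unfolding P_def t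
    by (simp add: connectedin_subtopology)
  ultimately have "connectedin (leaf_topology \<F>) (id ` P)"
    by (rule connectedin_continuous_map_image)
  then show ?thesis unfolding P_def by simp
qed

lemma adj_pow_connected:
  assumes "s \<in> topspace T" "(s, t) \<in> adj ^^ k"
  shows "\<exists>\<P>\<subseteq>plaques \<U>. finite \<P> \<and> card \<P> \<le> Suc k \<and> connectedin (leaf_topology \<F>) (\<Union>\<P>) \<and>
    pl s \<in> \<P> \<and> pl t \<in> \<P>"
  using assms(2)
proof (induction k arbitrary: t)
  case 0
  then show ?case
    using connectedin_leaf_pl[OF assms(1)] assms(1) by (intro exI[of _ "{pl s}"]) (auto simp: plaques_eq)
next
  case (Suc k)
  then obtain u where u: "(s, u) \<in> adj ^^ k" "(u, t) \<in> adj" by auto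
  obtain \<P> where P: "\<P> \<subseteq> plaques \<U>" "finite \<P>" "card \<P> \<le> Suc k"
    "connectedin (leaf_topology \<F>) (\<Union>\<P>)" "pl s \<in> \<P>" "pl u \<in> \<P>"
    using Suc.IH[OF u(1)] by auto
  have t: "t \<in> topspace T" "pl u \<inter> pl t \<noteq> {}" using u(2) unfolding adj_iff by auto
  have "connectedin (leaf_topology \<F>) (\<Union>\<P> \<union> pl t)"
    using P(4,6) connectedin_leaf_pl[OF t(1)] t(2) by (intro connectedin_Un) auto
  then show ?case
    using P t(1) card_insert_le_m1[of "Suc (Suc k)" \<P> "pl t"]
    by (intro exI[of _ "insert (pl t) \<P>"]) (auto simp: plaques_eq Un_commute)
qed

text \<open>Leaves are the components of the adjacency graph. The plaques reachable from
  \<open>x\<close> and the unreachable ones have open unions; these are disjoint, because a plaque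
  that meets a reachable one is reachable.\<close>

lemma leaf_through_iff:
  "y \<in> leaf_through \<F> x \<longleftrightarrow> (\<exists>s\<in>topspace T. \<exists>t k. x \<in> pl s \<and> y \<in> pl t \<and> (s, t) \<in> adj ^^ k)"
  (is "_ \<longleftrightarrow> ?R y")
proof
  assume "?R y"
  then obtain s t k where s: "s \<in> topspace T" "x \<in> pl s" "y \<in> pl t" "(s, t) \<in> adj ^^ k" by auto
  then obtain \<P> where "connectedin (leaf_topology \<F>) (\<Union>\<P>)" "pl s \<in> \<P>" "pl t \<in> \<P>"
    using adj_pow_connected[OF s(1,4)] by auto
  then show "y \<in> leaf_through \<F> x"
    unfolding leaf_through_def connected_component_of_def using s by auto
next
  assume y: "y \<in> leaf_through \<F> x"
  let ?L = "leaf_topology \<F>"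
  have x: "x \<in> topspace X" and yX: "y \<in> topspace X"
    using y connected_component_in_topspace[of ?L x y] topspace_leaf_topology
    unfolding leaf_through_def by auto
  have ex: "\<exists>s\<in>topspace T. p \<in> pl s" if "p \<in> topspace X" for p
    using \<C>_cover[OF that] pl_pr[OF \<C>_\<U>] pr_in_T[OF \<C>_\<U>] by metis
  define S where "S = (\<Union>t\<in>{t \<in> topspace T. \<exists>s\<in>topspace T. \<exists>k. x \<in> pl s \<and> (s, t) \<in> adj ^^ k}. pl t)"
  define S' where "S' = (\<Union>t\<in>{t \<in> topspace T. \<nexists>s k. s \<in> topspace T \<and> x \<in> pl s \<and> (s, t) \<in> adj ^^ k}. pl t)"
  have "openin ?L S" "openin ?L S'" unfolding S_def S'_def by (auto intro: openin_leaf_pl)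
  moreover have "topspace X \<subseteq> S \<union> S'" using ex unfolding S_def S'_def by fast
  moreover have "S \<inter> S' = {}"
  proof (rule ccontr)
    assume "S \<inter> S' \<noteq> {}"
    then obtain p t t' s k where t: "t \<in> topspace T" "t' \<in> topspace T" "p \<in> pl t" "p \<in> pl t'"
      "s \<in> topspace T" "x \<in> pl s" "(s, t) \<in> adj ^^ k"
      "\<nexists>s k. s \<in> topspace T \<and> x \<in> pl s \<and> (s, t') \<in> adj ^^ k"
      unfolding S_def S'_def by auto
    have "(s, t') \<in> adj ^^ Suc k" by (rule relpow_Suc_I[OF t(7) adjI[OF t(1-4)]])
    then show False using t by metis
  qed
  moreover have "connectedin ?L (leaf_through \<F> x)"
    unfolding leaf_through_def by (rule connectedin_connected_component_of)
  moreover have "leaf_through \<F> x \<subseteq> topspace X"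
    unfolding leaf_through_def topspace_leaf_topology[symmetric]
    by (rule connected_component_of_subset_topspace)
  moreover have "x \<in> leaf_through \<F> x"
    unfolding leaf_through_def using x by (simp add: connected_component_of_refl topspace_leaf_topology)
  moreover have "x \<in> S"
  proof -
    obtain s where "s \<in> topspace T" "x \<in> pl s" using ex[OF x] by auto
    then show ?thesis unfolding S_def using relpow_0_I[of s adj] by fast
  qed
  ultimately have "S' \<inter> leaf_through \<F> x = {}"
    unfolding connectedin by (metis Int_assoc disjoint_iff inf_bot_left subset_trans)
  then have "y \<in> S" using y yX \<open>topspace X \<subseteq> S \<union> S'\<close> by auto
  then show "?R y" unfolding S_def by auto
qed

text \<open>The leaf distance counts plaques and \<open>adj ^^ k\<close> counts overlaps, whence the
  shift by one. The exceptional value 0 at \<open>x = y\<close> does no harm, since a plaque through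
  \<open>x\<close> carries paths of every length.\<close>

lemma leaf_dist_le_Suc:
  assumes y: "y \<in> leaf_through \<F> x"
  shows "leaf_dist \<F> \<U> x y \<le> Suc k \<longleftrightarrow>
    (\<exists>s\<in>topspace T. \<exists>t. x \<in> pl s \<and> y \<in> pl t \<and> (s, t) \<in> adj ^^ k)"
proof
  let ?Q = "\<lambda>k. \<exists>\<P>. \<P> \<subseteq> plaques \<U> \<and> finite \<P> \<and> card \<P> = k \<and>
                       connectedin (leaf_topology \<F>) (\<Union>\<P>) \<and> x \<in> \<Union>\<P> \<and> y \<in> \<Union>\<P>"
  have Q: "\<exists>j\<le>Suc k. ?Q j" if "s \<in> topspace T" "x \<in> pl s" "y \<in> pl t" "(s, t) \<in> adj ^^ k" for s t k
    using adj_pow_connected[OF that(1,4)] that(2,3) by auto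
  {
    assume "\<exists>s\<in>topspace T. \<exists>t. x \<in> pl s \<and> y \<in> pl t \<and> (s, t) \<in> adj ^^ k"
    then obtain j where "j \<le> Suc k" "?Q j" using Q by metis
    then have "(LEAST k. ?Q k) \<le> Suc k" using Least_le[of ?Q j] by simp
    then show "leaf_dist \<F> \<U> x y \<le> Suc k" unfolding leaf_dist_def by simp
  next
    assume le: "leaf_dist \<F> \<U> x y \<le> Suc k"
    obtain s0 t0 k0 where s0: "s0 \<in> topspace T" "x \<in> pl s0" "y \<in> pl t0" "(s0, t0) \<in> adj ^^ k0"
      using y unfolding leaf_through_iff by auto
    show "\<exists>s\<in>topspace T. \<exists>t. x \<in> pl s \<and> y \<in> pl t \<and> (s, t) \<in> adj ^^ k"
    proof (cases "x = y")
      case True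
      then show ?thesis
        using s0(1,2) adj_pow_mono[OF s0(1) relpow_0_I, of k] by (metis zero_le)
    next
      case False
      \<comment> \<open>Points of one leaf are joined by some chain, so the minimum in
        \<open>leaf_dist\<close> is attained.\<close>
      obtain j where "?Q j" using Q[OF s0] by auto
      then have "?Q (LEAST k. ?Q k)" by (rule LeastI)
      moreover have "(LEAST k. ?Q k) \<le> Suc k" using le False unfolding leaf_dist_def by simp
      ultimately obtain \<P> where P: "\<P> \<subseteq> plaques \<U>" "finite \<P>" "card \<P> \<le> Suc k"
        "connectedin (leaf_topology \<F>) (\<Union>\<P>)" "x \<in> \<Union>\<P>" "y \<in> \<Union>\<P>"
        by metis
      obtain V W where VW: "V \<in> \<P>" "x \<in> V" "W \<in> \<P>" "y \<in> W" using P(5,6) by auto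
      have "\<forall>A\<in>\<P>. \<exists>t\<in>topspace T. A = pl t" using P(1) unfolding plaques_eq by auto
      then obtain \<tau> where \<tau>: "\<And>A. A \<in> \<P> \<Longrightarrow> \<tau> A \<in> topspace T" "\<And>A. A \<in> \<P> \<Longrightarrow> pl (\<tau> A) = A"
        by metis
      have op: "\<And>A. A \<in> \<P> \<Longrightarrow> openin (leaf_topology \<F>) A" using \<tau> openin_leaf_pl by fastforce
      let ?r = "{(A, B). A \<in> \<P> \<and> B \<in> \<P> \<and> A \<inter> B \<inter> \<Union>\<P> \<noteq> {}}"
      obtain j where j: "j < card \<P>" "(V, W) \<in> ?r ^^ j"
        using connectedin_finite_cover_chain[OF P(4,2) op subset_refl VW(1,2) P(5) VW(3,4) P(6)] by auto
      have "(\<tau> V, \<tau> A) \<in> adj ^^ i" if "(V, A) \<in> ?r ^^ i" for A i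
        using that
      proof (induction i arbitrary: A)
        case (Suc i)
        then obtain B where B: "(V, B) \<in> ?r ^^ i" "B \<in> \<P>" "A \<in> \<P>" "B \<inter> A \<noteq> {}" by auto
        then have "(\<tau> B, \<tau> A) \<in> adj" unfolding adj_iff using \<tau> by simp
        then show ?case using Suc.IH[OF B(1)] by auto
      qed simp
      then have "(\<tau> V, \<tau> W) \<in> adj ^^ j" using j(2) by blast
      then have "(\<tau> V, \<tau> W) \<in> adj ^^ k"
        using adj_pow_mono[of "\<tau> V" "\<tau> W" j k] \<tau>(1)[OF VW(1)] j(1) P(3) by simp
      moreover have "\<tau> V \<in> topspace T" "x \<in> pl (\<tau> V)" "y \<in> pl (\<tau> W)" using \<tau> VW by simp_all
      ultimately show ?thesis by metis
    qed
  }
qed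

text \<open>Two of the \<open>m\<close> steps are spent at the ends: from the given plaque through
  \<open>x\<close> to the first plaque of the chain, and from its last plaque to
  \<open>P\<close>.\<close>

lemma plaques_meeting_leaf_ball_subset:
  assumes "c \<in> \<U>" "x \<in> chart_dom c" "r \<le> real m" "2 \<le> m"
  shows "{P \<in> plaques \<U>. P \<inter> leaf_ball \<F> \<U> x r \<noteq> {}} \<subseteq> pl ` ((adj ^^ m) `` {pr c x})"
proof
  fix P assume "P \<in> {P \<in> plaques \<U>. P \<inter> leaf_ball \<F> \<U> x r \<noteq> {}}"
  then obtain q y where q: "q \<in> topspace T" "P = pl q" "y \<in> pl q" "y \<in> leaf_through \<F> x"
    "real (leaf_dist \<F> \<U> x y) < r" unfolding plaques_eq leaf_ball_def by auto
  obtain k where k: "m = Suc (Suc k)" using assms(4) by (metis add_2_eq_Suc le_Suc_ex)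
  have "leaf_dist \<F> \<U> x y \<le> Suc k" using q(5) assms(3) k by linarith
  then obtain s t where st: "s \<in> topspace T" "x \<in> pl s" "y \<in> pl t" "(s, t) \<in> adj ^^ k"
    unfolding leaf_dist_le_Suc[OF q(4)] by auto
  have "(pr c x, s) \<in> adj"
    using st(1,2) assms(1,2) pr_in_T pl_pr by (intro adjI) auto
  moreover have "(t, q) \<in> adj" using st adj_pow_in_T q(1,3) by (intro adjI) auto
  ultimately have "(pr c x, q) \<in> adj ^^ m"
    using st(4) unfolding k by (metis relpow_Suc_I relpow_Suc_I2)
  then show "P \<in> pl ` ((adj ^^ m) `` {pr c x})" using q(2) by auto
qed

lemma leaf_growth_le_vol:
  assumes "c \<in> \<U>" "x \<in> chart_dom c" "r \<le> real m" "2 \<le> m"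
  shows "leaf_growth \<F> \<U> x r \<le> real (vol (pr c x) m)"
  unfolding leaf_growth_def vol_def of_nat_le_iff
  using plaques_meeting_leaf_ball_subset[OF assms] finite_adj_pow by (meson surj_card_le)

lemma vol_le_leaf_growth:
  assumes "c \<in> \<U>" "x \<in> chart_dom c" "real m + 1 < r"
  shows "real (vol (pr c x) m) \<le> real (card \<C>) * leaf_growth \<F> \<U> x r"
proof -
  define S where "S = {P \<in> plaques \<U>. P \<inter> leaf_ball \<F> \<U> x r \<noteq> {}}"
  \<comment> \<open>To be settled first, because \<open>card\<close> of an infinite set is 0 and the
    lower bound on the count would be lost.\<close>
  have fin: "finite S"
  proof -
    obtain M where "r \<le> real M" "2 \<le> M"
      using real_arch_simple[of "max r 2"] by auto
    then show ?thesis
      unfolding S_def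
      using finite_subset[OF plaques_meeting_leaf_ball_subset[OF assms(1,2)] finite_imageI[OF finite_adj_pow]]
      by simp
  qed
  have sub: "(adj ^^ m) `` {pr c x} \<subseteq> (\<Union>P\<in>S. {q \<in> topspace T. pl q = P})"
  proof
    fix q assume "q \<in> (adj ^^ m) `` {pr c x}"
    then have q: "(pr c x, q) \<in> adj ^^ m" by simp
    have pT: "pr c x \<in> topspace T" "x \<in> pl (pr c x)" using pr_in_T pl_pr assms by auto
    have qT: "q \<in> topspace T" using adj_pow_in_T[OF pT(1) q] .
    obtain y where y: "y \<in> pl q" using pl_nonempty[OF qT] by auto
    have L: "y \<in> leaf_through \<F> x" unfolding leaf_through_iff using pT q y by metis
    have "leaf_dist \<F> \<U> x y \<le> Suc m" unfolding leaf_dist_le_Suc[OF L] using pT q y by metis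
    then have "y \<in> leaf_ball \<F> \<U> x r" unfolding leaf_ball_def using L assms(3) by simp
    then have "pl q \<in> S" unfolding S_def plaques_eq using qT y by auto
    then show "q \<in> (\<Union>P\<in>S. {q \<in> topspace T. pl q = P})" using qT by auto
  qed
  \<comment> \<open>One set may be a plaque of several charts, but over at most one point of each
    transversal. This is the origin of the factor \<open>card \<C>\<close>.\<close>
  have fib: "finite {q \<in> topspace T. pl q = P} \<and> card {q \<in> topspace T. pl q = P} \<le> card \<C>" for P
  proof -
    have "inj_on fst {q \<in> topspace T. pl q = P}"
    proof (rule inj_onI)
      fix q q' assume q: "q \<in> {q \<in> topspace T. pl q = P}" "q' \<in> {q \<in> topspace T. pl q = P}" "fst q = fst q'"
      then obtain y where y: "y \<in> pl q" "y \<in> pl q'" using pl_nonempty[of q] by auto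
      have qT: "q \<in> topspace T" "q' \<in> topspace T" using q by simp_all
      have "q = pr (fst q) y" "q' = pr (fst q') y"
        using y(1)[unfolded pl_iff[OF qT(1)]] y(2)[unfolded pl_iff[OF qT(2)]] pr_def by auto
      then show "q = q'" using q(3) by simp
    qed
    moreover have "fst ` {q \<in> topspace T. pl q = P} \<subseteq> \<C>"
    proof
      fix c assume "c \<in> fst ` {q \<in> topspace T. pl q = P}"
      then obtain q where "c = fst q" "q \<in> topspace T" by auto
      then show "c \<in> \<C>" using pl_nonempty[of q] pl_iff[of q] by auto
    qed
    ultimately show ?thesis using finite_\<C> by (meson card_inj_on_le inj_on_finite)
  qed
  have "vol (pr c x) m \<le> card (\<Union>P\<in>S. {q \<in> topspace T. pl q = P})"
    unfolding vol_def using fin fib sub by (intro card_mono finite_UN_I) auto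
  also have "\<dots> \<le> (\<Sum>P\<in>S. card {q \<in> topspace T. pl q = P})" by (rule card_UN_le[OF fin])
  also have "\<dots> \<le> (\<Sum>P\<in>S. card \<C>)" using fib by (intro sum_mono) auto
  also have "\<dots> = card \<C> * card S" by simp
  finally have "vol (pr c x) m \<le> card \<C> * card S" .
  then have "real (vol (pr c x) m) \<le> real (card \<C>) * real (card S)" by (simp flip: of_nat_mult)
  then show ?thesis unfolding leaf_growth_def S_def .
qed

section \<open>Semicontinuity of the growth function\<close>

lemma eventually_nhdsin_openI:
  "openin Y W \<Longrightarrow> t \<in> W \<Longrightarrow> (\<And>s. s \<in> W \<Longrightarrow> P s) \<Longrightarrow> eventually P (nhdsin Y t)"
  unfolding eventually_nhdsin by auto

lemma vol_lower_semicontinuous: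
  assumes t: "t \<in> topspace T"
  shows "eventually (\<lambda>s. vol t m \<le> vol s m) (nhdsin T t)"
proof -
  define L where "L = {ps \<in> words. length ps = m}"
  have L: "finite L" "\<And>p. p \<in> L \<Longrightarrow> p \<in> words" unfolding L_def using finite_words by auto
  have "eventually (\<lambda>s. s \<in> topspace T) (nhdsin T t)"
    by (rule eventually_nhdsin_openI[OF openin_topspace t])
  moreover have "eventually (\<lambda>s. \<forall>p\<in>L. t \<in> Domain (hol p) \<longrightarrow> s \<in> Domain (hol p)) (nhdsin T t)"
  proof (intro eventually_ball_finite L(1) ballI)
    fix p assume p: "p \<in> L"
    show "eventually (\<lambda>s. t \<in> Domain (hol p) \<longrightarrow> s \<in> Domain (hol p)) (nhdsin T t)"
    proof (cases "t \<in> Domain (hol p)")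
      case True
      have "Domain (hol p) = (hol p)\<inverse> `` topspace T" using hol_subset[of p] by auto
      then have "openin T (Domain (hol p))" using hol_preimage_open[OF L(2)[OF p] openin_topspace] by simp
      then show ?thesis using True by (intro eventually_nhdsin_openI) auto
    qed simp
  qed
  moreover have "eventually (\<lambda>s. \<forall>p\<in>L. \<forall>q\<in>L. \<forall>e f g. (s, e) \<in> hol p \<longrightarrow> (s, e) \<in> hol q \<longrightarrow>
      (t, f) \<in> hol p \<longrightarrow> (t, g) \<in> hol q \<longrightarrow> f = g) (nhdsin T t)"
  proof (intro eventually_ball_finite L(1) ballI)
    fix p q assume pq: "p \<in> L" "q \<in> L"
    note sv = single_valuedD[OF hol_single_valued[OF L(2)[OF pq(1)]]]
      single_valuedD[OF hol_single_valued[OF L(2)[OF pq(2)]]]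
    show "eventually (\<lambda>s. \<forall>e f g. (s, e) \<in> hol p \<longrightarrow> (s, e) \<in> hol q \<longrightarrow>
      (t, f) \<in> hol p \<longrightarrow> (t, g) \<in> hol q \<longrightarrow> f = g) (nhdsin T t)"
    proof (cases "\<exists>f g. (t, f) \<in> hol p \<and> (t, g) \<in> hol q \<and> f \<noteq> g")
      case True
      then obtain f g where fg: "(t, f) \<in> hol p" "(t, g) \<in> hol q" "f \<noteq> g" by auto
      have "f \<in> topspace T" "g \<in> topspace T" using fg hol_subset[of p] hol_subset[where ps = q] by auto
      then obtain V W where VW: "openin T V" "openin T W" "f \<in> V" "g \<in> W" "V \<inter> W = {}"
        using T_Hausdorff fg(3) by metis
      show ?thesis
      proof (rule eventually_nhdsin_openI)
        show "openin T ((hol p)\<inverse> `` V \<inter> (hol q)\<inverse> `` W)"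
          using hol_preimage_open L(2) pq VW(1,2) by (intro openin_Int) auto
        show "t \<in> (hol p)\<inverse> `` V \<inter> (hol q)\<inverse> `` W" using fg VW by auto
        fix s assume "s \<in> (hol p)\<inverse> `` V \<inter> (hol q)\<inverse> `` W"
        then obtain v w where vw: "(s, v) \<in> hol p" "v \<in> V" "(s, w) \<in> hol q" "w \<in> W" by auto
        have "\<not> ((s, e) \<in> hol p \<and> (s, e) \<in> hol q)" for e
        proof
          assume e: "(s, e) \<in> hol p \<and> (s, e) \<in> hol q"
          have "e = v" using sv(1) e vw(1) by blast
          moreover have "e = w" using sv(2) e vw(3) by blast
          ultimately show False using vw VW(5) by auto
        qed
        then show "\<forall>e f g. (s, e) \<in> hol p \<longrightarrow> (s, e) \<in> hol q \<longrightarrow>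
          (t, f) \<in> hol p \<longrightarrow> (t, g) \<in> hol q \<longrightarrow> f = g" by simp
      qed
    next
      case False
      then show ?thesis by (auto intro!: always_eventually)
    qed
  qed
  ultimately show ?thesis
  proof eventually_elim
    case (elim s)
    \<comment> \<open>The points have exchanged roles in \<open>card_UN_Image_le\<close>: end points
      over \<open>t\<close> are carried to end points over \<open>s\<close>.\<close>
    have "card (\<Union>p\<in>L. hol p `` {t}) \<le> card (\<Union>p\<in>L. hol p `` {s})"
    proof (rule card_UN_Image_le[OF L(1)])
      show "single_valued (hol p)" if "p \<in> L" for p using hol_single_valued L(2) that by auto
      show "s \<in> Domain (hol p)" if "p \<in> L" "t \<in> Domain (hol p)" for p using that elim(2) by simp
      show "f = g" if "p \<in> L" "q \<in> L" "(s, e) \<in> hol p" "(s, e) \<in> hol q" "(t, f) \<in> hol p" "(t, g) \<in> hol q"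
        for p q e f g using that elim(3) by metis
    qed
    then show ?case
      unfolding vol_def L_def adj_pow_words[OF t] adj_pow_words[OF elim(1)] .
  qed
qed

section \<open>Points without holonomy, compact cores and upper semicontinuity\<close>

lemma hol_in_pseudogroup: "ps \<in> words \<Longrightarrow> hol ps \<in> holonomy_pseudogroup \<U>"
proof (induction ps)
  case (Cons p ps)
  then have "elem (fst p) (snd p) \<in> holonomy_pseudogroup \<U>"
    unfolding elem_def using \<C>_\<U> by (auto intro!: holonomy_pseudogroup.generator simp: mem_Times_iff)
  then show ?case using Cons by (auto intro: holonomy_pseudogroup.composition)
qed (simp add: holonomy_pseudogroup.identity)

lemma leaves_iff: "L \<in> leaves \<F> \<longleftrightarrow> (\<exists>x\<in>topspace X. L = leaf_through \<F> x)"
  unfolding leaves_def leaf_through_def connected_components_of_def topspace_leaf_topology by auto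

lemma leaf_through_sym: "y \<in> leaf_through \<F> x \<Longrightarrow> leaf_through \<F> y = leaf_through \<F> x"
  unfolding leaf_through_def
  using connected_component_of_equiv[of "leaf_topology \<F>" x y] by auto

lemma leaf_through_self: "x \<in> topspace X \<Longrightarrow> x \<in> leaf_through \<F> x"
  unfolding leaf_through_def by (simp add: connected_component_of_refl topspace_leaf_topology)

lemma leaf_through_subset: "leaf_through \<F> x \<subseteq> topspace X"
  unfolding leaf_through_def using connected_component_of_subset_topspace[of "leaf_topology \<F>"]
  by (simp add: topspace_leaf_topology)

lemma in_Union_leaves_iff:
  "x \<in> \<Union>{L \<in> leaves \<F>. P L} \<longleftrightarrow> x \<in> topspace X \<and> P (leaf_through \<F> x)"
proof
  assume "x \<in> \<Union>{L \<in> leaves \<F>. P L}"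
  then obtain y where y: "P (leaf_through \<F> y)" "x \<in> leaf_through \<F> y" unfolding leaves_iff by auto
  then show "x \<in> topspace X \<and> P (leaf_through \<F> x)"
    using leaf_through_sym[OF y(2)] leaf_through_subset[of y] by auto
next
  assume "x \<in> topspace X \<and> P (leaf_through \<F> x)"
  then show "x \<in> \<Union>{L \<in> leaves \<F>. P L}" using leaf_through_self leaves_iff by auto
qed

lemma X_0_iff: "x \<in> X_0 \<F> \<U> \<longleftrightarrow> x \<in> topspace X \<and> without_holonomy \<U> (leaf_through \<F> x)"
  unfolding X_0_def by (rule in_Union_leaves_iff)

lemma X_0d_iff: "x \<in> X_0d X \<F> \<U> \<longleftrightarrow>
    x \<in> topspace X \<and> dense_leaf X (leaf_through \<F> x) \<and> without_holonomy \<U> (leaf_through \<F> x)"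
  unfolding X_0d_def by (rule in_Union_leaves_iff)

text \<open>A germ is a set of maps to which \<open>h\<close> itself belongs. If it is the germ of
  the identity, this membership yields a neighbourhood on which \<open>h\<close> is the
  identity.\<close>

lemma eventually_fixed_X_0:
  assumes "x \<in> X_0 \<F> \<U>" "c \<in> \<U>" "x \<in> chart_dom c" "h \<in> holonomy_pseudogroup \<U>" "(pr c x, pr c x) \<in> h"
  shows "eventually (\<lambda>s. (s, s) \<in> h) (nhdsin T (pr c x))"
proof -
  let ?t = "pr c x"
  have tT: "?t \<in> topspace T" using pr_in_T assms(2,3) by simp
  have x: "x \<in> topspace X" "without_holonomy \<U> (leaf_through \<F> x)" using assms(1) X_0_iff by auto
  have "holonomy_group \<U> ?t = {holonomy_germ \<U> ?t (Id_on (topspace T))}"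
    using x(2) leaf_through_self[OF x(1)] assms(2,3)
    unfolding without_holonomy_def Let_def pr_def by simp
  moreover have "holonomy_germ \<U> ?t h \<in> holonomy_group \<U> ?t"
    unfolding holonomy_group_def using assms(4,5) by auto
  ultimately have "holonomy_germ \<U> ?t h = holonomy_germ \<U> ?t (Id_on (topspace T))" by simp
  moreover have "h \<in> holonomy_germ \<U> ?t h"
    unfolding holonomy_germ_def using assms(4) tT openin_topspace[of T] by blast
  ultimately have "h \<in> holonomy_germ \<U> ?t (Id_on (topspace T))" by simp
  then obtain W where W: "openin T W" "?t \<in> W" "h \<inter> (W \<times> UNIV) = Id_on (topspace T) \<inter> (W \<times> UNIV)"
    unfolding holonomy_germ_def by auto
  have "(s, s) \<in> h" if "s \<in> W" for s
  proof -
    have "(s, s) \<in> Id_on (topspace T) \<inter> (W \<times> UNIV)" using that openin_subset[OF W(1)] by auto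
    then show ?thesis unfolding W(3)[symmetric] by simp
  qed
  then show ?thesis using W by (intro eventually_nhdsin_openI)
qed

text \<open>Domains of elementary holonomy maps are open but not closed, so \<open>vol\<close> is not upper
  semicontinuous. Shrinking the charts to compact cores makes them closed, and changes the
  growth function only by a linear rescaling of the radius.\<close>

definition core :: "('a, 'z) chart \<Rightarrow> 'a set" where
  "core = (SOME M. (\<forall>c. closedin X (M c)) \<and> (\<forall>c\<in>\<C>. M c \<subseteq> chart_dom c) \<and>
     (\<forall>x\<in>topspace X. \<exists>c\<in>\<C>. x \<in> X interior_of (M c)))"

lemma core:
  "closedin X (core c)" "c \<in> \<C> \<Longrightarrow> core c \<subseteq> chart_dom c"
  "x \<in> topspace X \<Longrightarrow> \<exists>c\<in>\<C>. x \<in> X interior_of (core c)"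
proof -
  have "topspace X \<subseteq> (\<Union>c\<in>\<C>. chart_dom c)" using \<C>_cover by auto
  then obtain M where "\<And>c. closedin X (M c)" "\<And>c. c \<in> \<C> \<Longrightarrow> M c \<subseteq> chart_dom c"
    "\<And>x. x \<in> topspace X \<Longrightarrow> \<exists>c\<in>\<C>. x \<in> X interior_of (M c)"
    using compact_Hausdorff_shrinking[OF compact Hausdorff, of \<C> chart_dom] dom_open[OF \<C>_\<U>] by metis
  then have "\<exists>M. (\<forall>c. closedin X (M c)) \<and> (\<forall>c\<in>\<C>. M c \<subseteq> chart_dom c) \<and>
     (\<forall>x\<in>topspace X. \<exists>c\<in>\<C>. x \<in> X interior_of (M c))" by metis
  from someI_ex[OF this, folded core_def]
  show "closedin X (core c)" "c \<in> \<C> \<Longrightarrow> core c \<subseteq> chart_dom c"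
    "x \<in> topspace X \<Longrightarrow> \<exists>c\<in>\<C>. x \<in> X interior_of (core c)" by simp_all
qed

text \<open>The common point \<open>x\<close> must lie in both cores. The relation is then a
  continuous image of a compact set and has a closed domain; the price is that
  \<open>core_adj\<close> need not be reflexive.\<close>

definition core_elem :: "('a, 'z) chart \<Rightarrow> ('a, 'z) chart \<Rightarrow> (('a, 'z) chart \<times> 'z) rel" where
  "core_elem c d = (if c \<in> \<C> \<and> d \<in> \<C> then (\<lambda>x. (pr c x, pr d x)) ` (core c \<inter> core d) else {})"

abbreviation core_hol :: "(('a, 'z) chart \<times> ('a, 'z) chart) list \<Rightarrow> (('a, 'z) chart \<times> 'z) rel" where
  "core_hol \<equiv> word_rel (topspace T) core_elem"

definition core_adj :: "(('a, 'z) chart \<times> 'z) rel" where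
  "core_adj = (\<Union>c\<in>\<C>. \<Union>d\<in>\<C>. core_elem c d)"

lemma core_elem_subset: "core_elem c d \<subseteq> elem c d"
proof (cases "c \<in> \<C> \<and> d \<in> \<C>")
  case True
  then have "core c \<subseteq> chart_dom c" "core d \<subseteq> chart_dom d" using core(2) by auto
  then show ?thesis
    unfolding core_elem_def elem_def if_P[OF True] elementary_holonomy_def pr_def by blast
qed (auto simp: core_elem_def)

lemma core_elem_subset_T: "core_elem c d \<subseteq> topspace T \<times> topspace T"
  using core_elem_subset elem_subset by (meson subset_trans)

lemma core_adj_subset: "core_adj \<subseteq> adj"
  unfolding core_adj_def adj_def using core_elem_subset by (intro UN_mono) auto

lemma core_hol_subset: "ps \<in> words \<Longrightarrow> core_hol ps \<subseteq> hol ps"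
  by (rule word_rel_mono[OF core_elem_subset])

lemma core_adj_pow_words:
  "t \<in> topspace T \<Longrightarrow> (core_adj ^^ m) `` {t} = (\<Union>ps\<in>{ps \<in> words. length ps = m}. core_hol ps `` {t})"
  unfolding core_adj_def by (rule relpow_UN_word_rel) (rule core_elem_subset_T)

lemma core_elem_preimage_closed:
  assumes "c \<in> \<C>" "d \<in> \<C>" "closedin T K"
  shows "closedin T ((core_elem c d)\<inverse> `` K)"
proof -
  define Y where "Y = {x \<in> core c \<inter> core d. pr d x \<in> K}"
  \<comment> \<open>\<open>pr d\<close> is continuous only on the open domain of \<open>d\<close>,
    so closedness of \<open>Y\<close> in \<open>X\<close> is read off from an open set removed from
    a closed one. Then \<open>Y\<close> is compact and its image is closed in the Hausdorff
    transversal.\<close>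
  have "Y = core c \<inter> core d - {x \<in> chart_dom d. pr d x \<in> topspace T - K}"
    using core(2)[OF assms(2)] pr_in_T[OF \<C>_\<U>[OF assms(2)]] unfolding Y_def by auto
  moreover have "openin X {x \<in> chart_dom d. pr d x \<in> topspace T - K}"
    by (rule pr_preimage_open[OF \<C>_\<U>[OF assms(2)] openin_diff[OF openin_topspace assms(3)]])
  ultimately have "closedin X Y" using core(1) by (simp add: closedin_diff closedin_Int)
  then have "compactin X Y" using compact closedin_compact_space by blast
  moreover have "Y \<subseteq> chart_dom c" using core(2)[OF assms(1)] unfolding Y_def by auto
  ultimately have "compactin (subtopology X (chart_dom c)) Y" by (simp add: compactin_subtopology)
  then have "compactin T (pr c ` Y)"
    using image_compactin pr_continuous[OF \<C>_\<U>[OF assms(1)]] by blast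
  then have "closedin T (pr c ` Y)" using Hausdorff_T compactin_imp_closedin by blast
  moreover have "(core_elem c d)\<inverse> `` K = pr c ` Y"
    unfolding core_elem_def Y_def using assms(1,2) by auto
  ultimately show ?thesis by simp
qed

lemma core_hol_preimage_closed:
  assumes "ps \<in> words" "closedin T K"
  shows "closedin T ((core_hol ps)\<inverse> `` K)"
  using word_rel_preimage[of \<C> "closedin T" core_elem ps "topspace T" K] core_elem_preimage_closed
    closedin_subset[of T] assms by auto

lemma core_vol_upper_semicontinuous:
  assumes x: "x \<in> X_0 \<F> \<U>" "c \<in> \<U>" "x \<in> chart_dom c"
  shows "eventually (\<lambda>s. card ((core_adj ^^ m) `` {s}) \<le> card ((core_adj ^^ m) `` {pr c x}))
    (nhdsin T (pr c x))"
proof -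
  define t where "t = pr c x"
  have t: "t \<in> topspace T" using pr_in_T x t_def by simp
  define L where "L = {ps \<in> words. length ps = m}"
  have L: "finite L" "\<And>p. p \<in> L \<Longrightarrow> p \<in> words" unfolding L_def using finite_words by auto
  have "eventually (\<lambda>s. s \<in> topspace T) (nhdsin T t)"
    by (rule eventually_nhdsin_openI[OF openin_topspace t])
  moreover have "eventually (\<lambda>s. \<forall>p\<in>L. s \<in> Domain (core_hol p) \<longrightarrow> t \<in> Domain (core_hol p)) (nhdsin T t)"
  proof (intro eventually_ball_finite L(1) ballI)
    fix p assume p: "p \<in> L"
    show "eventually (\<lambda>s. s \<in> Domain (core_hol p) \<longrightarrow> t \<in> Domain (core_hol p)) (nhdsin T t)"
    proof (cases "t \<in> Domain (core_hol p)")
      \<comment> \<open>Closedness of the domains is used here: a word undefined at \<open>t\<close>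
        stays undefined nearby, so no new path appears.\<close>
      case False
      have "core_hol p \<subseteq> topspace T \<times> topspace T" by (rule word_rel_subset) (rule core_elem_subset_T)
      then have "Domain (core_hol p) = (core_hol p)\<inverse> `` topspace T" by auto
      then have "closedin T (Domain (core_hol p))"
        using core_hol_preimage_closed[OF L(2)[OF p] closedin_topspace] by simp
      then have "openin T (topspace T - Domain (core_hol p))" by auto
      then show ?thesis using False t by (rule_tac eventually_nhdsin_openI[of T "topspace T - Domain (core_hol p)"]) blast+
    qed simp
  qed
  moreover have "eventually (\<lambda>s. \<forall>p\<in>L. \<forall>q\<in>L. \<forall>e f g. (t, e) \<in> core_hol p \<longrightarrow> (t, e) \<in> core_hol q \<longrightarrow>
      (s, f) \<in> core_hol p \<longrightarrow> (s, g) \<in> core_hol q \<longrightarrow> f = g) (nhdsin T t)"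
  proof (intro eventually_ball_finite L(1) ballI)
    fix p q assume pq: "p \<in> L" "q \<in> L"
    note sv = single_valuedD[OF hol_single_valued[OF L(2)[OF pq(1)]]]
      single_valuedD[OF hol_single_valued[OF L(2)[OF pq(2)]]]
    note sub = core_hol_subset[OF L(2)[OF pq(1)]] core_hol_subset[OF L(2)[OF pq(2)]]
    show "eventually (\<lambda>s. \<forall>e f g. (t, e) \<in> core_hol p \<longrightarrow> (t, e) \<in> core_hol q \<longrightarrow>
      (s, f) \<in> core_hol p \<longrightarrow> (s, g) \<in> core_hol q \<longrightarrow> f = g) (nhdsin T t)"
    proof (cases "\<exists>e. (t, e) \<in> core_hol p \<and> (t, e) \<in> core_hol q")
      case True
      then obtain e where "(t, e) \<in> hol p" "(t, e) \<in> hol q" using sub by auto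
      \<comment> \<open>Going out along \<open>p\<close> and back along \<open>q\<close> fixes
        \<open>t\<close>, hence all nearby \<open>s\<close>. The loop is formed in
        \<open>hol\<close>, since core relations need not lie in the pseudogroup; single-valuedness
        of \<open>hol\<close> then identifies the end points of the core words.\<close>
      then have "(t, t) \<in> hol p O (hol q)\<inverse>" by auto
      moreover have "hol p O (hol q)\<inverse> \<in> holonomy_pseudogroup \<U>"
        using hol_in_pseudogroup L(2) pq
        by (intro holonomy_pseudogroup.composition holonomy_pseudogroup.inversion) auto
      ultimately have "eventually (\<lambda>s. (s, s) \<in> hol p O (hol q)\<inverse>) (nhdsin T t)"
        unfolding t_def by (rule_tac eventually_fixed_X_0[OF x])
      then show ?thesis
      proof eventually_elim
        case (elim s)
        then obtain u where u: "(s, u) \<in> hol p" "(s, u) \<in> hol q" by auto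
        have "f = g" if "(s, f) \<in> core_hol p" "(s, g) \<in> core_hol q" for f g
        proof -
          have "f = u" using sv(1)[OF _ u(1)] that(1) sub(1) by blast
          moreover have "g = u" using sv(2)[OF _ u(2)] that(2) sub(2) by blast
          ultimately show ?thesis by simp
        qed
        then show ?case by simp
      qed
    next
      case False
      then show ?thesis by (auto intro!: always_eventually)
    qed
  qed
  ultimately have "eventually (\<lambda>s. card ((core_adj ^^ m) `` {s}) \<le> card ((core_adj ^^ m) `` {t}))
    (nhdsin T t)"
  proof eventually_elim
    case (elim s)
    have "card (\<Union>p\<in>L. core_hol p `` {s}) \<le> card (\<Union>p\<in>L. core_hol p `` {t})"
    proof (rule card_UN_Image_le[OF L(1)])
      show "single_valued (core_hol p)" if "p \<in> L" for p
        using single_valued_subset[OF core_hol_subset hol_single_valued] L(2) that by auto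
      show "t \<in> Domain (core_hol p)" if "p \<in> L" "s \<in> Domain (core_hol p)" for p using that elim(2) by simp
      show "f = g" if "p \<in> L" "q \<in> L" "(t, e) \<in> core_hol p" "(t, e) \<in> core_hol q"
        "(s, f) \<in> core_hol p" "(s, g) \<in> core_hol q"
        for p q e f g using that elim(3) by metis
    qed
    then show ?case
      unfolding L_def core_adj_pow_words[OF t] core_adj_pow_words[OF elim(1)] .
  qed
  then show ?thesis unfolding t_def .
qed

section \<open>Growth at nearby points\<close>

lemma core_adjI: "x \<in> core c \<Longrightarrow> x \<in> core d \<Longrightarrow> c \<in> \<C> \<Longrightarrow> d \<in> \<C> \<Longrightarrow> (pr c x, pr d x) \<in> core_adj"
  unfolding core_adj_def core_elem_def by auto

lemma core_adj_refl2: "(a, b) \<in> core_adj \<Longrightarrow> (b, b) \<in> core_adj"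
  unfolding core_adj_def core_elem_def by (auto split: if_splits)

text \<open>\<open>core_adj\<close> has loops only at plaques that meet the core of their own chart,
  so padding a path requires \<open>y \<in> core d\<close>.\<close>

lemma core_adj_pow_mono:
  assumes "(a, pr d y) \<in> core_adj ^^ j" "y \<in> core d" "d \<in> \<C>" "j \<le> k"
  shows "(a, pr d y) \<in> core_adj ^^ k"
  using assms(1,4) core_adjI[OF assms(2,2,3,3)] core_adj_refl2
  by (rule_tac relpow_mono_refl_on[of core_adj "pr d y" a j k])

lemma core_adj_pow_subset: "core_adj ^^ k \<subseteq> adj ^^ k"
  by (induction k) (simp_all add: relcomp_mono core_adj_subset)

text \<open>A path of plaques may enter and leave a plaque at distant points, and the intermediate
  plaque itself may miss its core. It is replaced by a detour along the plaque through overlaps in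
  cores, whose length \<open>q\<close> does not depend on the plaque.\<close>

lemma core_path_in_plaque:
  assumes c: "c \<in> \<C>"
  shows "\<exists>q. \<forall>z x y. \<forall>e\<in>\<C>. \<forall>f\<in>\<C>. x \<in> plaque c z \<longrightarrow> y \<in> plaque c z \<longrightarrow> x \<in> core e \<longrightarrow> y \<in> core f \<longrightarrow>
    (pr e x, pr f y) \<in> core_adj ^^ q"
proof -
  note cU = \<C>_\<U>[OF c]
  \<comment> \<open>The compact set to be covered is the closure of the domain of \<open>c\<close>.
    It may leave that domain, so local changes of coordinates are taken from the larger chart
    \<open>d\<close>, whose transversal projection extends that of \<open>c\<close>.\<close>
  obtain d where d: "d \<in> \<F>" "chart_restriction c d" "X closure_of (chart_dom c) \<subseteq> chart_dom d"
    using regular_atlasD(3) cU by auto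
  have proj_d: "transversal_proj d x = transversal_proj c x" if "x \<in> chart_dom c" for x
    using d(2) that unfolding chart_restriction_def transversal_proj_def by simp
  \<comment> \<open>Sets small enough to lie in one core and to let a plaque of \<open>c\<close> run
    inside a single plaque of that chart. Moving along the plaque within one such set changes no
    vertex of the graph.\<close>
  define \<O> where "\<O> = {V. openin X V \<and> (\<exists>e\<in>\<C>. V \<subseteq> core e \<and> (\<forall>x\<in>V \<inter> chart_dom c. \<forall>y\<in>V \<inter> chart_dom c.
      transversal_proj c x = transversal_proj c y \<longrightarrow> transversal_proj e x = transversal_proj e y))}"
  have "X closure_of (chart_dom c) \<subseteq> \<Union>\<O>"
  proof
    fix p assume p: "p \<in> X closure_of (chart_dom c)"
    then have pX: "p \<in> topspace X" by (simp add: in_closure_of)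
    obtain e where e: "e \<in> \<C>" "p \<in> X interior_of (core e)" using core(3)[OF pX] by auto
    have ed: "p \<in> chart_dom e" using e core(2)[OF e(1)] interior_of_subset[of X "core e"] by auto
    have pd: "p \<in> chart_dom d" using p d(3) by auto
    obtain V where V: "openin X V" "p \<in> V" "V \<subseteq> chart_dom d \<inter> chart_dom e"
      "\<And>x y. x \<in> V \<Longrightarrow> y \<in> V \<Longrightarrow> transversal_proj d x = transversal_proj d y \<Longrightarrow>
         transversal_proj e x = transversal_proj e y"
      using local_change[OF d(1) \<U>_\<F>[OF \<C>_\<U>[OF e(1)]] pd ed] by metis
    have "V \<inter> X interior_of (core e) \<in> \<O>"
      unfolding \<O>_def mem_Collect_eq
    proof (intro conjI bexI[OF _ e(1)] ballI impI)
      show "openin X (V \<inter> X interior_of (core e))" using V(1) by (intro openin_Int) auto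
      show "V \<inter> X interior_of core e \<subseteq> core e" using interior_of_subset[of X "core e"] by auto
      fix x y assume xy: "x \<in> V \<inter> X interior_of core e \<inter> chart_dom c"
        "y \<in> V \<inter> X interior_of core e \<inter> chart_dom c" "transversal_proj c x = transversal_proj c y"
      then show "transversal_proj e x = transversal_proj e y"
        using V(4)[of x y] proj_d[of x] proj_d[of y] by auto
    qed
    then show "p \<in> \<Union>\<O>" using V(2) e(2) by auto
  qed
  moreover have "compactin X (X closure_of (chart_dom c))"
    using compact closedin_compact_space closedin_closure_of by blast
  moreover have "\<And>V. V \<in> \<O> \<Longrightarrow> openin X V" unfolding \<O>_def by simp
  ultimately obtain \<V> where V: "finite \<V>" "\<V> \<subseteq> \<O>" "X closure_of (chart_dom c) \<subseteq> \<Union>\<V>"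
    unfolding compactin_def by metis
  have op: "\<And>V. V \<in> \<V> \<Longrightarrow> openin X V" using V(2) unfolding \<O>_def by auto
  have "\<forall>V\<in>\<V>. \<exists>e\<in>\<C>. V \<subseteq> core e \<and> (\<forall>x\<in>V \<inter> chart_dom c. \<forall>y\<in>V \<inter> chart_dom c.
      transversal_proj c x = transversal_proj c y \<longrightarrow> transversal_proj e x = transversal_proj e y)"
    using V(2) unfolding \<O>_def by auto
  then obtain \<epsilon> where \<epsilon>: "\<And>V. V \<in> \<V> \<Longrightarrow> \<epsilon> V \<in> \<C>" "\<And>V. V \<in> \<V> \<Longrightarrow> V \<subseteq> core (\<epsilon> V)"
    "\<And>V x y. V \<in> \<V> \<Longrightarrow> x \<in> V \<Longrightarrow> y \<in> V \<Longrightarrow> x \<in> chart_dom c \<Longrightarrow> y \<in> chart_dom c \<Longrightarrow>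
      transversal_proj c x = transversal_proj c y \<Longrightarrow> transversal_proj (\<epsilon> V) x = transversal_proj (\<epsilon> V) y"
    by (metis IntI)
  have "(pr e x, pr f y) \<in> core_adj ^^ (card \<V> + 1)"
    if ef: "e \<in> \<C>" "f \<in> \<C>" and xy: "x \<in> plaque c z" "y \<in> plaque c z" "x \<in> core e" "y \<in> core f" for e f x y z
  proof -
    define P where "P = plaque c z"
    have P: "P = {x \<in> chart_dom c. transversal_proj c x = z}"
      unfolding P_def by (rule plaque_eq[OF chart_\<U>[OF cU]])
    have conn: "connectedin X P" unfolding P_def by (rule connectedin_plaque[OF chart_\<U>[OF cU]])
    have "P \<subseteq> X closure_of (chart_dom c)"
      unfolding P using closure_of_subset[of "chart_dom c" X] dom_topspace[OF cU] by auto
    then have PV: "P \<subseteq> \<Union>\<V>" using V(3) by auto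
    have same: "pr (\<epsilon> V) u = pr (\<epsilon> V) v" if "V \<in> \<V>" "u \<in> V" "v \<in> V" "u \<in> P" "v \<in> P" for V u v
      unfolding pr_def using \<epsilon>(3)[OF that(1-3)] that(4,5) unfolding P by simp
    have xP: "x \<in> P" "y \<in> P" using xy P_def by auto
    obtain V W where VW: "V \<in> \<V>" "x \<in> V" "W \<in> \<V>" "y \<in> W" using PV xP by (metis UnionE subsetD)
    let ?r = "{(A, B). A \<in> \<V> \<and> B \<in> \<V> \<and> A \<inter> B \<inter> P \<noteq> {}}"
    obtain j where j: "j < card \<V>" "(V, W) \<in> ?r ^^ j"
      using connectedin_finite_cover_chain[OF conn V(1) op PV VW(1,2) xP(1) VW(3,4) xP(2)] by auto
    have step: "(pr (\<epsilon> V) x, pr (\<epsilon> A) u) \<in> core_adj ^^ i" if "(V, A) \<in> ?r ^^ i" "A \<in> \<V>" "u \<in> A" "u \<in> P" for i A u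
      using that
    proof (induction i arbitrary: A u)
      case 0
      then show ?case using same[OF VW(1,2), of u] xP by simp
    next
      case (Suc i)
      then obtain B v where B: "(V, B) \<in> ?r ^^ i" "B \<in> \<V>" "v \<in> B" "v \<in> A" "v \<in> P" by auto
      have "(pr (\<epsilon> V) x, pr (\<epsilon> B) v) \<in> core_adj ^^ i" using Suc.IH[OF B(1-3,5)] .
      moreover have "(pr (\<epsilon> B) v, pr (\<epsilon> A) v) \<in> core_adj"
        using \<epsilon>(1,2) B(2-4) Suc.prems(2) by (intro core_adjI) auto
      moreover have "pr (\<epsilon> A) v = pr (\<epsilon> A) u"
        by (rule same[OF Suc.prems(2) B(4) Suc.prems(3) B(5) Suc.prems(4)])
      ultimately show ?case by auto
    qed
    have a: "(pr (\<epsilon> V) x, pr (\<epsilon> W) y) \<in> core_adj ^^ j" using step[OF j(2) VW(3,4) xP(2)] .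
    have b: "(pr e x, pr (\<epsilon> V) x) \<in> core_adj" using \<epsilon>(1,2)[OF VW(1)] VW(2) ef xy by (intro core_adjI) auto
    have "(pr (\<epsilon> W) y, pr f y) \<in> core_adj" using \<epsilon>(1,2)[OF VW(3)] VW(4) ef xy by (intro core_adjI) auto
    \<comment> \<open>One step from \<open>e\<close> into the chain, \<open>j\<close> overlaps, and
      one step out to \<open>f\<close>. As \<open>j < card \<V>\<close>, padding reaches the common
      length \<open>card \<V> + 1\<close>.\<close>
    then have "(pr e x, pr f y) \<in> core_adj ^^ Suc (Suc j)"
      by (rule relpow_Suc_I[OF relpow_Suc_I2[OF b a]])
    then show ?thesis by (rule core_adj_pow_mono) (use xy ef j in auto)
  qed
  then show ?thesis by (intro exI[of _ "card \<V> + 1"]) auto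
qed

lemma core_path_uniform:
  "\<exists>q. \<forall>t x y. \<forall>e\<in>\<C>. \<forall>f\<in>\<C>. t \<in> topspace T \<longrightarrow> x \<in> pl t \<longrightarrow> y \<in> pl t \<longrightarrow> x \<in> core e \<longrightarrow> y \<in> core f \<longrightarrow>
    (pr e x, pr f y) \<in> core_adj ^^ q"
proof -
  obtain Q where Q: "\<And>c z x y e f. c \<in> \<C> \<Longrightarrow> e \<in> \<C> \<Longrightarrow> f \<in> \<C> \<Longrightarrow> x \<in> plaque c z \<Longrightarrow> y \<in> plaque c z \<Longrightarrow>
    x \<in> core e \<Longrightarrow> y \<in> core f \<Longrightarrow> (pr e x, pr f y) \<in> core_adj ^^ Q c"
    using core_path_in_plaque by metis
  \<comment> \<open>The sum only serves as a common upper bound for the finitely many lengths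
    \<open>Q c\<close>.\<close>
  have "(pr e x, pr f y) \<in> core_adj ^^ (\<Sum>c\<in>\<C>. Q c)"
    if t: "t \<in> topspace T" "x \<in> pl t" "y \<in> pl t" and e: "e \<in> \<C>" "f \<in> \<C>" "x \<in> core e" "y \<in> core f" for t x y e f
  proof -
    have c: "fst t \<in> \<C>" using t pl_iff by auto
    have "(pr e x, pr f y) \<in> core_adj ^^ Q (fst t)" using Q[OF c e(1,2) t(2,3) e(3,4)] .
    then show ?thesis
      by (rule core_adj_pow_mono[OF _ e(4,2)]) (use member_le_sum[OF c, of Q] finite_\<C> in auto)
  qed
  then show ?thesis by metis
qed

lemma ex_core: "x \<in> topspace X \<Longrightarrow> \<exists>c\<in>\<C>. x \<in> core c"
  using core(3) interior_of_subset by (metis subsetD)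

text \<open>A path of \<open>m\<close> steps runs through \<open>m + 1\<close> plaques, each crossed
  by at most \<open>K\<close> core steps. The last plaque is only adjacent to the vertex reached,
  which costs the factor \<open>card \<C>\<close>.\<close>

lemma vol_le_core_vol:
  obtains K where "\<And>c x m. c \<in> \<C> \<Longrightarrow> x \<in> core c \<Longrightarrow>
    vol (pr c x) m \<le> card \<C> * card ((core_adj ^^ (K * Suc m)) `` {pr c x})"
proof -
  obtain K where K: "\<And>t x y e f. e \<in> \<C> \<Longrightarrow> f \<in> \<C> \<Longrightarrow> t \<in> topspace T \<Longrightarrow> x \<in> pl t \<Longrightarrow> y \<in> pl t \<Longrightarrow>
    x \<in> core e \<Longrightarrow> y \<in> core f \<Longrightarrow> (pr e x, pr f y) \<in> core_adj ^^ K"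
    using core_path_uniform by metis
  have "vol (pr c x) m \<le> card \<C> * card ((core_adj ^^ (K * Suc m)) `` {pr c x})"
    if c: "c \<in> \<C>" and x: "x \<in> core c" for c x m
  proof -
    have xd: "x \<in> chart_dom c" using core(2)[OF c] x by auto
    have tT: "pr c x \<in> topspace T" "x \<in> pl (pr c x)" using pr_in_T[OF \<C>_\<U>[OF c] xd] pl_pr[OF \<C>_\<U>[OF c]] xd by auto
    have path: "(pr c x, pr f y) \<in> core_adj ^^ (K * Suc i)"
      if "(pr c x, s) \<in> adj ^^ i" "f \<in> \<C>" "y \<in> pl s" "y \<in> core f" for i s f y
      using that
    proof (induction i arbitrary: s f y)
      case 0
      then have "y \<in> pl (pr c x)" by simp
      then show ?case using K[OF c 0(2) tT(1,2) _ x 0(4)] by simp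
    next
      case (Suc i)
      then obtain u where u: "(pr c x, u) \<in> adj ^^ i" "(u, s) \<in> adj" by auto
      then obtain v where v: "v \<in> pl u" "v \<in> pl s" "s \<in> topspace T" unfolding adj_iff by auto
      have "v \<in> topspace X" using v(2) pl_iff[OF v(3)] dom_topspace \<C>_\<U> by metis
      then obtain g where g: "g \<in> \<C>" "v \<in> core g" using ex_core by auto
      have "(pr c x, pr g v) \<in> core_adj ^^ (K * Suc i)" using Suc.IH[OF u(1) g(1) v(1) g(2)] .
      moreover have "(pr g v, pr f y) \<in> core_adj ^^ K"
        using K[OF g(1) Suc.prems(2) v(3,2) Suc.prems(3) g(2) Suc.prems(4)] .
      ultimately have "(pr c x, pr f y) \<in> core_adj ^^ (K * Suc i + K)" by (rule relpow_comp)
      then show ?case by (simp add: add.commute)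
    qed
    let ?S = "(core_adj ^^ (K * Suc m)) `` {pr c x}"
    have "?S \<subseteq> (adj ^^ (K * Suc m)) `` {pr c x}" by (rule Image_mono[OF core_adj_pow_subset subset_refl])
    then have "finite ?S" by (rule finite_subset[OF _ finite_adj_pow])
    moreover have "(adj ^^ m) `` {pr c x} \<subseteq> adj `` ?S"
    proof
      fix s assume "s \<in> (adj ^^ m) `` {pr c x}"
      then have s: "(pr c x, s) \<in> adj ^^ m" by simp
      have sT: "s \<in> topspace T" by (rule adj_pow_in_T[OF tT(1) s])
      then obtain y where y: "y \<in> pl s" using pl_nonempty[of s] by auto
      have "y \<in> topspace X" using y pl_iff[OF sT] dom_topspace \<C>_\<U> by metis
      then obtain f where f: "f \<in> \<C>" "y \<in> core f" using ex_core by auto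
      have yf: "y \<in> chart_dom f" using core(2)[OF f(1)] f(2) by auto
      have "(pr f y, s) \<in> adj"
        using pr_in_T[OF \<C>_\<U>[OF f(1)] yf] pl_pr[OF \<C>_\<U>[OF f(1)]] yf sT y by (intro adjI) auto
      moreover have "(pr c x, pr f y) \<in> core_adj ^^ (K * Suc m)" using path[OF s f(1) y f(2)] .
      ultimately show "s \<in> adj `` ?S" by auto
    qed
    ultimately have "vol (pr c x) m \<le> card (adj `` ?S)"
      unfolding vol_def using card_adj_Image_le(1) by (intro card_mono) auto
    also have "\<dots> \<le> card \<C> * card ?S" using card_adj_Image_le(2) \<open>finite ?S\<close> by auto
    finally show ?thesis .
  qed
  then show thesis by (rule that)
qed

section \<open>Growth as a function of a point of the space\<close>

definition core_chart :: "'a \<Rightarrow> ('a, 'z) chart" where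
  "core_chart x = (SOME c. c \<in> \<C> \<and> x \<in> X interior_of (core c))"

definition growth :: "'a \<Rightarrow> nat \<Rightarrow> nat" where
  "growth x m = vol (pr (core_chart x) x) m"

lemma core_chart:
  assumes "x \<in> topspace X"
  shows "core_chart x \<in> \<C>" "x \<in> X interior_of (core (core_chart x))" "x \<in> chart_dom (core_chart x)"
proof -
  have "\<exists>c. c \<in> \<C> \<and> x \<in> X interior_of (core c)" using core(3)[OF assms] by auto
  from someI_ex[OF this, folded core_chart_def]
  show *: "core_chart x \<in> \<C>" "x \<in> X interior_of (core (core_chart x))" by auto
  then show "x \<in> chart_dom (core_chart x)"
    using core(2) interior_of_subset by (metis subsetD)
qed

lemma growth_mono: "x \<in> topspace X \<Longrightarrow> m \<le> k \<Longrightarrow> growth x m \<le> growth x k"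
  unfolding growth_def using core_chart pr_in_T[OF \<C>_\<U>] by (intro vol_mono) auto

lemma pr_adj:
  assumes "c \<in> \<C>" "d \<in> \<C>" "x \<in> chart_dom c" "x \<in> chart_dom d"
  shows "(pr c x, pr d x) \<in> adj"
  using assms pr_in_T[OF \<C>_\<U>] pl_pr[OF \<C>_\<U>] by (intro adjI) auto

text \<open>The two extra steps change from the chosen charts to \<open>c\<close> at
  \<open>x\<close> and from \<open>d\<close> at \<open>y\<close>.\<close>

lemma growth_shift:
  assumes "x \<in> topspace X" "c \<in> \<C>" "x \<in> chart_dom c" "y \<in> topspace X" "d \<in> \<C>" "y \<in> chart_dom d"
    "(pr c x, pr d y) \<in> adj ^^ k"
  shows "growth y m \<le> growth x (m + (k + 2))"
  unfolding growth_def
proof (rule vol_shift)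
  have "(pr (core_chart x) x, pr c x) \<in> adj" using core_chart[OF assms(1)] assms by (intro pr_adj) auto
  then have "(pr (core_chart x) x, pr d y) \<in> adj ^^ Suc k" using assms(7) by (rule relpow_Suc_I2)
  moreover have "(pr d y, pr (core_chart y) y) \<in> adj" using core_chart[OF assms(4)] assms by (intro pr_adj) auto
  ultimately have "(pr (core_chart x) x, pr (core_chart y) y) \<in> adj ^^ Suc (Suc k)" by (rule relpow_Suc_I)
  then show "(pr (core_chart x) x, pr (core_chart y) y) \<in> adj ^^ (k + 2)" by simp
qed

lemma growth_leaf:
  assumes "x \<in> topspace X" "y \<in> leaf_through \<F> x"
  shows "\<exists>j. \<forall>m. growth x m \<le> growth y (m + j) \<and> growth y m \<le> growth x (m + j)"
proof -
  obtain s t k where s: "s \<in> topspace T" "x \<in> pl s" "y \<in> pl t" "(s, t) \<in> adj ^^ k"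
    using assms(2) leaf_through_iff by auto
  have t: "t \<in> topspace T" using adj_pow_in_T s by auto
  have "fst s \<in> \<C>" "x \<in> chart_dom (fst s)" "s = pr (fst s) x" using s pl_iff by auto
  moreover have "fst t \<in> \<C>" "y \<in> chart_dom (fst t)" "t = pr (fst t) y" using s t pl_iff by auto
  moreover have "y \<in> topspace X" using assms(2) leaf_through_subset by auto
  ultimately have "growth y m \<le> growth x (m + (k + 2))" "growth x m \<le> growth y (m + (k + 2))" for m
    using growth_shift assms(1) s(4) adj_pow_sym[OF s(4)] by metis+
  then show ?thesis by blast
qed

lemma eventually_pr:
  assumes "c \<in> \<U>" "x \<in> chart_dom c" "eventually P (nhdsin T (pr c x))"
  shows "eventually (\<lambda>y. P (pr c y)) (nhdsin X x)"
proof -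
  obtain W where W: "openin T W" "pr c x \<in> W" "\<And>s. s \<in> W \<Longrightarrow> P s"
    using assms(3) pr_in_T[OF assms(1,2)] unfolding eventually_nhdsin by auto
  show ?thesis
    by (rule eventually_nhdsin_openI[OF pr_preimage_open[OF assms(1) W(1)]]) (use assms W in auto)
qed

text \<open>Only the neighbourhood depends on \<open>x\<close> and \<open>m\<close>. For
  \<open>m \<ge> 1\<close> additive losses become factors: \<open>m + 1 \<le> 2 * m\<close> for the
  change of chart at \<open>y\<close>, and \<open>m + 2 \<le> 3 * m\<close> for that change together
  with the additional plaque counted in \<open>vol_le_core_vol\<close>. The summands 1 in the
  constants make them positive.\<close>

lemma local_growth:
  "\<exists>N K. N \<ge> 1 \<and> K \<ge> 1 \<and> (\<forall>x\<in>X_0 \<F> \<U>. \<forall>m\<ge>1.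
     eventually (\<lambda>y. growth x m \<le> growth y (2 * m) \<and> growth y m \<le> N * growth x (K * m)) (nhdsin X x))"
proof -
  obtain K where K: "\<And>c x m. c \<in> \<C> \<Longrightarrow> x \<in> core c \<Longrightarrow>
    vol (pr c x) m \<le> card \<C> * card ((core_adj ^^ (K * Suc m)) `` {pr c x})"
    using vol_le_core_vol by metis
  have "eventually (\<lambda>y. growth x m \<le> growth y (2 * m) \<and>
      growth y m \<le> (card \<C> + 1) * growth x ((3 * K + 1) * m)) (nhdsin X x)"
    if x: "x \<in> X_0 \<F> \<U>" and m: "m \<ge> 1" for x m
  proof -
    define c where "c = core_chart x"
    have xX: "x \<in> topspace X" using x X_0_iff by auto
    have c: "c \<in> \<C>" "x \<in> X interior_of (core c)" "x \<in> chart_dom c" "c \<in> \<U>"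
      using core_chart[OF xX] \<C>_\<U> unfolding c_def by auto
    \<comment> \<open>The chosen chart has \<open>x\<close> in the interior of its core, so nearby
      \<open>y\<close> lie in the same core and \<open>vol_le_core_vol\<close> applies to
      \<open>pr c y\<close>.\<close>
    have "eventually (\<lambda>y. y \<in> X interior_of (core c)) (nhdsin X x)"
      by (rule eventually_nhdsin_openI[OF openin_interior_of c(2)])
    moreover have "eventually (\<lambda>y. vol (pr c x) m \<le> vol (pr c y) m) (nhdsin X x)"
      by (rule eventually_pr[OF c(4,3) vol_lower_semicontinuous[OF pr_in_T[OF c(4,3)]]])
    moreover have "eventually (\<lambda>y. card ((core_adj ^^ (K * (m + 2))) `` {pr c y}) \<le>
        card ((core_adj ^^ (K * (m + 2))) `` {pr c x})) (nhdsin X x)"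
      by (rule eventually_pr[OF c(4,3) core_vol_upper_semicontinuous[OF x c(4,3)]])
    ultimately show ?thesis
    proof eventually_elim
      case (elim y)
      have y: "y \<in> core c" "y \<in> chart_dom c" "y \<in> topspace X"
        using elim(1) interior_of_subset[of X "core c"] core(2)[OF c(1)] dom_topspace[OF c(4)] by auto
      have adj: "(pr (core_chart y) y, pr c y) \<in> adj ^^ 1" "(pr c y, pr (core_chart y) y) \<in> adj ^^ 1"
        using pr_adj c(1) y core_chart[OF y(3)] by auto
      have "growth x m \<le> vol (pr c y) m" unfolding growth_def c_def[symmetric] by (rule elim(2))
      also have "\<dots> \<le> growth y (m + 1)" unfolding growth_def by (rule vol_shift[OF adj(1)])
      also have "\<dots> \<le> growth y (2 * m)" using m by (intro growth_mono y(3)) auto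
      finally have 1: "growth x m \<le> growth y (2 * m)" .
      have "growth y m \<le> vol (pr c y) (m + 1)" unfolding growth_def by (rule vol_shift[OF adj(2)])
      also have "\<dots> \<le> card \<C> * card ((core_adj ^^ (K * (m + 2))) `` {pr c y})"
        using K[OF c(1) y(1), of "m + 1"] by simp
      also have "\<dots> \<le> card \<C> * card ((core_adj ^^ (K * (m + 2))) `` {pr c x})"
        using elim(3) by (rule mult_left_mono) simp
      also have "\<dots> \<le> card \<C> * vol (pr c x) (K * (m + 2))"
        unfolding vol_def
        by (intro mult_left_mono card_mono finite_adj_pow Image_mono core_adj_pow_subset) auto
      also have "\<dots> = card \<C> * growth x (K * (m + 2))" unfolding growth_def c_def ..
      also have "\<dots> \<le> (card \<C> + 1) * growth x ((3 * K + 1) * m)"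
      proof (rule mult_mono[OF _ growth_mono[OF xX]])
        have "K * (m + 2) \<le> K * (3 * m)" using m by (intro mult_left_mono) auto
        also have "\<dots> \<le> (3 * K + 1) * m" by (simp add: algebra_simps)
        finally show "K * (m + 2) \<le> (3 * K + 1) * m" .
      qed auto
      finally have "growth y m \<le> (card \<C> + 1) * growth x ((3 * K + 1) * m)" .
      with 1 show ?case by simp
    qed
  qed
  then show ?thesis by (intro exI[of _ "card \<C> + 1"] exI[of _ "3 * K + 1"]) auto
qed

section \<open>Leaves without holonomy are generic\<close>

lemma pseudogroup_injective:
  "h \<in> holonomy_pseudogroup \<U> \<Longrightarrow> single_valued h \<and> single_valued (h\<inverse>)"
proof (induction rule: holonomy_pseudogroup.induct)
  case (generator c d)
  then show ?case
    using elementary_holonomy_single_valued elementary_holonomy_converse by metis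
next
  case (composition g h)
  then show ?case using single_valued_relcomp by (auto simp: converse_relcomp)
next
  case (restriction h W)
  then show ?case unfolding single_valued_def by auto
qed (auto simp: single_valued_def)

text \<open>Restrictions and combinations change only domains, so every map of the pseudogroup is
  locally a word. Trivial holonomy thereby becomes a condition on countably many maps.\<close>

lemma pseudogroup_words:
  "h \<in> holonomy_pseudogroup \<U> \<Longrightarrow> (s, t) \<in> h \<Longrightarrow>
    \<exists>ps\<in>words. (s, t) \<in> hol ps \<and> (\<exists>W. openin T W \<and> s \<in> W \<and> hol ps \<inter> (W \<times> UNIV) \<subseteq> h)"
proof (induction arbitrary: s t rule: holonomy_pseudogroup.induct)
  case (generator c d)
  obtain x where x: "x \<in> chart_dom c" "x \<in> chart_dom d" "s = pr c x" "t = pr d x"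
    using generator(3) unfolding elementary_holonomy_iff by auto
  have cd: "c \<in> \<C>" "d \<in> \<C>" using generator(1,2) x \<C>_I by auto
  have eq: "hol [(c, d)] = elementary_holonomy c d"
    using word_rel_singleton[of elem "topspace T" c d] elem_subset cd by (simp add: elem_def)
  show ?case
  proof (intro bexI[of _ "[(c, d)]"] conjI exI[of _ "topspace T"])
    show "s \<in> topspace T" using x pr_in_T generator(1) by simp
    show "(s, t) \<in> hol [(c, d)]" "hol [(c, d)] \<inter> (topspace T \<times> UNIV) \<subseteq> elementary_holonomy c d"
      unfolding eq using generator(3) by auto
  qed (use cd in auto)
next
  case identity
  then show ?case by (intro bexI[of _ "[]"] conjI exI[of _ "topspace T"]) auto
next
  case (composition g h)
  obtain u where u: "(s, u) \<in> g" "(u, t) \<in> h" using composition.prems by auto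
  obtain ps W where p: "ps \<in> words" "(s, u) \<in> hol ps" "openin T W" "s \<in> W" "hol ps \<inter> (W \<times> UNIV) \<subseteq> g"
    using composition.IH(1)[OF u(1)] by auto
  obtain qs W' where q: "qs \<in> words" "(u, t) \<in> hol qs" "openin T W'" "u \<in> W'" "hol qs \<inter> (W' \<times> UNIV) \<subseteq> h"
    using composition.IH(2)[OF u(2)] by auto
  show ?case
  proof (intro bexI[of _ "ps @ qs"] conjI exI[of _ "W \<inter> (hol ps)\<inverse> `` W'"])
    show "openin T (W \<inter> (hol ps)\<inverse> `` W')" using p q hol_preimage_open by (intro openin_Int) auto
    show "(s, t) \<in> hol (ps @ qs)" unfolding hol_append using p q by auto
    show "hol (ps @ qs) \<inter> ((W \<inter> (hol ps)\<inverse> `` W') \<times> UNIV) \<subseteq> g O h"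
    proof
      fix z assume "z \<in> hol (ps @ qs) \<inter> ((W \<inter> (hol ps)\<inverse> `` W') \<times> UNIV)"
      then obtain a b c b' where z: "z = (a, c)" "(a, b) \<in> hol ps" "(b, c) \<in> hol qs" "a \<in> W"
        "(a, b') \<in> hol ps" "b' \<in> W'" unfolding hol_append by auto
      have "b = b'" using single_valuedD[OF hol_single_valued[OF p(1)] z(2,5)] .
      then have "(a, b) \<in> g" "(b, c) \<in> h" using z p(5) q(5) by auto
      then show "z \<in> g O h" using z(1) by auto
    qed
  qed (use p q in auto)
next
  case (inversion h)
  have ts: "(t, s) \<in> h" using inversion.prems by simp
  obtain ps W where p: "ps \<in> words" "(t, s) \<in> hol ps" "openin T W" "t \<in> W" "hol ps \<inter> (W \<times> UNIV) \<subseteq> h"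
    using inversion.IH[OF ts] by auto
  show ?case
  proof (intro bexI[of _ "map prod.swap (rev ps)"] conjI exI[of _ "hol ps `` W"])
    show "map prod.swap (rev ps) \<in> words" by (rule rev_words[OF p(1)])
    show "openin T (hol ps `` W)" by (rule hol_image_open[OF p(1,3)])
    show "(s, t) \<in> hol (map prod.swap (rev ps))" "s \<in> hol ps `` W"
      unfolding hol_converse[symmetric] using p by auto
    show "hol (map prod.swap (rev ps)) \<inter> (hol ps `` W \<times> UNIV) \<subseteq> h\<inverse>"
    proof
      fix z assume "z \<in> hol (map prod.swap (rev ps)) \<inter> (hol ps `` W \<times> UNIV)"
      then obtain a b b' where z: "z = (a, b)" "(b, a) \<in> hol ps" "(b', a) \<in> hol ps" "b' \<in> W"
        unfolding hol_converse[symmetric] by auto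
      have "single_valued ((hol ps)\<inverse>)"
        unfolding hol_converse by (rule hol_single_valued[OF rev_words[OF p(1)]])
      then have "b = b'" using z(2,3) by (auto dest: single_valuedD)
      then show "z \<in> h\<inverse>" using z p(5) by auto
    qed
  qed
next
  case (restriction h W)
  have st: "(s, t) \<in> h" "s \<in> W" using restriction.prems by auto
  obtain ps W' where p: "ps \<in> words" "(s, t) \<in> hol ps" "openin T W'" "s \<in> W'" "hol ps \<inter> (W' \<times> UNIV) \<subseteq> h"
    using restriction.IH[OF st(1)] by auto
  show ?case
  proof (intro bexI[of _ ps] conjI exI[of _ "W \<inter> W'"])
    show "openin T (W \<inter> W')" using restriction.hyps p by (intro openin_Int) auto
  qed (use p st in auto)
next
  case (combination \<G>)
  obtain h where h: "h \<in> \<G>" "(s, t) \<in> h" using combination.prems by auto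
  then obtain ps W where "ps \<in> words" "(s, t) \<in> hol ps" "openin T W" "s \<in> W" "hol ps \<inter> (W \<times> UNIV) \<subseteq> h"
    using combination.IH by (metis (no_types, lifting))
  then show ?case using h(1) by (intro bexI[of _ ps] conjI exI[of _ W]) auto
qed

text \<open>Converse of \<open>eventually_fixed_X_0\<close>: on a neighbourhood of fixed points a
  single-valued \<open>h\<close> agrees with the identity, and agreement near a point gives equal
  germs.\<close>

lemma without_holonomyI:
  assumes fixed: "\<And>y d h. y \<in> L \<Longrightarrow> d \<in> \<U> \<Longrightarrow> y \<in> chart_dom d \<Longrightarrow> h \<in> holonomy_pseudogroup \<U> \<Longrightarrow>
    (pr d y, pr d y) \<in> h \<Longrightarrow> eventually (\<lambda>s. (s, s) \<in> h) (nhdsin T (pr d y))"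
  shows "without_holonomy \<U> L"
  unfolding without_holonomy_def Let_def pr_def[symmetric]
proof (intro ballI impI)
  fix y d assume y: "y \<in> L" "d \<in> \<U>" "y \<in> chart_dom d"
  let ?t = "pr d y" and ?id = "Id_on (topspace T)"
  have tT: "?t \<in> topspace T" using pr_in_T y by simp
  have eq: "holonomy_germ \<U> ?t h = holonomy_germ \<U> ?t ?id"
    if h: "h \<in> holonomy_pseudogroup \<U>" "(?t, ?t) \<in> h" for h
  proof -
    obtain W where W: "openin T W" "?t \<in> W" "\<And>s. s \<in> W \<Longrightarrow> (s, s) \<in> h"
      using fixed[OF y h] tT unfolding eventually_nhdsin by auto
    have WT: "W \<subseteq> topspace T" using W(1) by (rule openin_subset)
    have agree: "h \<inter> (W \<times> UNIV) = ?id \<inter> (W \<times> UNIV)"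
      using W(3) WT single_valuedD[OF conjunct1[OF pseudogroup_injective[OF h(1)]]] by (auto simp: Id_on_iff) blast+
    have sub: "holonomy_germ \<U> ?t f \<subseteq> holonomy_germ \<U> ?t g"
      if "f \<inter> (W \<times> UNIV) = g \<inter> (W \<times> UNIV)" for f g
    proof
      fix k assume "k \<in> holonomy_germ \<U> ?t f"
      then obtain V where V: "k \<in> holonomy_pseudogroup \<U>" "openin T V" "?t \<in> V"
        "k \<inter> (V \<times> UNIV) = f \<inter> (V \<times> UNIV)" unfolding holonomy_germ_def by auto
      have "k \<inter> ((V \<inter> W) \<times> UNIV) = g \<inter> ((V \<inter> W) \<times> UNIV)" using V(4) that by auto
      then show "k \<in> holonomy_germ \<U> ?t g"
        unfolding holonomy_germ_def using V W(1,2)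
        by (intro CollectI conjI exI[of _ "V \<inter> W"] openin_Int) auto
    qed
    show ?thesis using sub[OF agree] sub[OF agree[symmetric]] by (rule subset_antisym)
  qed
  have id: "(?t, ?t) \<in> ?id" using tT by auto
  show "holonomy_group \<U> ?t = {holonomy_germ \<U> ?t ?id}"
  proof (intro subset_antisym subsetI)
    fix G assume "G \<in> holonomy_group \<U> ?t"
    then obtain h where "G = holonomy_germ \<U> ?t h" "h \<in> holonomy_pseudogroup \<U>" "(?t, ?t) \<in> h"
      unfolding holonomy_group_def by blast
    then have "G = holonomy_germ \<U> ?t ?id" using eq by metis
    then show "G \<in> {holonomy_germ \<U> ?t ?id}" by simp
  next
    fix G assume "G \<in> {holonomy_germ \<U> ?t ?id}"
    then show "G \<in> holonomy_group \<U> ?t"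
      unfolding holonomy_group_def using id holonomy_pseudogroup.identity[of \<U>] by blast
  qed
qed

text \<open>Holonomy at the points of a leaf is conjugate along paths, so words fixing a single
  point of the leaf decide.\<close>

lemma X_0I:
  assumes x: "x \<in> topspace X" "c \<in> \<C>" "x \<in> chart_dom c"
    and fixed: "\<And>ps. ps \<in> words \<Longrightarrow> (pr c x, pr c x) \<in> hol ps \<Longrightarrow>
      eventually (\<lambda>s. (s, s) \<in> hol ps) (nhdsin T (pr c x))"
  shows "x \<in> X_0 \<F> \<U>"
  unfolding X_0_iff
proof (intro conjI x(1) without_holonomyI)
  fix y d h assume y: "y \<in> leaf_through \<F> x" "d \<in> \<U>" "y \<in> chart_dom d"
    and h: "h \<in> holonomy_pseudogroup \<U>" "(pr d y, pr d y) \<in> h"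
  obtain s t k where s: "s \<in> topspace T" "x \<in> pl s" "y \<in> pl t" "(s, t) \<in> adj ^^ k"
    using y(1) leaf_through_iff by auto
  have tT: "t \<in> topspace T" using adj_pow_in_T s by auto
  have pT: "pr c x \<in> topspace T" "pr d y \<in> topspace T" using pr_in_T \<C>_\<U> x y by auto
  have "(pr c x, s) \<in> adj" using s x pT pl_pr[OF \<C>_\<U>] by (intro adjI[of _ _ x]) auto
  moreover have "(t, pr d y) \<in> adj" using s y pT tT pl_pr by (intro adjI[of _ _ y]) auto
  ultimately have "(pr c x, pr d y) \<in> adj ^^ Suc (Suc k)"
    using relpow_Suc_I[OF relpow_Suc_I2[OF _ s(4)]] by metis
  then have "pr d y \<in> (adj ^^ Suc (Suc k)) `` {pr c x}" by simp
  then obtain qs where qs: "qs \<in> words" "(pr c x, pr d y) \<in> hol qs"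
    unfolding adj_pow_words[OF pT(1)] by auto
  obtain ps W where ps: "ps \<in> words" "(pr d y, pr d y) \<in> hol ps" "openin T W" "pr d y \<in> W"
    "hol ps \<inter> (W \<times> UNIV) \<subseteq> h"
    using pseudogroup_words[OF h] by auto
  \<comment> \<open>The conjugate of \<open>ps\<close> by the path \<open>qs\<close> is a word
    fixing \<open>pr c x\<close>. A neighbourhood that it fixes is carried by \<open>qs\<close> to
    one fixed by \<open>ps\<close>.\<close>
  define w where "w = qs @ ps @ map prod.swap (rev qs)"
  have hw: "hol w = hol qs O hol ps O (hol qs)\<inverse>"
    unfolding w_def hol_append hol_converse ..
  have "w \<in> words" using qs(1) ps(1) rev_words[OF qs(1)] unfolding w_def by simp
  moreover have "(pr c x, pr c x) \<in> hol w" unfolding hw using qs(2) ps(2) by auto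
  ultimately have "eventually (\<lambda>s. (s, s) \<in> hol w) (nhdsin T (pr c x))" by (rule fixed)
  then obtain V where V: "openin T V" "pr c x \<in> V" "\<And>s. s \<in> V \<Longrightarrow> (s, s) \<in> hol w"
    using pT(1) unfolding eventually_nhdsin by auto
  show "eventually (\<lambda>s. (s, s) \<in> h) (nhdsin T (pr d y))"
  proof (rule eventually_nhdsin_openI)
    show "openin T (W \<inter> hol qs `` V)" using ps(3) hol_image_open[OF qs(1) V(1)] by (rule openin_Int)
    show "pr d y \<in> W \<inter> hol qs `` V" using ps(4) qs(2) V(2) by auto
    fix s assume s: "s \<in> W \<inter> hol qs `` V"
    then obtain v where v: "v \<in> V" "(v, s) \<in> hol qs" by auto
    obtain a b where ab: "(v, a) \<in> hol qs" "(a, b) \<in> hol ps" "(v, b) \<in> hol qs"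
      using V(3)[OF v(1)] unfolding hw by auto
    note sv = single_valuedD[OF hol_single_valued[OF qs(1)]]
    have "a = s" "b = s" using sv[OF ab(1) v(2)] sv[OF ab(3) v(2)] by auto
    then show "(s, s) \<in> h" using ab(2) ps(5) s by auto
  qed
qed

text \<open>The boundary of the fixed point set of a holonomy map is nowhere dense, and there are
  countably many words.\<close>

lemma X_0_residual:
  obtains \<N> where "countable \<N>" "\<And>N. N \<in> \<N> \<Longrightarrow> closedin X N" "\<And>N. N \<in> \<N> \<Longrightarrow> X interior_of N = {}"
    "topspace X \<subseteq> X_0 \<F> \<U> \<union> \<Union>\<N>"
proof -
  define B where "B c ps = {x \<in> chart_dom c. (pr c x, pr c x) \<in> hol ps \<and>
    \<not> eventually (\<lambda>s. (s, s) \<in> hol ps) (nhdsin T (pr c x))}" for c ps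
  have empty: "X interior_of (X closure_of B c ps) = {}" if c: "c \<in> \<C>" and ps: "ps \<in> words" for c ps
  proof (rule ccontr)
    note cU = \<C>_\<U>[OF c]
    define O1 where "O1 = X interior_of (X closure_of B c ps)"
    assume "X interior_of (X closure_of B c ps) \<noteq> {}"
    then have ne: "O1 \<noteq> {}" "openin X O1" "O1 \<subseteq> X closure_of B c ps"
      unfolding O1_def by (auto simp: interior_of_subset)
    then obtain p where "p \<in> O1" "p \<in> X closure_of B c ps" by auto
    then obtain x where x: "x \<in> B c ps" "x \<in> O1" using ne(2) unfolding in_closure_of by auto
    define D where "D = {y \<in> chart_dom c. pr c y \<in> Domain (hol ps)}"
    have "Domain (hol ps) = (hol ps)\<inverse> `` topspace T" using hol_subset[of ps] by auto
    then have opD: "openin T (Domain (hol ps))" using hol_preimage_open[OF ps openin_topspace] by simp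
    have D: "openin X D" unfolding D_def by (rule pr_preimage_open[OF cU opD])
    \<comment> \<open>Fixed points are relatively closed in the domain \<open>D\<close>, and
      \<open>O1\<close> lies in the closure of fixed points, so all of \<open>O1 \<inter> D\<close>
      is fixed. Its open projection is then a fixed neighbourhood of \<open>pr c x\<close>, against
      \<open>x \<in> B c ps\<close>.\<close>
    have fixD: "(pr c y, pr c y) \<in> hol ps" if y: "y \<in> O1 \<inter> D" for y
    proof (rule ccontr)
      assume nfix: "(pr c y, pr c y) \<notin> hol ps"
      have yc: "y \<in> chart_dom c" using y D_def by auto
      obtain e where e: "(pr c y, e) \<in> hol ps" using y D_def by auto
      have "e \<noteq> pr c y" using e nfix by auto
      moreover have "e \<in> topspace T" "pr c y \<in> topspace T" using e hol_subset[of ps] by auto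
      ultimately obtain V W where VW: "openin T V" "openin T W" "e \<in> V" "pr c y \<in> W" "V \<inter> W = {}"
        using T_Hausdorff by metis
      define Q where "Q = {u \<in> chart_dom c. pr c u \<in> W \<inter> (hol ps)\<inverse> `` V}"
      have "openin X Q" unfolding Q_def
        by (rule pr_preimage_open[OF cU openin_Int[OF VW(2) hol_preimage_open[OF ps VW(1)]]])
      moreover have "y \<in> Q" unfolding Q_def using yc VW e by auto
      moreover have "y \<in> X closure_of B c ps" using y ne(3) by auto
      ultimately obtain u where u: "u \<in> B c ps" "u \<in> Q" unfolding in_closure_of by auto
      obtain v where v: "(pr c u, v) \<in> hol ps" "v \<in> V" "pr c u \<in> W" using u(2) unfolding Q_def by auto
      have "(pr c u, pr c u) \<in> hol ps" using u(1) unfolding B_def by simp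
      then have "v = pr c u" using single_valuedD[OF hol_single_valued[OF ps] v(1)] by simp
      then show False using v VW(5) by auto
    qed
    have xD: "x \<in> O1 \<inter> D" using x unfolding B_def D_def by auto
    have "openin T (pr c ` (O1 \<inter> D))"
      using ne(2) D cU by (intro pr_open openin_Int) (auto simp: D_def)
    then have "eventually (\<lambda>s. (s, s) \<in> hol ps) (nhdsin T (pr c x))"
      by (rule eventually_nhdsin_openI) (use xD fixD in auto)
    then show False using x(1) unfolding B_def by simp
  qed
  define \<N> where "\<N> = (\<lambda>(c, ps). X closure_of B c ps) ` (\<C> \<times> words)"
  show thesis
  proof (rule that)
    show "countable \<N>" unfolding \<N>_def using finite_\<C> by (intro countable_image countable_SIGMA countable_lists countable_finite) auto
    show "closedin X N" if "N \<in> \<N>" for N using that unfolding \<N>_def by auto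
    show "X interior_of N = {}" if "N \<in> \<N>" for N using that empty unfolding \<N>_def by auto
    show "topspace X \<subseteq> X_0 \<F> \<U> \<union> \<Union>\<N>"
    proof
      fix x assume x: "x \<in> topspace X"
      obtain c where c: "c \<in> \<C>" "x \<in> chart_dom c" using \<C>_cover[OF x] by auto
      show "x \<in> X_0 \<F> \<U> \<union> \<Union>\<N>"
      proof (cases "\<exists>ps\<in>words. x \<in> B c ps")
        case True
        then obtain ps where ps: "ps \<in> words" "x \<in> B c ps" by auto
        have "B c ps \<subseteq> topspace X" unfolding B_def using dom_topspace[OF \<C>_\<U>[OF c(1)]] by auto
        then have "x \<in> X closure_of B c ps" using ps(2) closure_of_subset by blast
        then show ?thesis unfolding \<N>_def using c(1) ps(1) by force
      next
        case False
        then have "x \<in> X_0 \<F> \<U>" using c unfolding B_def by (intro X_0I[OF x c]) auto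
        then show ?thesis by simp
      qed
    qed
  qed
qed

section \<open>Comparison of growth functions\<close>

text \<open>Integer form of \<open>equi_dominate\<close>: it avoids rounding of radii, and the two
  conversions below show that nothing is lost.\<close>

definition comparable :: "'a set \<Rightarrow> bool" where
  "comparable S \<longleftrightarrow> (\<exists>A B D. B \<ge> 1 \<and> (\<forall>x\<in>S. \<forall>y\<in>S. \<forall>m\<ge>D. growth x m \<le> A * growth y (B * m)))"

lemma leaf_growth_le_growth:
  assumes "x \<in> topspace X" "r \<le> real m" "2 \<le> m"
  shows "leaf_growth \<F> \<U> x r \<le> real (growth x m)"
  unfolding growth_def using core_chart[OF assms(1)] \<C>_\<U> assms by (intro leaf_growth_le_vol) auto

lemma growth_le_leaf_growth:
  assumes "x \<in> topspace X" "real m + 1 < r"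
  shows "real (growth x m) \<le> real (card \<C>) * leaf_growth \<F> \<U> x r"
  unfolding growth_def using core_chart[OF assms(1)] \<C>_\<U> assms by (intro vol_le_leaf_growth) auto

lemma leaf_growth_nonneg: "0 \<le> leaf_growth \<F> \<U> x r"
  unfolding leaf_growth_def by simp

lemma comparable_if_equi_dominate:
  assumes S: "S \<subseteq> topspace X" and eq: "equi_dominate (leaf_growth \<F> \<U> ` S)"
  shows "comparable S"
proof -
  obtain a b c where abc: "a \<ge> 1" "b \<ge> 1" "c > 0"
    and dom: "\<And>x y r. x \<in> S \<Longrightarrow> y \<in> S \<Longrightarrow> r \<ge> c \<Longrightarrow> leaf_growth \<F> \<U> x r \<le> a * leaf_growth \<F> \<U> y (b * r)"
    using eq unfolding equi_dominate_def dominated_with_def by auto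
  \<comment> \<open>\<open>growth x m\<close> is bounded by the leaf growth at radius
    \<open>m + 2\<close>, and \<open>m + 2 \<le> 3 * m\<close> for large \<open>m\<close>. The 2 in
    \<open>D\<close> ensures \<open>B * m \<ge> 2\<close>, as required for returning to
    \<open>growth\<close>.\<close>
  define B where "B = nat \<lceil>3 * b\<rceil>"
  define D where "D = nat \<lceil>c\<rceil> + 2"
  define A where "A = nat \<lceil>real (card \<C>) * a\<rceil>"
  have B: "3 * b \<le> real B" "B \<ge> 1" unfolding B_def using abc by linarith+
  have A: "real (card \<C>) * a \<le> real A" unfolding A_def by linarith
  have "growth x m \<le> A * growth y (B * m)" if xy: "x \<in> S" "y \<in> S" and m: "m \<ge> D" for x y m
  proof -
    have mc: "real m \<ge> c" "m \<ge> 2" using m unfolding D_def by linarith+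
    have X: "x \<in> topspace X" "y \<in> topspace X" using xy S by auto
    have le: "b * (real m + 2) \<le> real (B * m)"
    proof -
      have "b * (real m + 2) \<le> b * (3 * real m)" using mc abc by (intro mult_left_mono) auto
      also have "\<dots> = (3 * b) * real m" by simp
      also have "\<dots> \<le> real B * real m" using B(1) by (intro mult_right_mono) auto
      finally show ?thesis by simp
    qed
    have "2 * 1 \<le> m * B" using mc B by (intro mult_mono) auto
    then have 2: "2 \<le> B * m" by (simp add: mult.commute)
    have "real (growth x m) \<le> real (card \<C>) * leaf_growth \<F> \<U> x (real m + 2)"
      by (rule growth_le_leaf_growth[OF X(1)]) simp
    also have "\<dots> \<le> real (card \<C>) * (a * leaf_growth \<F> \<U> y (b * (real m + 2)))"
      using mc by (intro mult_left_mono dom xy) auto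
    also have "\<dots> = (real (card \<C>) * a) * leaf_growth \<F> \<U> y (b * (real m + 2))" by simp
    also have "\<dots> \<le> real A * real (growth y (B * m))"
      using A leaf_growth_le_growth[OF X(2) le 2] leaf_growth_nonneg by (intro mult_mono) auto
    finally have "real (growth x m) \<le> real (A * growth y (B * m))" by simp
    then show ?thesis by (simp only: of_nat_le_iff)
  qed
  then show ?thesis unfolding comparable_def using B(2) by blast
qed

lemma equi_dominate_if_comparable:
  assumes S: "S \<subseteq> topspace X" and eq: "comparable S"
  shows "equi_dominate (leaf_growth \<F> \<U> ` S)"
proof -
  obtain A B D where B: "B \<ge> 1"
    and cmp: "\<And>x y m. x \<in> S \<Longrightarrow> y \<in> S \<Longrightarrow> m \<ge> D \<Longrightarrow> growth x m \<le> A * growth y (B * m)"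
    using eq unfolding comparable_def by metis
  \<comment> \<open>The 1 gives \<open>a \<ge> 1\<close>. For \<open>b\<close>: the rounded radius
    \<open>k\<close> is at most \<open>2 * r\<close>, and the strict bound
    \<open>B * k + 1 < b * r\<close> needs the further 2.\<close>
  define a where "a = real A * real (card \<C>) + 1"
  define b where "b = 2 * real B + 2"
  have "leaf_growth \<F> \<U> x r \<le> a * leaf_growth \<F> \<U> y (b * r)"
    if xy: "x \<in> S" "y \<in> S" and r: "r \<ge> real D + 2" for x y r
  proof -
    have X: "x \<in> topspace X" "y \<in> topspace X" using xy S by auto
    define k where "k = nat \<lceil>r\<rceil>"
    have k: "r \<le> real k" "real k \<le> r + 1" unfolding k_def using r by linarith+
    have kD: "k \<ge> D" "k \<ge> 2" using k r by linarith+
    have "real B * real k \<le> real B * (2 * r)" using k r by (intro mult_left_mono) auto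
    then have lt: "real (B * k) + 1 < b * r" unfolding b_def using r by (simp add: algebra_simps)
    have "leaf_growth \<F> \<U> x r \<le> real (growth x k)"
      by (rule leaf_growth_le_growth[OF X(1) k(1) kD(2)])
    also have "\<dots> \<le> real (A * growth y (B * k))" using cmp[OF xy kD(1)] by (simp only: of_nat_le_iff)
    also have "\<dots> = real A * real (growth y (B * k))" by simp
    also have "\<dots> \<le> real A * (real (card \<C>) * leaf_growth \<F> \<U> y (b * r))"
      by (rule mult_left_mono[OF growth_le_leaf_growth[OF X(2) lt]]) simp
    also have "\<dots> \<le> a * leaf_growth \<F> \<U> y (b * r)"
      unfolding a_def using leaf_growth_nonneg[of y "b * r"] by (simp add: algebra_simps)
    finally show ?thesis .
  qed
  moreover have "a \<ge> 1" "b \<ge> 1" "real D + 2 > 0" unfolding a_def b_def by auto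
  ultimately show ?thesis
    unfolding equi_dominate_def dominated_with_def
    by (intro exI[of _ a] exI[of _ b] exI[of _ "real D + 2"]) auto
qed

section \<open>Comparison with a fixed function\<close>

definition comparable_with :: "nat \<Rightarrow> nat \<Rightarrow> nat \<Rightarrow> (nat \<Rightarrow> nat) \<Rightarrow> 'a \<Rightarrow> bool" where
  "comparable_with A B D f x \<longleftrightarrow>
    (\<forall>m\<ge>D. growth x m \<le> A * f (B * m) \<and> f m \<le> A * growth x (B * m))"

text \<open>Two points are compared through \<open>f\<close>, which squares both factors;
  \<open>B \<ge> 1\<close> keeps the second radius \<open>B * m\<close> above the threshold.
  Comparison with \<open>f\<close> concerns one point at a time, as closures and Baire's theorem
  require.\<close>

lemma comparable_if_comparable_with:
  assumes B: "B \<ge> 1" and S: "\<And>x. x \<in> S \<Longrightarrow> comparable_with A B D f x"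
  shows "comparable S"
proof -
  have "growth x m \<le> (A * A) * growth y ((B * B) * m)" if "x \<in> S" "y \<in> S" "m \<ge> D" for x y m
  proof -
    have "m \<le> B * m" using B by (cases B) auto
    then have "D \<le> B * m" using that(3) by linarith
    have "growth x m \<le> A * f (B * m)" using S[OF that(1)] that(3) unfolding comparable_with_def by simp
    also have "\<dots> \<le> A * (A * growth y (B * (B * m)))"
      using S[OF that(2)] \<open>D \<le> B * m\<close> unfolding comparable_with_def by (intro mult_left_mono) auto
    finally show ?thesis by (simp add: mult.assoc)
  qed
  moreover have "1 * 1 \<le> B * B" using B by (intro mult_mono) auto
  ultimately show ?thesis unfolding comparable_def by (metis mult_1)
qed

lemma in_closure_of_eventually:
  assumes "x \<in> X closure_of S" "eventually P (nhdsin X x)"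
  shows "\<exists>y\<in>S. P y"
proof -
  have "x \<in> topspace X" using assms(1) by (simp add: in_closure_of)
  then obtain V where "openin X V" "x \<in> V" "\<And>y. y \<in> V \<Longrightarrow> P y"
    using assms(2) unfolding eventually_nhdsin by auto
  then show ?thesis using assms(1) unfolding in_closure_of by blast
qed

text \<open>Near a point without holonomy, balls of any fixed radius look alike, so comparison with
  \<open>f\<close> passes to the closure as long as its constants do not depend on the point.\<close>

lemma comparable_with_closure:
  "\<exists>N K. K \<ge> 1 \<and> (\<forall>A B D f S y. mono f \<longrightarrow> B \<ge> 1 \<longrightarrow> (\<forall>x\<in>S. comparable_with A B D f x) \<longrightarrow>
    y \<in> X_0 \<F> \<U> \<longrightarrow> y \<in> X closure_of S \<longrightarrow> comparable_with (A * N) (2 * K * B) (Suc D) f y)"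
proof -
  obtain N K where NK: "N \<ge> 1" "K \<ge> 1"
    "\<forall>x\<in>X_0 \<F> \<U>. \<forall>m\<ge>1.
       eventually (\<lambda>y. growth x m \<le> growth y (2 * m) \<and> growth y m \<le> N * growth x (K * m)) (nhdsin X x)"
    using local_growth by blast
  have "comparable_with (A * N) (2 * K * B) (Suc D) f y"
    if f: "mono f" and B: "B \<ge> 1" and S: "\<forall>x\<in>S. comparable_with A B D f x"
      and y: "y \<in> X_0 \<F> \<U>" "y \<in> X closure_of S" for A B D f S y
    unfolding comparable_with_def
  proof (intro allI impI)
    fix m assume "m \<ge> Suc D"
    then have m: "m \<ge> D" "m \<ge> 1" by auto
    have yX: "y \<in> topspace X" using y(1) X_0_iff by auto
    have "m \<le> B * m" using B by (cases B) auto
    then have Bm: "B * m \<ge> 1" using m(2) by linarith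
    have "B * m \<le> K * (B * m)" using NK(2) by (cases K) auto
    then have le: "B * (2 * m) \<le> 2 * K * B * m" "K * (B * m) \<le> 2 * K * B * m"
      by (simp_all add: algebra_simps)
    \<comment> \<open>Radius \<open>m\<close> serves to bound the growth at \<open>y\<close> from
      above and radius \<open>B * m\<close> to bound it from below. The point \<open>x\<close> found
      in \<open>S\<close> depends on \<open>m\<close>, its constants do not.\<close>
    let ?P = "\<lambda>x. (growth y m \<le> growth x (2 * m) \<and> growth x m \<le> N * growth y (K * m)) \<and>
      (growth y (B * m) \<le> growth x (2 * (B * m)) \<and> growth x (B * m) \<le> N * growth y (K * (B * m)))"
    have "eventually ?P (nhdsin X y)"
      by (rule eventually_conj[OF NK(3)[rule_format, OF y(1) m(2)] NK(3)[rule_format, OF y(1) Bm]])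
    then have "\<exists>x\<in>S. ?P x" by (rule in_closure_of_eventually[OF y(2)])
    then obtain x where x: "x \<in> S" "growth y m \<le> growth x (2 * m)" "growth x (B * m) \<le> N * growth y (K * (B * m))"
      by auto
    have xS: "\<forall>m\<ge>D. growth x m \<le> A * f (B * m) \<and> f m \<le> A * growth x (B * m)"
      using S x(1) unfolding comparable_with_def by blast
    have "growth y m \<le> growth x (2 * m)" by (rule x(2))
    also have "\<dots> \<le> A * f (B * (2 * m))" using m xS by simp
    also have "\<dots> \<le> (A * N) * f ((2 * K * B) * m)"
      using monoD[OF f le(1)] NK(1) by (intro mult_mono) auto
    finally have 1: "growth y m \<le> (A * N) * f ((2 * K * B) * m)" .
    have "f m \<le> A * growth x (B * m)" using m xS by simp
    also have "\<dots> \<le> A * (N * growth y (K * (B * m)))" using x(3) by (intro mult_left_mono) auto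
    also have "\<dots> = (A * N) * growth y (K * (B * m))" by (simp only: mult.assoc)
    also have "\<dots> \<le> (A * N) * growth y ((2 * K * B) * m)"
      by (rule mult_left_mono[OF growth_mono[OF yX le(2)]]) simp
    finally have "f m \<le> (A * N) * growth y ((2 * K * B) * m)" .
    with 1 show "growth y m \<le> (A * N) * f ((2 * K * B) * m) \<and> f m \<le> (A * N) * growth y ((2 * K * B) * m)" ..
  qed
  then show ?thesis using NK(2) by (intro exI[of _ N] exI[of _ K] conjI allI impI) auto
qed

lemma mono_growth: "x \<in> topspace X \<Longrightarrow> mono (growth x)"
  by (intro monoI growth_mono)

text \<open>Any point of \<open>S\<close> supplies the reference function, and every point without
  holonomy is a limit of \<open>S\<close>. For (i), \<open>S\<close> is the growth symmetric
  leaf.\<close>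

lemma comparable_X_0_if_dense:
  assumes S: "S \<subseteq> topspace X" "comparable S" "X closure_of S = topspace X"
  shows "comparable (X_0 \<F> \<U>)"
proof (cases "S = {}")
  case True
  then have "X_0 \<F> \<U> = {}" using S(3) X_0_iff by auto
  then show ?thesis unfolding comparable_def by auto
next
  case False
  then obtain x0 where x0: "x0 \<in> S" by auto
  obtain A B D where B: "B \<ge> 1"
    and cmp: "\<And>x y m. x \<in> S \<Longrightarrow> y \<in> S \<Longrightarrow> m \<ge> D \<Longrightarrow> growth x m \<le> A * growth y (B * m)"
    using S(2) unfolding comparable_def by metis
  obtain N K where K: "K \<ge> 1" and NK: "\<And>A B D f S y. mono f \<Longrightarrow> B \<ge> 1 \<Longrightarrow>
      \<forall>x\<in>S. comparable_with A B D f x \<Longrightarrow> y \<in> X_0 \<F> \<U> \<Longrightarrow> y \<in> X closure_of S \<Longrightarrow>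
      comparable_with (A * N) (2 * K * B) (Suc D) f y"
    using comparable_with_closure by blast
  have "comparable_with (A * N) (2 * K * B) (Suc D) (growth x0) y" if "y \<in> X_0 \<F> \<U>" for y
  proof (rule NK[OF mono_growth B _ that])
    show "x0 \<in> topspace X" using x0 S(1) by auto
    show "\<forall>x\<in>S. comparable_with A B D (growth x0) x"
      using cmp x0 unfolding comparable_with_def by simp
    show "y \<in> X closure_of S" using that X_0_iff S(3) by auto
  qed
  moreover have "2 * K * B \<ge> 1" using K B by (simp add: Suc_leI)
  ultimately show ?thesis using comparable_if_comparable_with by blast
qed

section \<open>Uniform return and Baire's theorem for minimal foliations\<close>

lemma adj_preimage_open: "openin T W \<Longrightarrow> openin T ((adj ^^ k)\<inverse> `` W)"
proof (induction k arbitrary: W)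
  case 0
  then show ?case by simp
next
  case (Suc k)
  have "adj\<inverse> `` W = (\<Union>c\<in>\<C>. \<Union>d\<in>\<C>. (elem c d)\<inverse> `` W)" unfolding adj_def by blast
  then have "openin T (adj\<inverse> `` W)" using elem_preimage_open[OF Suc.prems] by (auto intro!: openin_Union)
  then have "openin T ((adj ^^ k)\<inverse> `` (adj\<inverse> `` W))" by (rule Suc.IH)
  moreover have "(adj ^^ Suc k)\<inverse> `` W = (adj ^^ k)\<inverse> `` (adj\<inverse> `` W)" by auto
  ultimately show ?case by simp
qed

text \<open>The points from which \<open>V\<close> is reached in \<open>k\<close> steps form an open
  set, because adjacency is a union of maps with open preimages. These sets cover \<open>X\<close>
  by minimality, and finitely many suffice.\<close>

lemma minimal_uniform_return:
  assumes min: "minimal_foliation X \<F>" and V: "openin X V" "V \<noteq> {}"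
  obtains R where "\<And>x. x \<in> topspace X \<Longrightarrow> \<exists>y\<in>V. y \<in> leaf_through \<F> x \<and>
    (\<forall>m. growth x m \<le> growth y (m + R) \<and> growth y m \<le> growth x (m + R))"
proof -
  define W where "W = (\<Union>d\<in>\<C>. pr d ` (V \<inter> chart_dom d))"
  have W: "openin T W" unfolding W_def
    using V(1) dom_open[OF \<C>_\<U>] \<C>_\<U> by (auto intro!: openin_Union pr_open openin_Int)
  define O1 where "O1 k = (\<Union>c\<in>\<C>. {x \<in> chart_dom c. pr c x \<in> (adj ^^ k)\<inverse> `` W})" for k
  have op: "openin X (O1 k)" for k unfolding O1_def
    using pr_preimage_open[OF \<C>_\<U> adj_preimage_open[OF W]] by (auto intro!: openin_Union)
  have "topspace X \<subseteq> \<Union>(range O1)"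
  proof
    fix x assume x: "x \<in> topspace X"
    have "leaf_through \<F> x \<in> leaves \<F>" using leaves_iff x by auto
    then have "X closure_of (leaf_through \<F> x) = topspace X"
      using min unfolding minimal_foliation_def dense_leaf_def by auto
    moreover obtain v where v: "v \<in> V" "v \<in> topspace X" using V openin_subset by auto
    ultimately have "v \<in> X closure_of (leaf_through \<F> x)" by simp
    then obtain y where y: "y \<in> leaf_through \<F> x" "y \<in> V" using v(1) V(1) unfolding in_closure_of by auto
    obtain s t k where s: "s \<in> topspace T" "x \<in> pl s" "y \<in> pl t" "(s, t) \<in> adj ^^ k"
      using y(1) leaf_through_iff by auto
    have tT: "t \<in> topspace T" using adj_pow_in_T s by auto
    have t: "fst t \<in> \<C>" "y \<in> chart_dom (fst t)" "t = pr (fst t) y" using s tT pl_iff by auto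
    have sx: "fst s \<in> \<C>" "x \<in> chart_dom (fst s)" "s = pr (fst s) x" using s pl_iff by auto
    have "t \<in> W" unfolding W_def using t y(2) by blast
    then have "s \<in> (adj ^^ k)\<inverse> `` W" using s(4) by auto
    then have "x \<in> {x \<in> chart_dom (fst s). pr (fst s) x \<in> (adj ^^ k)\<inverse> `` W}" using sx by simp
    then have "x \<in> O1 k" unfolding O1_def using sx(1) by (rule UN_I[rotated])
    then show "x \<in> \<Union>(range O1)" by auto
  qed
  then obtain \<O> where O: "finite \<O>" "\<O> \<subseteq> range O1" "topspace X \<subseteq> \<Union>\<O>"
    using compact op unfolding compact_space_def compactin_def by (metis rangeE)
  obtain I where I: "finite I" "\<O> = O1 ` I" using finite_subset_image[OF O(1,2)] by auto
  define R where "R = Max (insert 0 I)"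
  show thesis
  proof (rule that)
    fix x assume x: "x \<in> topspace X"
    then obtain k where k: "k \<in> I" "x \<in> O1 k" using O(3) I(2) by auto
    have kR: "k \<le> R" unfolding R_def using I(1) k(1) by auto
    obtain c w where c: "c \<in> \<C>" "x \<in> chart_dom c" "(pr c x, w) \<in> adj ^^ k" "w \<in> W"
      using k(2) unfolding O1_def by auto
    obtain d y where y: "d \<in> \<C>" "y \<in> V" "y \<in> chart_dom d" "w = pr d y" using c(4) unfolding W_def by auto
    have pT: "pr c x \<in> topspace T" "x \<in> pl (pr c x)" "y \<in> pl (pr d y)"
      using pr_in_T[OF \<C>_\<U>] pl_pr[OF \<C>_\<U>] c y by auto
    have path: "(pr c x, pr d y) \<in> adj ^^ R" using adj_pow_mono[OF pT(1) _ kR] c(3) y(4) by auto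
    have yX: "y \<in> topspace X" using y(3) dom_topspace[OF \<C>_\<U>[OF y(1)]] by auto
    have "y \<in> leaf_through \<F> x" unfolding leaf_through_iff using pT path by metis
    moreover have "growth y m \<le> growth x (m + (R + 2))" for m
      by (rule growth_shift[OF x c(1,2) yX y(1,3) path])
    moreover have "growth x m \<le> growth y (m + (R + 2))" for m
      by (rule growth_shift[OF yX y(1,3) x c(1,2) adj_pow_sym[OF path]])
    ultimately show "\<exists>y\<in>V. y \<in> leaf_through \<F> x \<and>
      (\<forall>m. growth x m \<le> growth y (m + (R + 2)) \<and> growth y m \<le> growth x (m + (R + 2)))"
      using y(2) by blast
  qed
qed

lemma leaf_in_X_0: "x \<in> X_0 \<F> \<U> \<Longrightarrow> y \<in> leaf_through \<F> x \<Longrightarrow> y \<in> X_0 \<F> \<U>"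
  using leaf_through_sym[of y x] leaf_through_subset[of x] unfolding X_0_iff by auto

text \<open>Here \<open>S\<close> meets every leaf without holonomy but need not be dense, so
  uniformity has to be gained from Baire's theorem first.\<close>

lemma comparable_X_0_if_minimal:
  assumes min: "minimal_foliation X \<F>" and S: "S \<subseteq> topspace X" "comparable S"
    and meets: "\<And>x. x \<in> X_0 \<F> \<U> \<Longrightarrow> \<exists>y\<in>S. y \<in> leaf_through \<F> x"
  shows "comparable (X_0 \<F> \<U>)"
proof (cases "X_0 \<F> \<U> = {}")
  case True
  then show ?thesis unfolding comparable_def by auto
next
  case False
  then obtain x1 where x1: "x1 \<in> X_0 \<F> \<U>" by auto
  then obtain x0 where x0: "x0 \<in> S" using meets by blast
  define f where "f = growth x0"
  have x0X: "x0 \<in> topspace X" using x0 S(1) by auto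
  have f: "mono f" unfolding f_def using mono_growth x0X .
  obtain A B D where B: "B \<ge> 1"
    and cmp: "\<And>x y m. x \<in> S \<Longrightarrow> y \<in> S \<Longrightarrow> m \<ge> D \<Longrightarrow> growth x m \<le> A * growth y (B * m)"
    using S(2) unfolding comparable_def by metis
  \<comment> \<open>Only the threshold \<open>j\<close> varies with the point. It absorbs the
    distance from \<open>y\<close> to a point of \<open>S\<close> in its leaf, at the price of the
    factor 2 in \<open>2 * B\<close>.\<close>
  define G where "G j = {y \<in> X_0 \<F> \<U>. comparable_with A (2 * B) j f y}" for j
  have cov: "X_0 \<F> \<U> \<subseteq> (\<Union>j. G j)"
  proof
    fix y assume y: "y \<in> X_0 \<F> \<U>"
    have yX: "y \<in> topspace X" using y X_0_iff by auto
    obtain p where p: "p \<in> S" "p \<in> leaf_through \<F> y" using meets[OF y] by auto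
    have pX: "p \<in> topspace X" using p(1) S(1) by auto
    obtain j where j: "\<And>m. growth y m \<le> growth p (m + j)" "\<And>m. growth p m \<le> growth y (m + j)"
      using growth_leaf[OF yX p(2)] by auto
    have "growth y m \<le> A * f ((2 * B) * m) \<and> f m \<le> A * growth y ((2 * B) * m)" if m: "m \<ge> max j D" for m
    proof
      have "growth y m \<le> growth p (m + j)" by (rule j(1))
      also have "\<dots> \<le> growth p (2 * m)" using m by (intro growth_mono pX) auto
      also have "\<dots> \<le> A * f (B * (2 * m))" unfolding f_def using m by (intro cmp p x0) auto
      finally show "growth y m \<le> A * f ((2 * B) * m)" by (simp add: algebra_simps)
      have "m \<le> B * m" using B by (cases B) auto
      then have "j \<le> B * m" using m by linarith
      then have jm: "B * m + j \<le> (2 * B) * m" by simp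
      have "f m \<le> A * growth p (B * m)" unfolding f_def using m by (intro cmp p x0) auto
      also have "\<dots> \<le> A * growth y (B * m + j)" using j(2) by (intro mult_left_mono) auto
      also have "\<dots> \<le> A * growth y ((2 * B) * m)" by (intro mult_left_mono growth_mono yX jm) auto
      finally show "f m \<le> A * growth y ((2 * B) * m)" .
    qed
    then have "y \<in> G (max j D)" unfolding G_def comparable_with_def using y by auto
    then show "y \<in> (\<Union>j. G j)" by auto
  qed
  obtain \<N> where N: "countable \<N>" "\<And>N. N \<in> \<N> \<Longrightarrow> closedin X N" "\<And>N. N \<in> \<N> \<Longrightarrow> X interior_of N = {}"
    "topspace X \<subseteq> X_0 \<F> \<U> \<union> \<Union>\<N>" by (rule X_0_residual) blast
  have "\<exists>j. X interior_of (X closure_of (G j)) \<noteq> {}"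
  proof (rule ccontr)
    assume none: "\<not> ?thesis"
    \<comment> \<open>The first sets cover the complement of \<open>X_0\<close>, the closures cover
      \<open>X_0\<close>. If all had empty interior, \<open>X\<close> would be empty, although it
      contains \<open>x0\<close>.\<close>
    let ?\<G> = "\<N> \<union> range (\<lambda>j. X closure_of (G j))"
    have "X interior_of \<Union>?\<G> = {}"
    proof (rule Baire_category_alt)
      show "completely_metrizable_space X \<or> locally_compact_space X \<and> regular_space X"
        using compact_Hausdorff_imp_regular_space[OF compact Hausdorff] compact_imp_locally_compact_space[OF compact]
        by blast
      show "countable ?\<G>" using N(1) by auto
      show "closedin X N \<and> X interior_of N = {}" if "N \<in> ?\<G>" for N using that N none by auto
    qed
    moreover have "topspace X \<subseteq> \<Union>?\<G>"
    proof
      fix y assume y: "y \<in> topspace X"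
      show "y \<in> \<Union>?\<G>"
      proof (cases "y \<in> X_0 \<F> \<U>")
        case True
        then obtain j where "y \<in> G j" using cov by auto
        moreover have "G j \<subseteq> topspace X" unfolding G_def X_0_iff by auto
        ultimately have "y \<in> X closure_of (G j)" using closure_of_subset by blast
        then show ?thesis by auto
      next
        case False
        then show ?thesis using N(4) y by auto
      qed
    qed
    ultimately have "topspace X = {}"
      using interior_of_maximal[of "topspace X" "\<Union>?\<G>" X] by auto
    then show False using x0X by auto
  qed
  then obtain j where j: "X interior_of (X closure_of (G j)) \<noteq> {}" by auto
  define V where "V = X interior_of (X closure_of (G j))"
  have V: "openin X V" "V \<noteq> {}" "V \<subseteq> X closure_of (G j)"
    unfolding V_def using j by (auto simp: interior_of_subset)
  obtain R where R: "\<And>x. x \<in> topspace X \<Longrightarrow> \<exists>y\<in>V. y \<in> leaf_through \<F> x \<and>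
    (\<forall>m. growth x m \<le> growth y (m + R) \<and> growth y m \<le> growth x (m + R))"
    by (rule minimal_uniform_return[OF min V(1,2)]) blast
  obtain N K where K: "K \<ge> 1" and NK: "\<And>A B D f S y. mono f \<Longrightarrow> B \<ge> 1 \<Longrightarrow>
      \<forall>x\<in>S. comparable_with A B D f x \<Longrightarrow> y \<in> X_0 \<F> \<U> \<Longrightarrow> y \<in> X closure_of S \<Longrightarrow>
      comparable_with (A * N) (2 * K * B) (Suc D) f y"
    using comparable_with_closure by blast
  define A' where "A' = A * N"
  define B' where "B' = 2 * K * (2 * B)"
  have B': "B' \<ge> 1" unfolding B'_def using K B by (simp add: Suc_leI)
  have onV: "growth y m \<le> A' * f (B' * m) \<and> f m \<le> A' * growth y (B' * m)"
    if y: "y \<in> X_0 \<F> \<U>" "y \<in> V" and m: "m \<ge> Suc j" for y m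
  proof -
    have "comparable_with A' B' (Suc j) f y"
      unfolding A'_def B'_def
    proof (rule NK[OF f _ _ y(1)])
      show "\<forall>x\<in>G j. comparable_with A (2 * B) j f x" unfolding G_def by simp
      show "y \<in> X closure_of (G j)" using y(2) V(3) by auto
    qed (use B in auto)
    then show ?thesis using m unfolding comparable_with_def by blast
  qed
  \<comment> \<open>Every \<open>x\<close> is moved within its leaf to a point of \<open>V\<close>,
    where the constants are uniform. The shift is at most \<open>R\<close>, now the same for all
    points, and a second doubling absorbs it.\<close>
  have "comparable_with A' (2 * B') (R + Suc j) f x" if x: "x \<in> X_0 \<F> \<U>" for x
    unfolding comparable_with_def
  proof (intro allI impI conjI)
    fix m assume m: "m \<ge> R + Suc j"
    have xX: "x \<in> topspace X" using x X_0_iff by auto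
    obtain y where y: "y \<in> V" "y \<in> leaf_through \<F> x"
      "\<And>m. growth x m \<le> growth y (m + R)" "\<And>m. growth y m \<le> growth x (m + R)"
      using R[OF xX] by auto
    have y0: "y \<in> X_0 \<F> \<U>" by (rule leaf_in_X_0[OF x y(2)])
    have yX: "y \<in> topspace X" using y0 X_0_iff by auto
    have "growth x m \<le> growth y (m + R)" by (rule y(3))
    also have "\<dots> \<le> growth y (2 * m)" using m by (intro growth_mono yX) auto
    also have "\<dots> \<le> A' * f (B' * (2 * m))" using onV[OF y0 y(1), of "2 * m"] m by auto
    finally show "growth x m \<le> A' * f ((2 * B') * m)" by (simp add: algebra_simps)
    have "m \<le> B' * m" using B' by (cases B') auto
    then have "R \<le> B' * m" using m by linarith
    then have Rm: "B' * m + R \<le> (2 * B') * m" by simp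
    have "f m \<le> A' * growth y (B' * m)" using onV[OF y0 y(1), of m] m by auto
    also have "\<dots> \<le> A' * growth x (B' * m + R)" using y(4) by (intro mult_left_mono) auto
    also have "\<dots> \<le> A' * growth x ((2 * B') * m)" by (intro mult_left_mono growth_mono xX Rm) auto
    finally show "f m \<le> A' * growth x ((2 * B') * m)" .
  qed
  moreover have "2 * B' \<ge> 1" using B' by simp
  ultimately show ?thesis using comparable_if_comparable_with by blast
qed

lemma X_0_subset: "X_0 \<F> \<U> \<subseteq> topspace X"
  using X_0_iff by auto

lemma Union_leaves_in_subset: "\<Union>(leaves_in \<F> Y) \<subseteq> Y"
  unfolding leaves_in_def by auto

lemma leaves_in_nonempty: "L \<in> leaves_in \<F> Y \<Longrightarrow> L \<noteq> {}"
  unfolding leaves_in_def leaves_iff using leaf_through_self by auto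

section \<open>The two implications\<close>

lemma growth_symmetric_imp_equi_equivalent:
  assumes L: "L \<in> leaves_in \<F> (X_0d X \<F> \<U>)" "growth_symmetric \<F> \<U> L"
  shows "equi_equivalent_growth \<F> \<U> (leaves_in \<F> (X_0d X \<F> \<U>))"
proof -
  obtain x where x: "x \<in> topspace X" "L = leaf_through \<F> x" "L \<subseteq> X_0d X \<F> \<U>"
    using L(1) unfolding leaves_in_def leaves_iff by auto
  have "x \<in> X_0d X \<F> \<U>" using x leaf_through_self by auto
  then have dense: "X closure_of L = topspace X" unfolding X_0d_iff dense_leaf_def x(2) by simp
  have LX: "L \<subseteq> topspace X" using leaf_through_subset x(2) by auto
  have "comparable L"
    using comparable_if_equi_dominate[OF LX] L(2) unfolding growth_symmetric_def by simp
  then have "equi_dominate (leaf_growth \<F> \<U> ` X_0 \<F> \<U>)"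
    using equi_dominate_if_comparable[OF X_0_subset] comparable_X_0_if_dense[OF LX _ dense] by simp
  \<comment> \<open>The growth functions are comparable on all of \<open>X_0\<close>, so any choice
    of base points works.\<close>
  moreover define pt where "pt L = (SOME x. x \<in> L)" for L :: "'a set"
  have pt: "pt L \<in> L" if "L \<in> leaves_in \<F> (X_0d X \<F> \<U>)" for L
    unfolding pt_def using leaves_in_nonempty[OF that] by (simp add: some_in_eq)
  have "pt L \<in> X_0 \<F> \<U>" if "L \<in> leaves_in \<F> (X_0d X \<F> \<U>)" for L
    using pt[OF that] that X_0d_iff X_0_iff unfolding leaves_in_def by auto
  then have "(\<lambda>L. leaf_growth \<F> \<U> (pt L)) ` leaves_in \<F> (X_0d X \<F> \<U>) \<subseteq> leaf_growth \<F> \<U> ` X_0 \<F> \<U>"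
    by auto
  ultimately have "equi_dominate ((\<lambda>L. leaf_growth \<F> \<U> (pt L)) ` leaves_in \<F> (X_0d X \<F> \<U>))"
    using equi_dominate_subset by metis
  then show ?thesis unfolding equi_equivalent_growth_def using pt by auto
qed

text \<open>The base points of the leaves play the part of \<open>S\<close>. By minimality each leaf
  without holonomy is dense, so it carries one of them.\<close>

lemma equi_equivalent_imp_equi_growth_symmetric:
  assumes min: "minimal_foliation X \<F>"
    and eq: "equi_equivalent_growth \<F> \<U> (leaves_in \<F> (X_0d X \<F> \<U>))"
  shows "equi_growth_symmetric \<F> \<U> (leaves_in \<F> (X_0 \<F> \<U>))"
proof -
  let ?Ls = "leaves_in \<F> (X_0d X \<F> \<U>)"
  obtain pt where pt: "\<And>L. L \<in> ?Ls \<Longrightarrow> pt L \<in> L"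
    and dom: "equi_dominate ((\<lambda>L. leaf_growth \<F> \<U> (pt L)) ` ?Ls)"
    using eq unfolding equi_equivalent_growth_def by auto
  have sub: "pt ` ?Ls \<subseteq> topspace X"
    using pt X_0d_iff unfolding leaves_in_def by auto
  have "equi_dominate (leaf_growth \<F> \<U> ` (pt ` ?Ls))" using dom by (simp add: image_image)
  then have "comparable (pt ` ?Ls)" by (rule comparable_if_equi_dominate[OF sub])
  moreover have "\<exists>y\<in>pt ` ?Ls. y \<in> leaf_through \<F> x" if x: "x \<in> X_0 \<F> \<U>" for x
  proof -
    have xX: "x \<in> topspace X" using x X_0_iff by auto
    have L: "leaf_through \<F> x \<in> leaves \<F>" using leaves_iff xX by auto
    have "leaf_through \<F> x \<subseteq> X_0d X \<F> \<U>"
    proof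
      fix y assume y: "y \<in> leaf_through \<F> x"
      have "dense_leaf X (leaf_through \<F> y)"
        using min L leaf_through_sym[OF y] unfolding minimal_foliation_def by simp
      then show "y \<in> X_0d X \<F> \<U>" using leaf_in_X_0[OF x y] unfolding X_0_iff X_0d_iff by simp
    qed
    then have "leaf_through \<F> x \<in> ?Ls" using L unfolding leaves_in_def by simp
    then show ?thesis using pt by auto
  qed
  ultimately have "comparable (X_0 \<F> \<U>)" by (intro comparable_X_0_if_minimal[OF min sub]) auto
  then have "equi_dominate (leaf_growth \<F> \<U> ` X_0 \<F> \<U>)"
    by (rule equi_dominate_if_comparable[OF X_0_subset])
  then show ?thesis
    unfolding equi_growth_symmetric_def
    using equi_dominate_subset image_mono[OF Union_leaves_in_subset] by metis
qed

end

theorem theorem1p7: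
  fixes X :: "'a topology" and n :: nat and \<F> \<U> :: "('a, 'z) chart set"
  assumes "compact_Polish_foliated_space X n \<F>"
    and "regular_foliated_atlas X n \<F> \<U>"
  shows "(transitive_foliation X \<F> \<and> (\<exists>L\<in>leaves_in \<F> (X_0d X \<F> \<U>). growth_symmetric \<F> \<U> L)
            \<longrightarrow> equi_equivalent_growth \<F> \<U> (leaves_in \<F> (X_0d X \<F> \<U>)))
       \<and> (minimal_foliation X \<F> \<and> equi_equivalent_growth \<F> \<U> (leaves_in \<F> (X_0d X \<F> \<U>))
            \<longrightarrow> equi_growth_symmetric \<F> \<U> (leaves_in \<F> (X_0 \<F> \<U>)))"
proof -
  interpret regular_foliated_space X n \<F> \<U>
    using assms by unfold_locales
  show ?thesis
    using growth_symmetric_imp_equi_equivalent equi_equivalent_imp_equi_growth_symmetric by blast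
qed

end
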